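(* Let $\xi\in\mathcal{S}^2$ be an optional process which is right upper semicontinuous, and let $g=(g(\omega,t))$ be a progressive process (not depending on $y,z,l$) with $E\big[\int_0^T g(t)^2\,dt\big]<\infty$. Let $(\xi^n)_{n\in\mathbb{N}}$ be a nonincreasing sequence of RCLL optional processes with $\xi^n\ge\xi$, $E[\sup_{t\in[0,T]}(\xi^n_t)^2]<\infty$, $\xi^n\downarrow\xi$ and $\|\xi^n-\xi\|_{\mathcal{S}^2}\to0$. For each $n$ let $(Y^n,Z^n,l^n,A^n)$ be the solution of the RCLL reflected BSDE with driver $g$ and barrier $\xi^n$, and let $Y=\lim_{n\to\infty}Y^n$ be the (decreasing) limit of $(Y^n)$, the convergence holding in $L^2(\Omega\times[0,T],\mathcal{F}_T\otimes\mathcal{B}([0,T]),P\otimes dt)$. Then for each $S\in\mathcal{T}_0$ $$Y_S=\operatorname*{ess\,sup}_{\tau\in\mathcal{T}_S}E\Big[\xi_\tau+\int_S^\tau g(u)\,du\,\Big|\,\mathcal{F}_S\Big]\quad\text{a.s.},$$ and the following hold: (i) $Y=\xi\vee Y^+$ (up to indistinguishability), where $Y^+$ is the process of right limits of $Y$; (ii) $Y_{\tau-}=\big(\limsup_{u\uparrow\tau}\xi_u\big)\vee Y_\tau$ a.s. for all $\tau\in\mathcal{T}_0^p$. Moreover, the convergence of $(Y^n)_{n\in\mathbb{N}}$ to $Y$ holds in $\mathcal{S}^2$.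
   Context: Setting. $T>0$ is fixed; $(E,\mathcal{E})$ is a measurable space with a $\sigma$-finite positive measure $\mu$; $(\Omega,\mathcal{F},P,\mathbb{F}=(\mathcal{F}_t)_{t\ge0})$ is a filtered probability space whose filtration is complete, right continuous and quasi-left continuous, supporting a Brownian motion $W$ and an independent Poisson random measure $N$ with intensity $dt\otimes\mu(de)$; $\tilde N$ is the compensated measure. $\mathcal{T}_0$ (resp. $\mathcal{T}_0^p$) is the set of stopping times (resp. predictable stopping times) with values in $[0,T]$ a.s., and for $S\in\mathcal{T}_0$, $\mathcal{T}_S$ is the set of stopping times $\tau$ with $S\le\tau\le T$ a.s. Spaces. $L^2_\mu$: measurable $\ell:E\to\mathbb{R}$ with $\|\ell\|_\mu^2=\int_E|\ell(e)|^2\mu(de)<\infty$. $\mathbb{H}^2$: predictable $\phi$ with $E\int_0^T\phi_t^2dt<\infty$. $\mathbb{H}^2_\mu$: predictable $\phi_t(\omega,e)$ with $E\int_0^T\|\phi_t\|_\mu^2dt<\infty$. $\mathbb{D}^2$: adapted RCLL processes with $E[\sup_{t\le T}|\phi_t|^2]<\infty$. $\mathcal{S}^2$: real-valued optional processes with $\|\phi\|_{\mathcal{S}^2}^2=E[\operatorname{ess\,sup}_{\tau\in\mathcal{T}_0}|\phi_\tau|^2]<\infty$. $\mathcal{S}^2_{pi}$: real-valued predictable increasing processes $A$ with $A_0=0$, $E(A_T^2)<\infty$. Right upper semicontinuous means: for all $\tau\in\mathcal{T}_0$ and stopping times $\tau_n\downarrow\tau$, $\xi_\tau\ge\limsup_n\xi_{\tau_n}$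 a.s. RCLL reflected BSDE with driver $g$ and barrier $\xi^n$: $(Y^n,Z^n,l^n,A^n)\in\mathbb{D}^2\times\mathbb{H}^2\times\mathbb{H}^2_\mu\times\mathcal{S}^2_{pi}$ with $A^n$ RCLL, such that a.s. for all $t\in[0,T]$, $Y^n_t=\xi^n_T+\int_t^Tg(s)ds-\int_t^TZ^n_sdW_s-\int_t^T\int_El^n_s(e)\tilde N(ds,de)+A^n_T-A^n_t$, $Y^n_t\ge\xi^n_t$, and $\int_0^T(Y^n_{t-}-\xi^n_{t-})dA^n_t=0$. It is known that such a solution exists and that $Y^n\ge Y^{n+1}$. Right limits $Y_{t+}$ are taken for $t<T$ and left limits $Y_{t-}$, $\limsup_{u\uparrow t}$ (over $u<t$) for $t>0$; identities involving $\tau+$ (resp. $\tau-$) are understood on $\{\tau<T\}$ (resp. $\{\tau>0\}$). *)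

theory Defs
  imports "HOL-Probability.Probability"
begin

section \<open>Conventions\<close>

text \<open>
  A process is a function \<open>X :: real \<Rightarrow> 'a \<Rightarrow> real\<close>, time first; only its values on
  \<open>{0..T} \<times> space M\<close> matter. The path properties required of the members of a space of
  processes (RCLL, increasing, null at 0) hold for every \<open>\<omega>\<close>, so that RCLL adapted processes
  are optional; relations between processes hold almost surely, simultaneously in all times.
  Filtrations are indexed by \<open>real\<close> in order to use the library's stopping times; the
  \<open>\<sigma>\<close>-algebras at negative times are required to coincide with that at time 0.
  Stopping times are real valued. Those considered are almost surely bounded by \<open>T\<close>, so the value
  \<open>\<infinity>\<close> would only be taken on a null set, which belongs to \<open>F 0\<close>.
\<close>


section \<open>Filtered probability spaces and stopping times\<close>

definition sigma_at :: "'a measure \<Rightarrow> (real \<Rightarrow> 'a measure) \<Rightarrow> ('a \<Rightarrow> real) \<Rightarrow> 'a measure" where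
  "sigma_at M F \<tau> = filtration.pre_sigma (space M) F \<tau>"

definition sigma_before :: "'a measure \<Rightarrow> (real \<Rightarrow> 'a measure) \<Rightarrow> ('a \<Rightarrow> real) \<Rightarrow> 'a measure" where
  "sigma_before M F \<tau> = sigma (space M)
     (sets (F 0) \<union> {A \<inter> {\<omega> \<in> space M. t < \<tau> \<omega>} | A t. 0 \<le> t \<and> A \<in> sets (F t)})"

text \<open>A time is predictable if it is announced by a sequence \<open>\<sigma>\<close> of stopping times.\<close>

definition predictable_time :: "'a measure \<Rightarrow> (real \<Rightarrow> 'a measure) \<Rightarrow> ('a \<Rightarrow> real) \<Rightarrow> bool" where
  "predictable_time M F \<tau> \<longleftrightarrow>
     stopping_time F \<tau> \<and> (AE \<omega> in M. 0 \<le> \<tau> \<omega>) \<and>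
     (\<exists>\<sigma> :: nat \<Rightarrow> 'a \<Rightarrow> real. (\<forall>n. stopping_time F (\<sigma> n)) \<and>
        (AE \<omega> in M. (\<forall>n. 0 \<le> \<sigma> n \<omega>) \<and> incseq (\<lambda>n. \<sigma> n \<omega>) \<and> (\<lambda>n. \<sigma> n \<omega>) \<longlonglongrightarrow> \<tau> \<omega> \<and>
           (0 < \<tau> \<omega> \<longrightarrow> (\<forall>n. \<sigma> n \<omega> < \<tau> \<omega>))))"

definition filtered_prob_space :: "'a measure \<Rightarrow> (real \<Rightarrow> 'a measure) \<Rightarrow> bool" where
  "filtered_prob_space M F \<longleftrightarrow>
     prob_space M \<and> filtration (space M) F \<and> (\<forall>t. subalgebra M (F t)) \<and>
     (\<forall>t<0. sets (F t) = sets (F 0))"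

definition complete_filtration :: "'a measure \<Rightarrow> (real \<Rightarrow> 'a measure) \<Rightarrow> bool" where
  "complete_filtration M F \<longleftrightarrow> (\<forall>N\<in>null_sets M. \<forall>B\<subseteq>N. B \<in> sets (F 0))"

definition right_continuous_filtration :: "(real \<Rightarrow> 'a measure) \<Rightarrow> bool" where
  "right_continuous_filtration F \<longleftrightarrow> (\<forall>t\<ge>0. sets (F t) = (\<Inter>s\<in>{t<..}. sets (F s)))"

definition quasi_left_continuous :: "'a measure \<Rightarrow> (real \<Rightarrow> 'a measure) \<Rightarrow> bool" where
  "quasi_left_continuous M F \<longleftrightarrow>
     (\<forall>\<tau>. predictable_time M F \<tau> \<longrightarrow> sets (sigma_at M F \<tau>) = sets (sigma_before M F \<tau>))"

definition stopping_times ::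
    "'a measure \<Rightarrow> (real \<Rightarrow> 'a measure) \<Rightarrow> real \<Rightarrow> ('a \<Rightarrow> real) \<Rightarrow> ('a \<Rightarrow> real) set" where
  "stopping_times M F T S = {\<tau>. stopping_time F \<tau> \<and> (AE \<omega> in M. S \<omega> \<le> \<tau> \<omega> \<and> \<tau> \<omega> \<le> T)}"

abbreviation stopping_times0 ::
    "'a measure \<Rightarrow> (real \<Rightarrow> 'a measure) \<Rightarrow> real \<Rightarrow> ('a \<Rightarrow> real) set" where
  "stopping_times0 M F T \<equiv> stopping_times M F T (\<lambda>_. 0)"

definition predictable_times0 ::
    "'a measure \<Rightarrow> (real \<Rightarrow> 'a measure) \<Rightarrow> real \<Rightarrow> ('a \<Rightarrow> real) set" where
  "predictable_times0 M F T = {\<tau> \<in> stopping_times0 M F T. predictable_time M F \<tau>}"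


section \<open>Essential supremum of a family of random variables\<close>

definition is_ess_sup :: "'a measure \<Rightarrow> 'i set \<Rightarrow> ('i \<Rightarrow> 'a \<Rightarrow> ereal) \<Rightarrow> ('a \<Rightarrow> ereal) \<Rightarrow> bool" where
  "is_ess_sup M I f h \<longleftrightarrow>
     h \<in> borel_measurable M \<and> (\<forall>i\<in>I. AE \<omega> in M. f i \<omega> \<le> h \<omega>) \<and>
     (\<forall>k\<in>borel_measurable M. (\<forall>i\<in>I. AE \<omega> in M. f i \<omega> \<le> k \<omega>) \<longrightarrow> (AE \<omega> in M. h \<omega> \<le> k \<omega>))"

text \<open>The essential supremum is unique up to almost sure equality; this is one version of it.\<close>

definition ess_sup :: "'a measure \<Rightarrow> 'i set \<Rightarrow> ('i \<Rightarrow> 'a \<Rightarrow> ereal) \<Rightarrow> 'a \<Rightarrow> ereal" where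
  "ess_sup M I f = (SOME h :: 'a \<Rightarrow> ereal. is_ess_sup M I f h)"

definition squash :: "ereal \<Rightarrow> real" where
  "squash x = (if x = \<infinity> then 2 else if x = -\<infinity> then -2 else arctan (real_of_ereal x))"

lemma squash_le_iff: "squash x \<le> squash y \<longleftrightarrow> x \<le> y"
proof -
  have "- 2 < arctan r \<and> arctan r < 2" for r
    using arctan_lbound[of r] arctan_ubound[of r] pi_less_4 by linarith
  then show ?thesis
    by (cases x; cases y) (auto simp: squash_def arctan_le_iff less_imp_le not_le)
qed

lemma abs_squash_le: "\<bar>squash x\<bar> \<le> 2"
proof -
  have "- 2 < arctan r \<and> arctan r < 2" for r
    using arctan_lbound[of r] arctan_ubound[of r] pi_less_4 by linarith
  from this[of "real_of_ereal x"] show ?thesis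
    by (auto simp: squash_def)
qed

lemma measurable_squash [measurable]: "squash \<in> borel_measurable borel"
proof -
  have [measurable]: "arctan \<in> borel_measurable borel"
    by (intro borel_measurable_continuous_onI continuous_intros)
  have "(\<lambda>x. if x = \<infinity> then 2 else if x = -\<infinity> then -2 else arctan (real_of_ereal x))
          \<in> borel_measurable (borel :: ereal measure)"
    by measurable
  then show ?thesis
    by (simp add: squash_def[abs_def])
qed

lemma ex_is_ess_sup:
  fixes f :: "'i \<Rightarrow> 'a \<Rightarrow> ereal"
  assumes "prob_space M"
  shows "\<exists>h :: 'a \<Rightarrow> ereal. is_ess_sup M I f h"
proof -
  interpret prob_space M by fact
  define K where "K = {k \<in> borel_measurable M. \<forall>i\<in>I. AE \<omega> in M. f i \<omega> \<le> k \<omega>}"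
  define J where "J k = (\<integral>\<omega>. squash (k \<omega>) \<partial>M)" for k :: "'a \<Rightarrow> ereal"
  have int: "integrable M (\<lambda>\<omega>. squash (k \<omega>))" if "k \<in> borel_measurable M" for k
    using that by (intro integrable_const_bound[where B=2]) (auto simp: abs_squash_le)
  have top: "(\<lambda>_. \<infinity>) \<in> K" by (auto simp: K_def)
  have bdd: "bdd_below (J ` K)"
  proof (rule bdd_belowI2)
    fix k assume "k \<in> K"
    then have "(\<integral>\<omega>. -2 \<partial>M) \<le> J k"
      unfolding J_def using abs_squash_le[of "k _"]
      by (intro integral_mono int) (auto simp: K_def abs_le_iff minus_le_iff)
    then show "-2 \<le> J k" by (simp add: prob_space)
  qed
  define b where "b = (INF k\<in>K. J k)"
  have "\<exists>k\<in>K. J k < b + 1 / real (Suc n)" for n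
    using cINF_less_iff[OF _ bdd, of "b + 1 / real (Suc n)"] top by (auto simp: b_def)
  then obtain k where kK: "\<And>n. k n \<in> K" and kb: "\<And>n. J (k n) < b + 1 / real (Suc n)"
    by metis
  define h where "h = (\<lambda>\<omega>. INF n. k n \<omega>)"
  have [measurable]: "k n \<in> borel_measurable M" for n using kK by (auto simp: K_def)
  have hm [measurable]: "h \<in> borel_measurable M" unfolding h_def by measurable
  have hub: "AE \<omega> in M. f i \<omega> \<le> h \<omega>" if "i \<in> I" for i
  proof -
    have "AE \<omega> in M. \<forall>n. f i \<omega> \<le> k n \<omega>"
      using kK that by (auto simp: AE_all_countable K_def)
    then show ?thesis by eventually_elim (auto simp: h_def intro: INF_greatest)
  qed
  have Jh: "J h \<le> b"
  proof (rule field_le_epsilon)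
    fix e :: real assume "0 < e"
    then obtain n where "1 / real (Suc n) < e" using nat_approx_posE by blast
    moreover have "J h \<le> J (k n)"
      unfolding J_def by (intro integral_mono int) (auto simp: squash_le_iff h_def intro: INF_lower)
    ultimately show "J h \<le> b + e" using kb[of n] by linarith
  qed
  have "AE \<omega> in M. h \<omega> \<le> k' \<omega>"
    if k'm: "k' \<in> borel_measurable M" and k'ub: "\<forall>i\<in>I. AE \<omega> in M. f i \<omega> \<le> k' \<omega>" for k'
  proof -
    define m where "m = (\<lambda>\<omega>. min (h \<omega>) (k' \<omega>))"
    have mm [measurable]: "m \<in> borel_measurable M" using k'm by (simp add: m_def)
    have "AE \<omega> in M. f i \<omega> \<le> m \<omega>" if "i \<in> I" for i
      using hub[OF that] k'ub[rule_format, OF that] by eventually_elim (simp add: m_def)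
    then have "m \<in> K" by (simp add: K_def)
    then have "J h \<le> J m" using Jh cINF_lower[OF bdd] by (force simp: b_def)
    moreover have le: "squash (m \<omega>) \<le> squash (h \<omega>)" for \<omega>
      by (simp add: squash_le_iff m_def)
    moreover have "J m \<le> J h" unfolding J_def by (intro integral_mono int mm hm le)
    ultimately have "(\<integral>\<omega>. squash (h \<omega>) - squash (m \<omega>) \<partial>M) = 0"
      using int[OF hm] int[OF mm] by (simp add: J_def)
    then have "AE \<omega> in M. squash (h \<omega>) - squash (m \<omega>) = 0"
      using int[OF hm] int[OF mm] le by (subst (asm) integral_nonneg_eq_0_iff_AE) auto
    then show ?thesis
    proof eventually_elim
      case (elim \<omega>)
      then have "h \<omega> \<le> m \<omega>" by (simp flip: squash_le_iff)
      then show ?case by (simp add: m_def)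
    qed
  qed
  then have "is_ess_sup M I f h" by (auto simp: is_ess_sup_def hub)
  then show ?thesis by (rule exI[of _ h])
qed

lemma is_ess_sup_ess_sup: "prob_space M \<Longrightarrow> is_ess_sup M I f (ess_sup M I f)"
  unfolding ess_sup_def by (rule ex_is_ess_sup[THEN someI_ex])


section \<open>Path properties, optional and predictable processes\<close>

definition rcll_on :: "real \<Rightarrow> (real \<Rightarrow> real) \<Rightarrow> bool" where
  "rcll_on T x \<longleftrightarrow>
     (\<forall>t\<in>{0..<T}. (x \<longlongrightarrow> x t) (at_right t)) \<and> (\<forall>t\<in>{0<..T}. \<exists>y. (x \<longlongrightarrow> y) (at_left t))"

definition rcll_process :: "'a measure \<Rightarrow> real \<Rightarrow> (real \<Rightarrow> 'a \<Rightarrow> real) \<Rightarrow> bool" where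
  "rcll_process M T X \<longleftrightarrow> (\<forall>\<omega>\<in>space M. rcll_on T (\<lambda>t. X t \<omega>))"

definition adapted_process :: "(real \<Rightarrow> 'a measure) \<Rightarrow> real \<Rightarrow> (real \<Rightarrow> 'a \<Rightarrow> real) \<Rightarrow> bool" where
  "adapted_process F T X \<longleftrightarrow> (\<forall>t\<in>{0..T}. X t \<in> borel_measurable (F t))"

definition optional_sigma :: "'a measure \<Rightarrow> (real \<Rightarrow> 'a measure) \<Rightarrow> real \<Rightarrow> (real \<times> 'a) measure" where
  "optional_sigma M F T = sigma ({0..T} \<times> space M)
     {{(t, \<omega>) \<in> {0..T} \<times> space M. X t \<omega> \<in> B} | X B.
        rcll_process M T X \<and> adapted_process F T X \<and> B \<in> sets borel}"

definition predictable_sigma :: "'a measure \<Rightarrow> (real \<Rightarrow> 'a measure) \<Rightarrow> real \<Rightarrow> (real \<times> 'a) measure" where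
  "predictable_sigma M F T = sigma ({0..T} \<times> space M)
     ({{0} \<times> A | A. A \<in> sets (F 0)} \<union>
      {{s<..t} \<times> A | s t A. 0 \<le> s \<and> s \<le> t \<and> t \<le> T \<and> A \<in> sets (F s)})"

definition optional_process ::
    "'a measure \<Rightarrow> (real \<Rightarrow> 'a measure) \<Rightarrow> real \<Rightarrow> (real \<Rightarrow> 'a \<Rightarrow> real) \<Rightarrow> bool" where
  "optional_process M F T X \<longleftrightarrow> (\<lambda>(t, \<omega>). X t \<omega>) \<in> borel_measurable (optional_sigma M F T)"

definition predictable_process ::
    "'a measure \<Rightarrow> (real \<Rightarrow> 'a measure) \<Rightarrow> real \<Rightarrow> (real \<Rightarrow> 'a \<Rightarrow> real) \<Rightarrow> bool" where
  "predictable_process M F T X \<longleftrightarrow> (\<lambda>(t, \<omega>). X t \<omega>) \<in> borel_measurable (predictable_sigma M F T)"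

definition progressive_process :: "(real \<Rightarrow> 'a measure) \<Rightarrow> real \<Rightarrow> (real \<Rightarrow> 'a \<Rightarrow> real) \<Rightarrow> bool" where
  "progressive_process F T X \<longleftrightarrow>
     (\<forall>t\<in>{0..T}. (\<lambda>(s, \<omega>). X s \<omega>) \<in> borel_measurable (restrict_space borel {0..t} \<Otimes>\<^sub>M F t))"

definition right_usc ::
    "'a measure \<Rightarrow> (real \<Rightarrow> 'a measure) \<Rightarrow> real \<Rightarrow> (real \<Rightarrow> 'a \<Rightarrow> real) \<Rightarrow> bool" where
  "right_usc M F T X \<longleftrightarrow>
     (\<forall>\<tau>\<in>stopping_times0 M F T. \<forall>\<sigma> :: nat \<Rightarrow> 'a \<Rightarrow> real.
        (\<forall>n. \<sigma> n \<in> stopping_times0 M F T) \<and>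
        (AE \<omega> in M. decseq (\<lambda>n. \<sigma> n \<omega>) \<and> (\<lambda>n. \<sigma> n \<omega>) \<longlonglongrightarrow> \<tau> \<omega>) \<longrightarrow>
        (AE \<omega> in M. limsup (\<lambda>n. ereal (X (\<sigma> n \<omega>) \<omega>)) \<le> ereal (X (\<tau> \<omega>) \<omega>)))"


section \<open>Spaces of processes\<close>

text \<open>The norms are represented by their squares, with values in \<open>[0, \<infinity>]\<close>.\<close>

definition S2_norm_sq ::
    "'a measure \<Rightarrow> (real \<Rightarrow> 'a measure) \<Rightarrow> real \<Rightarrow> (real \<Rightarrow> 'a \<Rightarrow> real) \<Rightarrow> ennreal" where
  "S2_norm_sq M F T X =
     (\<integral>\<^sup>+\<omega>. e2ennreal (ess_sup M (stopping_times0 M F T) (\<lambda>\<tau> \<omega>. ereal (\<bar>X (\<tau> \<omega>) \<omega>\<bar>\<^sup>2)) \<omega>) \<partial>M)"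

definition in_S2 :: "'a measure \<Rightarrow> (real \<Rightarrow> 'a measure) \<Rightarrow> real \<Rightarrow> (real \<Rightarrow> 'a \<Rightarrow> real) \<Rightarrow> bool" where
  "in_S2 M F T X \<longleftrightarrow> optional_process M F T X \<and> S2_norm_sq M F T X < \<infinity>"

definition sup_norm_sq :: "'a measure \<Rightarrow> real \<Rightarrow> (real \<Rightarrow> 'a \<Rightarrow> real) \<Rightarrow> ennreal" where
  "sup_norm_sq M T X = (\<integral>\<^sup>+\<omega>. (SUP t\<in>{0..T}. ennreal (\<bar>X t \<omega>\<bar>\<^sup>2)) \<partial>M)"

definition in_D2 :: "'a measure \<Rightarrow> (real \<Rightarrow> 'a measure) \<Rightarrow> real \<Rightarrow> (real \<Rightarrow> 'a \<Rightarrow> real) \<Rightarrow> bool" where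
  "in_D2 M F T X \<longleftrightarrow> adapted_process F T X \<and> rcll_process M T X \<and> sup_norm_sq M T X < \<infinity>"

definition H2_norm_sq :: "'a measure \<Rightarrow> real \<Rightarrow> (real \<Rightarrow> 'a \<Rightarrow> real) \<Rightarrow> ennreal" where
  "H2_norm_sq M T X = (\<integral>\<^sup>+\<omega>. (\<integral>\<^sup>+t\<in>{0..T}. ennreal ((X t \<omega>)\<^sup>2) \<partial>lborel) \<partial>M)"

definition in_H2 :: "'a measure \<Rightarrow> (real \<Rightarrow> 'a measure) \<Rightarrow> real \<Rightarrow> (real \<Rightarrow> 'a \<Rightarrow> real) \<Rightarrow> bool" where
  "in_H2 M F T X \<longleftrightarrow> predictable_process M F T X \<and> H2_norm_sq M T X < \<infinity>"

definition H2mu_norm_sq ::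
    "'a measure \<Rightarrow> real \<Rightarrow> 'e measure \<Rightarrow> (real \<Rightarrow> 'a \<Rightarrow> 'e \<Rightarrow> real) \<Rightarrow> ennreal" where
  "H2mu_norm_sq M T \<mu> l =
     (\<integral>\<^sup>+\<omega>. (\<integral>\<^sup>+t\<in>{0..T}. (\<integral>\<^sup>+e. ennreal (\<bar>l t \<omega> e\<bar>\<^sup>2) \<partial>\<mu>) \<partial>lborel) \<partial>M)"

definition in_H2mu ::
    "'a measure \<Rightarrow> (real \<Rightarrow> 'a measure) \<Rightarrow> real \<Rightarrow> 'e measure \<Rightarrow>
     (real \<Rightarrow> 'a \<Rightarrow> 'e \<Rightarrow> real) \<Rightarrow> bool" where
  "in_H2mu M F T \<mu> l \<longleftrightarrow>
     (\<lambda>((t, \<omega>), e). l t \<omega> e) \<in> borel_measurable (predictable_sigma M F T \<Otimes>\<^sub>M \<mu>) \<and>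
     H2mu_norm_sq M T \<mu> l < \<infinity>"

definition in_S2pi :: "'a measure \<Rightarrow> (real \<Rightarrow> 'a measure) \<Rightarrow> real \<Rightarrow> (real \<Rightarrow> 'a \<Rightarrow> real) \<Rightarrow> bool" where
  "in_S2pi M F T A \<longleftrightarrow>
     predictable_process M F T A \<and>
     (\<forall>\<omega>\<in>space M. A 0 \<omega> = 0 \<and> mono_on {0..T} (\<lambda>t. A t \<omega>)) \<and>
     (\<integral>\<^sup>+\<omega>. ennreal ((A T \<omega>)\<^sup>2) \<partial>M) < \<infinity>"

definition converges_in_L2 :: "'b measure \<Rightarrow> (nat \<Rightarrow> 'b \<Rightarrow> real) \<Rightarrow> ('b \<Rightarrow> real) \<Rightarrow> bool" where
  "converges_in_L2 R f h \<longleftrightarrow>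
     (\<forall>n. f n \<in> borel_measurable R \<and> (\<integral>\<^sup>+x. ennreal ((f n x)\<^sup>2) \<partial>R) < \<infinity>) \<and>
     h \<in> borel_measurable R \<and> (\<integral>\<^sup>+x. ennreal ((h x)\<^sup>2) \<partial>R) < \<infinity> \<and>
     (\<lambda>n. \<integral>\<^sup>+x. ennreal ((f n x - h x)\<^sup>2) \<partial>R) \<longlonglongrightarrow> 0"


section \<open>Brownian motion and Poisson random measure\<close>

definition generated_events ::
    "'a measure \<Rightarrow> 'i set \<Rightarrow> ('i \<Rightarrow> 'a \<Rightarrow> 'b::topological_space) \<Rightarrow> 'a set set" where
  "generated_events M I X =
     sigma_sets (space M) {X i -` B \<inter> space M | i B. i \<in> I \<and> B \<in> sets borel}"

definition brownian_motion :: "'a measure \<Rightarrow> (real \<Rightarrow> 'a measure) \<Rightarrow> (real \<Rightarrow> 'a \<Rightarrow> real) \<Rightarrow> bool" where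
  "brownian_motion M F W \<longleftrightarrow>
     (\<forall>t\<ge>0. W t \<in> borel_measurable (F t)) \<and>
     (AE \<omega> in M. W 0 \<omega> = 0 \<and> continuous_on {0..} (\<lambda>t. W t \<omega>)) \<and>
     (\<forall>s t. 0 \<le> s \<and> s < t \<longrightarrow>
        distributed M lborel (\<lambda>\<omega>. W t \<omega> - W s \<omega>) (\<lambda>x. ennreal (normal_density 0 (sqrt (t - s)) x)) \<and>
        prob_space.indep_set M (sets (F s))
          (generated_events M {()} (\<lambda>_ \<omega>. W t \<omega> - W s \<omega>)))"

definition time_mark_space :: "'e measure \<Rightarrow> (real \<times> 'e) measure" where
  "time_mark_space \<mu> = restrict_space lborel {0..} \<Otimes>\<^sub>M \<mu>"

text \<open>
  Poisson random measure with respect to \<open>F\<close>, with intensity \<open>dt \<otimes> \<mu>(de)\<close>. The Poisson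
  probabilities are written out because \<open>poisson_pmf\<close> is unspecified at rate 0.
\<close>

definition poisson_random_measure ::
    "'a measure \<Rightarrow> (real \<Rightarrow> 'a measure) \<Rightarrow> 'e measure \<Rightarrow> ('a \<Rightarrow> (real \<times> 'e) measure) \<Rightarrow> bool" where
  "poisson_random_measure M F \<mu> N \<longleftrightarrow>
     (\<forall>\<omega>\<in>space M. sets (N \<omega>) = sets (time_mark_space \<mu>)) \<and>
     (\<forall>B\<in>sets (time_mark_space \<mu>). (\<lambda>\<omega>. emeasure (N \<omega>) B) \<in> borel_measurable M) \<and>
     (\<forall>B\<in>sets (time_mark_space \<mu>). emeasure (time_mark_space \<mu>) B < \<infinity> \<longrightarrow>
        (\<forall>k::nat. measure M {\<omega> \<in> space M. emeasure (N \<omega>) B = of_nat k} =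
           exp (- measure (time_mark_space \<mu>) B) * measure (time_mark_space \<mu>) B ^ k / fact k)) \<and>
     (\<forall>B n. (\<forall>i<n::nat. B i \<in> sets (time_mark_space \<mu>)) \<and> disjoint_family_on B {..<n} \<longrightarrow>
        prob_space.indep_vars M (\<lambda>_. borel) (\<lambda>i \<omega>. emeasure (N \<omega>) (B i)) {..<n}) \<and>
     (\<forall>t\<ge>0. \<forall>B\<in>sets (time_mark_space \<mu>). B \<subseteq> {0..t} \<times> space \<mu> \<longrightarrow>
        (\<lambda>\<omega>. emeasure (N \<omega>) B) \<in> borel_measurable (F t)) \<and>
     (\<forall>s\<ge>0. prob_space.indep_set M (sets (F s))
        (generated_events M {B \<in> sets (time_mark_space \<mu>). B \<subseteq> {s<..} \<times> space \<mu>}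
           (\<lambda>B \<omega>. emeasure (N \<omega>) B)))"

definition independent_noises ::
    "'a measure \<Rightarrow> 'e measure \<Rightarrow> (real \<Rightarrow> 'a \<Rightarrow> real) \<Rightarrow> ('a \<Rightarrow> (real \<times> 'e) measure) \<Rightarrow> bool" where
  "independent_noises M \<mu> W N \<longleftrightarrow>
     prob_space.indep_set M
       (generated_events M {0..} W)
       (generated_events M (sets (time_mark_space \<mu>)) (\<lambda>B \<omega>. emeasure (N \<omega>) B))"

definition compensated ::
    "'e measure \<Rightarrow> ('a \<Rightarrow> (real \<times> 'e) measure) \<Rightarrow> 'a \<Rightarrow> (real \<times> 'e) set \<Rightarrow> real" where
  "compensated \<mu> N \<omega> C = measure (N \<omega>) C - measure (time_mark_space \<mu>) C"


section \<open>Stochastic integrals\<close>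

text \<open>
  Both integrals are the \<open>L\<^sup>2\<close>-extensions of the elementary integrals of simple predictable
  integrands. A list entry \<open>(s, t, H)\<close> stands for the integrand equal to \<open>H\<close> on \<open>(s, t]\<close>,
  an entry \<open>(s, t, B, H)\<close> for the one equal to \<open>H\<close> on \<open>(s, t] \<times> B\<close>. The integral processes
  are determined up to indistinguishability.
\<close>

definition simple_W_integrand ::
    "'a measure \<Rightarrow> (real \<Rightarrow> 'a measure) \<Rightarrow> real \<Rightarrow> (real \<times> real \<times> ('a \<Rightarrow> real)) list \<Rightarrow> bool" where
  "simple_W_integrand M F T xs \<longleftrightarrow>
     (\<forall>(s, t, H)\<in>set xs. 0 \<le> s \<and> s \<le> t \<and> t \<le> T \<and>
        H \<in> borel_measurable (F s) \<and> bounded (H ` space M))"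

definition simple_W_value :: "(real \<times> real \<times> ('a \<Rightarrow> real)) list \<Rightarrow> real \<Rightarrow> 'a \<Rightarrow> real" where
  "simple_W_value xs u \<omega> = (\<Sum>(s, t, H)\<leftarrow>xs. H \<omega> * indicator {s<..t} u)"

definition simple_W_integral ::
    "(real \<Rightarrow> 'a \<Rightarrow> real) \<Rightarrow> (real \<times> real \<times> ('a \<Rightarrow> real)) list \<Rightarrow> real \<Rightarrow> 'a \<Rightarrow> real" where
  "simple_W_integral W xs r \<omega> =
     (\<Sum>(s, t, H)\<leftarrow>xs. H \<omega> * (W (min t r) \<omega> - W (min s r) \<omega>))"

definition is_W_integral ::
    "'a measure \<Rightarrow> (real \<Rightarrow> 'a measure) \<Rightarrow> real \<Rightarrow> (real \<Rightarrow> 'a \<Rightarrow> real) \<Rightarrow>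
     (real \<Rightarrow> 'a \<Rightarrow> real) \<Rightarrow> (real \<Rightarrow> 'a \<Rightarrow> real) \<Rightarrow> bool" where
  "is_W_integral M F T W Z I \<longleftrightarrow>
     adapted_process F T I \<and> (AE \<omega> in M. continuous_on {0..T} (\<lambda>t. I t \<omega>)) \<and>
     (\<exists>xs :: nat \<Rightarrow> (real \<times> real \<times> ('a \<Rightarrow> real)) list.
        (\<forall>n. simple_W_integrand M F T (xs n)) \<and>
        (\<lambda>n. H2_norm_sq M T (\<lambda>t \<omega>. Z t \<omega> - simple_W_value (xs n) t \<omega>)) \<longlonglongrightarrow> 0 \<and>
        (\<forall>t\<in>{0..T}.
          (\<lambda>n. \<integral>\<^sup>+\<omega>. ennreal ((I t \<omega> - simple_W_integral W (xs n) t \<omega>)\<^sup>2) \<partial>M) \<longlonglongrightarrow> 0))"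

definition simple_N_integrand ::
    "'a measure \<Rightarrow> (real \<Rightarrow> 'a measure) \<Rightarrow> real \<Rightarrow> 'e measure \<Rightarrow>
     (real \<times> real \<times> 'e set \<times> ('a \<Rightarrow> real)) list \<Rightarrow> bool" where
  "simple_N_integrand M F T \<mu> xs \<longleftrightarrow>
     (\<forall>(s, t, B, H)\<in>set xs. 0 \<le> s \<and> s \<le> t \<and> t \<le> T \<and>
        B \<in> sets \<mu> \<and> emeasure \<mu> B < \<infinity> \<and>
        H \<in> borel_measurable (F s) \<and> bounded (H ` space M))"

definition simple_N_value ::
    "(real \<times> real \<times> 'e set \<times> ('a \<Rightarrow> real)) list \<Rightarrow> real \<Rightarrow> 'a \<Rightarrow> 'e \<Rightarrow> real" where
  "simple_N_value xs u \<omega> e = (\<Sum>(s, t, B, H)\<leftarrow>xs. H \<omega> * indicator {s<..t} u * indicator B e)"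

definition simple_N_integral ::
    "'e measure \<Rightarrow> ('a \<Rightarrow> (real \<times> 'e) measure) \<Rightarrow>
     (real \<times> real \<times> 'e set \<times> ('a \<Rightarrow> real)) list \<Rightarrow> real \<Rightarrow> 'a \<Rightarrow> real" where
  "simple_N_integral \<mu> N xs r \<omega> =
     (\<Sum>(s, t, B, H)\<leftarrow>xs. H \<omega> * compensated \<mu> N \<omega> ({min s r<..min t r} \<times> B))"

definition is_N_integral ::
    "'a measure \<Rightarrow> (real \<Rightarrow> 'a measure) \<Rightarrow> real \<Rightarrow> 'e measure \<Rightarrow>
     ('a \<Rightarrow> (real \<times> 'e) measure) \<Rightarrow> (real \<Rightarrow> 'a \<Rightarrow> 'e \<Rightarrow> real) \<Rightarrow>
     (real \<Rightarrow> 'a \<Rightarrow> real) \<Rightarrow> bool" where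
  "is_N_integral M F T \<mu> N l J \<longleftrightarrow>
     adapted_process F T J \<and> (AE \<omega> in M. rcll_on T (\<lambda>t. J t \<omega>)) \<and>
     (\<exists>xs :: nat \<Rightarrow> (real \<times> real \<times> 'e set \<times> ('a \<Rightarrow> real)) list.
        (\<forall>n. simple_N_integrand M F T \<mu> (xs n)) \<and>
        (\<lambda>n. H2mu_norm_sq M T \<mu> (\<lambda>t \<omega> e. l t \<omega> e - simple_N_value (xs n) t \<omega> e)) \<longlonglongrightarrow> 0 \<and>
        (\<forall>t\<in>{0..T}.
          (\<lambda>n. \<integral>\<^sup>+\<omega>. ennreal ((J t \<omega> - simple_N_integral \<mu> N (xs n) t \<omega>)\<^sup>2) \<partial>M) \<longlonglongrightarrow> 0))"


section \<open>Reflected BSDE with RCLL barrier and driver not depending on the solution\<close>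

text \<open>
  The Stieltjes measure on \<open>(0, T]\<close> of an increasing right-continuous function on \<open>[0, T]\<close>,
  which is extended by constants to the whole line.
\<close>

definition stieltjes_measure :: "real \<Rightarrow> (real \<Rightarrow> real) \<Rightarrow> real measure" where
  "stieltjes_measure T a = interval_measure (\<lambda>t. a (max 0 (min t T)))"

text \<open>
  In the Skorokhod condition the integrand is the left-limit function of an RCLL path, hence
  bounded and Borel on \<open>(0, T]\<close>, so the integral exists.
\<close>

definition rbsde_solution ::
    "'a measure \<Rightarrow> (real \<Rightarrow> 'a measure) \<Rightarrow> real \<Rightarrow> 'e measure \<Rightarrow>
     (real \<Rightarrow> 'a \<Rightarrow> real) \<Rightarrow> ('a \<Rightarrow> (real \<times> 'e) measure) \<Rightarrow>
     (real \<Rightarrow> 'a \<Rightarrow> real) \<Rightarrow> (real \<Rightarrow> 'a \<Rightarrow> real) \<Rightarrow>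
     (real \<Rightarrow> 'a \<Rightarrow> real) \<Rightarrow> (real \<Rightarrow> 'a \<Rightarrow> real) \<Rightarrow> (real \<Rightarrow> 'a \<Rightarrow> 'e \<Rightarrow> real) \<Rightarrow>
     (real \<Rightarrow> 'a \<Rightarrow> real) \<Rightarrow> bool" where
  "rbsde_solution M F T \<mu> W N g \<xi> Y Z l A \<longleftrightarrow>
     in_D2 M F T Y \<and> in_H2 M F T Z \<and> in_H2mu M F T \<mu> l \<and>
     in_S2pi M F T A \<and> rcll_process M T A \<and>
     (\<exists>I J. is_W_integral M F T W Z I \<and> is_N_integral M F T \<mu> N l J \<and>
        (AE \<omega> in M. \<forall>t\<in>{0..T}.
           Y t \<omega> = \<xi> T \<omega> + (LINT s:{t..T}|lborel. g s \<omega>)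
                   - (I T \<omega> - I t \<omega>) - (J T \<omega> - J t \<omega>) + A T \<omega> - A t \<omega>)) \<and>
     (AE \<omega> in M. \<forall>t\<in>{0..T}. \<xi> t \<omega> \<le> Y t \<omega>) \<and>
     (AE \<omega> in M.
        (LINT t:{0<..T}|stieltjes_measure T (\<lambda>t. A t \<omega>).
           Lim (at_left t) (\<lambda>u. Y u \<omega>) - Lim (at_left t) (\<lambda>u. \<xi> u \<omega>)) = 0)"

end

theory Submission
  imports Defs
begin

text \<open>
  Adding the primitive \<open>G\<close> of the driver turns \<open>Y\<^sup>n + G\<close> into a supermartingale \<open>m\<^sup>n - A\<^sup>n\<close>.
  The martingale \<open>m\<^sup>n\<close> consists of the two stochastic integrals, which inherit the martingale property
  from simple integrands because the increments of \<open>W\<close> and of the compensated measure are centred and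
  independent of the past. By optional sampling, \<open>Y\<^sup>n\<close> at a time \<open>S\<close> dominates the value of
  stopping at any later time (\<open>supermartingale\<close>). Up to the first time at which \<open>Y\<^sup>n\<close> is within
  \<open>\<epsilon>\<close> of \<open>\<xi>\<^sup>n\<close>, the flat-off condition prevents \<open>A\<^sup>n\<close> from increasing, so this time is optimal up to
  \<open>\<epsilon>\<close> (\<open>almost_optimal_time\<close>).

  Using this time also for a smaller barrier \<open>\<xi>\<^sup>m\<close> costs at most the uniform distance of the barriers,
  which bounds \<open>Y\<^sup>n - Y\<^sup>m\<close> at any stopping time by a conditional expectation. At the first time at
  which \<open>Y\<^sup>n - Y\<^sup>m\<close> exceeds a given level, this is a weak maximal inequality, and Doob's argument gives
  \<open>E[sup\<^sub>t (Y\<^sup>n\<^sub>t - Y\<^sup>m\<^sub>t)\<^sup>2] \<le> 4 E[sup\<^sub>t (\<xi>\<^sup>n\<^sub>t - \<xi>\<^sup>m\<^sub>t)\<^sup>2]\<close> (\<open>reflected_maximal_inequality\<close>).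

  The decisive observation is that the convergence of the barriers is uniform in time
  (\<open>barrier_bound\<close>). The essential supremum in the \<open>S\<^sup>2\<close>-norm bounds \<open>\<xi>\<^sup>n - \<xi>\<close> simultaneously at
  countably many times only, but these may be dense. For \<open>m \<ge> n\<close> it therefore bounds the smaller
  difference \<open>\<xi>\<^sup>n - \<xi>\<^sup>m\<close>, which is right-continuous, at all times; letting \<open>m\<close> tend to infinity, it
  bounds \<open>\<xi>\<^sup>n - \<xi>\<close> at all times. By the maximal inequality \<open>Y\<^sup>n\<close> converges to \<open>Y\<close> uniformly in time as
  well (\<open>solution_bound\<close>). Hence almost all paths of \<open>\<xi>\<close> and \<open>Y\<close> are uniform limits of
  right-continuous paths with left limits and are themselves of this kind. This gives the convergence
  in \<open>S\<^sup>2\<close>, and (i) becomes \<open>Y \<ge> \<xi>\<close>. Passing to the limit in the two halves of the optimal stopping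
  problem for \<open>\<xi>\<^sup>n\<close> represents \<open>Y\<close> as the value of the problem for \<open>\<xi>\<close>.

  For (ii), quasi-left-continuity makes \<open>m\<^sup>n\<close> continuous at predictable times
  (\<open>martingale_no_predictable_jump\<close>). There \<open>Y\<^sup>n\<close> can thus only jump downwards, by the jump of \<open>A\<^sup>n\<close>,
  and only if its left limit is that of the barrier. So the left limit of \<open>Y\<^sup>n\<close> is the maximum of the
  left limit of \<open>\<xi>\<^sup>n\<close> and the value of \<open>Y\<^sup>n\<close>, and uniform convergence carries this identity over
  to \<open>Y\<close>.
\<close>


section \<open>Right-continuous paths with left limits\<close>

lemma rcll_onD_right: "rcll_on T x \<Longrightarrow> 0 \<le> t \<Longrightarrow> t < T \<Longrightarrow> (x \<longlongrightarrow> x t) (at_right t)"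
  by (auto simp: rcll_on_def)

lemma rcll_onD_left:
  assumes "rcll_on T x" "0 < t" "t \<le> T"
  shows "(x \<longlongrightarrow> Lim (at_left t) x) (at_left t)"
proof -
  obtain y where "(x \<longlongrightarrow> y) (at_left t)" using assms unfolding rcll_on_def by (metis greaterThanAtMost_iff)
  then show ?thesis by (metis tendsto_Lim trivial_limit_at_left_real)
qed

lemma rcll_on_add: "rcll_on T x \<Longrightarrow> rcll_on T y \<Longrightarrow> rcll_on T (\<lambda>t. x t + y t)"
  unfolding rcll_on_def by (blast intro: tendsto_add)

lemma rcll_on_diff: "rcll_on T x \<Longrightarrow> rcll_on T y \<Longrightarrow> rcll_on T (\<lambda>t. x t - y t)"
  unfolding rcll_on_def by (blast intro: tendsto_diff)

lemma rcll_on_continuous: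
  assumes "continuous_on {0..T} x"
  shows "rcll_on T x"
  unfolding rcll_on_def
proof (intro conjI ballI)
  fix t assume t: "t \<in> {0..<T}"
  then have "(x \<longlongrightarrow> x t) (at t within {0..T})"
    using assms by (auto simp: continuous_on_def)
  then have "(x \<longlongrightarrow> x t) (at t within {t..T})"
    by (rule tendsto_within_subset) (use t in auto)
  then show "(x \<longlongrightarrow> x t) (at_right t)"
    using t by (simp add: at_within_Icc_at_right)
next
  fix t assume t: "t \<in> {0<..T}"
  then have "(x \<longlongrightarrow> x t) (at t within {0..T})"
    using assms by (auto simp: continuous_on_def)
  then have "(x \<longlongrightarrow> x t) (at t within {0..t})"
    by (rule tendsto_within_subset) (use t in auto)
  then show "\<exists>y. (x \<longlongrightarrow> y) (at_left t)"
    using t by (auto simp: at_within_Icc_at_left)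
qed

lemma right_limit_seq:
  fixes x :: "real \<Rightarrow> real"
  assumes lim: "t < T \<Longrightarrow> (x \<longlongrightarrow> x t) (at_right t)"
    and s: "s \<longlonglongrightarrow> t" "\<And>k::nat. t \<le> s k" "\<And>k. s k \<le> T"
  shows "(\<lambda>k. x (s k)) \<longlonglongrightarrow> x t"
proof (cases "t < T")
  case True
  have "at t within {t..} = at_right t"
    by (simp add: at_within_def) (rule arg_cong[where f="\<lambda>A. inf (nhds t) (principal A)"], auto)
  then have "continuous (at t within {t..}) x"
    using lim[OF True] by (simp add: continuous_within)
  then show ?thesis
    using s by (auto simp: continuous_within_sequentially o_def)
next
  case False
  then have "s k = t" for k using s(2)[of k] s(3)[of k] by simp
  then show ?thesis by simp
qed

lemma rcll_bounded:
  assumes "rcll_on T x"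
  shows "bounded (x ` {0..T})"
proof (cases "0 \<le> T")
  case True
  define P where "P a b = bounded (x ` ({a..b} \<inter> {0..T}))" for a b
  have "P 0 T"
    using True
  proof (induction rule: Bolzano)
    case (trans a b c)
    have "{a..c} \<inter> {0..T} \<subseteq> ({a..b} \<inter> {0..T}) \<union> ({b..c} \<inter> {0..T})" by auto
    then have "x ` ({a..c} \<inter> {0..T}) \<subseteq> x ` ({a..b} \<inter> {0..T}) \<union> x ` ({b..c} \<inter> {0..T})"
      by (metis image_Un image_mono)
    then show ?case
      using trans unfolding P_def by (meson bounded_Un bounded_subset)
  next
    case (local t)
    \<comment> \<open>Near \<open>t\<close> the path stays within distance 1 of its right and left limits.\<close>
    have "\<exists>y. \<forall>\<^sub>F s in at_right t. s \<le> T \<longrightarrow> dist (x s) y < 1"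
    proof (cases "t < T")
      case True
      then have "(x \<longlongrightarrow> x t) (at_right t)" using assms local by (auto simp: rcll_on_def)
      from tendstoD[OF this, of 1] show ?thesis
        by (intro exI[of _ "x t"]) (auto elim: eventually_mono)
    next
      case False
      have "\<forall>\<^sub>F s in at_right t. t < s" by (simp add: eventually_at_right_less)
      then show ?thesis using False by (intro exI[of _ 0]) (auto elim!: eventually_mono)
    qed
    then obtain y d where d: "d > 0" "\<And>s. t < s \<Longrightarrow> s < t + d \<Longrightarrow> s \<le> T \<Longrightarrow> dist (x s) y < 1"
      unfolding eventually_at_right_field
      by (metis add.commute diff_add_cancel diff_gt_0_iff_gt)
    have "\<exists>y. \<forall>\<^sub>F s in at_left t. 0 \<le> s \<longrightarrow> dist (x s) y < 1"
    proof (cases "0 < t")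
      case True
      with assms local obtain y where "(x \<longlongrightarrow> y) (at_left t)"
        unfolding rcll_on_def by (metis greaterThanAtMost_iff)
      from tendstoD[OF this, of 1] show ?thesis
        by (intro exI[of _ y]) (auto elim: eventually_mono)
    next
      case False
      have "\<forall>\<^sub>F s in at_left t. s < t" by (simp add: eventually_at_left_field) (use lt_ex in blast)
      then show ?thesis using False by (intro exI[of _ 0]) (auto elim!: eventually_mono)
    qed
    then obtain z b where "b < t" "\<And>s. b < s \<Longrightarrow> s < t \<Longrightarrow> 0 \<le> s \<Longrightarrow> dist (x s) z < 1"
      unfolding eventually_at_left_field by metis
    then obtain e where e: "e > 0" "\<And>s. t - e < s \<Longrightarrow> s < t \<Longrightarrow> 0 \<le> s \<Longrightarrow> dist (x s) z < 1"
      by (metis diff_diff_eq2 diff_gt_0_iff_gt add_diff_cancel_left')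
    have "P a b" if ab: "a \<le> t" "t \<le> b" "b - a < min d e" for a b
    proof -
      have "x ` ({a..b} \<inter> {0..T}) \<subseteq> insert (x t) (ball y 1 \<union> ball z 1)"
      proof safe
        fix s assume s: "s \<in> {a..b}" "s \<in> {0..T}" "x s \<noteq> x t" "x s \<notin> ball z 1"
        then have "s \<noteq> t" "\<not> s < t" using e(2)[of s] ab by (auto simp: dist_commute)
        then show "x s \<in> ball y 1" using d(2)[of s] ab s by (auto simp: dist_commute)
      qed
      then show ?thesis
        unfolding P_def by (rule bounded_subset[rotated]) auto
    qed
    then show ?case using d e by (intro exI[of _ "min d e"]) auto
  qed
  then show ?thesis by (simp add: P_def)
qed auto

text \<open>On this countable set a right-continuous function has the same supremum as on \<open>{0..T}\<close>. The point
  \<open>T\<close>, which may be irrational, is isolated from the right and has to be included.\<close>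

definition dense_times :: "real \<Rightarrow> real set" where
  "dense_times T = insert T ({0..T} \<inter> \<rat>)"

lemma countable_dense_times: "countable (dense_times T)"
  by (simp add: dense_times_def countable_rat)

lemma dense_times_subset: "0 \<le> T \<Longrightarrow> dense_times T \<subseteq> {0..T}"
  by (auto simp: dense_times_def)

lemma rcll_gt_dense:
  assumes "rcll_on T x" "0 \<le> s" "s < u" "u \<le> T" "c < x s"
  shows "\<exists>q\<in>\<rat>. s < q \<and> q < u \<and> c < x q"
proof -
  have "\<forall>\<^sub>F r in at_right s. c < x r"
    using rcll_onD_right[OF assms(1,2)] assms by (intro order_tendstoD) auto
  moreover have "\<forall>\<^sub>F r in at_right s. r < u"
    using \<open>s < u\<close> by (auto simp: eventually_at_right_field)
  ultimately have "\<forall>\<^sub>F r in at_right s. c < x r \<and> r < u" by eventually_elim auto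
  then obtain b where "s < b" and b: "\<And>r. s < r \<Longrightarrow> r < b \<Longrightarrow> c < x r \<and> r < u"
    by (auto simp: eventually_at_right_field)
  then show ?thesis
    using Rats_dense_in_real[OF \<open>s < b\<close>] by blast
qed

lemma rcll_le_on_dense_times:
  assumes x: "rcll_on T x" and le: "\<And>q. q \<in> dense_times T \<Longrightarrow> x q \<le> c" and t: "t \<in> {0..T}"
  shows "x t \<le> c"
proof (rule ccontr)
  assume "\<not> x t \<le> c"
  then have c: "c < x t" by simp
  with le[of T] t have "t < T" by (cases "t = T") (auto simp: dense_times_def)
  from rcll_gt_dense[OF x _ this _ c] t obtain q where "q \<in> \<rat>" "t < q" "q < T" "c < x q" by auto
  with le[of q] t show False by (auto simp: dense_times_def)
qed

definition path_sup :: "real \<Rightarrow> (real \<Rightarrow> real) \<Rightarrow> real" where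
  "path_sup T x = (SUP t\<in>{0..T}. \<bar>x t\<bar>)"

lemma rcll_on_abs: "rcll_on T x \<Longrightarrow> rcll_on T (\<lambda>t. \<bar>x t\<bar>)"
  unfolding rcll_on_def by (blast intro: tendsto_rabs)

lemma rcll_bdd_above: "rcll_on T x \<Longrightarrow> bdd_above ((\<lambda>t. \<bar>x t\<bar>) ` {0..T})"
  using rcll_bounded[OF rcll_on_abs] by (auto intro: bounded_imp_bdd_above)

lemma path_sup_upper: "rcll_on T x \<Longrightarrow> t \<in> {0..T} \<Longrightarrow> \<bar>x t\<bar> \<le> path_sup T x"
  unfolding path_sup_def by (rule cSUP_upper[OF _ rcll_bdd_above])

lemma path_sup_nonneg: "rcll_on T x \<Longrightarrow> 0 \<le> T \<Longrightarrow> 0 \<le> path_sup T x"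
  using path_sup_upper[of T x 0] by simp

lemma path_sup_least: "0 \<le> T \<Longrightarrow> (\<And>t. t \<in> {0..T} \<Longrightarrow> \<bar>x t\<bar> \<le> c) \<Longrightarrow> path_sup T x \<le> c"
  unfolding path_sup_def by (rule cSUP_least) auto

lemma path_sup_dense_times:
  assumes x: "rcll_on T x" and T: "0 \<le> T"
  shows "path_sup T x = (SUP t\<in>dense_times T. \<bar>x t\<bar>)"
proof (rule antisym)
  have bdd: "bdd_above ((\<lambda>t. \<bar>x t\<bar>) ` dense_times T)"
    using rcll_bdd_above[OF x] dense_times_subset[OF T] by (meson bdd_above_mono image_mono)
  show "path_sup T x \<le> (SUP t\<in>dense_times T. \<bar>x t\<bar>)"
    by (rule path_sup_least[OF T]) (rule rcll_le_on_dense_times[OF rcll_on_abs[OF x] cSUP_upper[OF _ bdd]])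
  show "(SUP t\<in>dense_times T. \<bar>x t\<bar>) \<le> path_sup T x"
    using path_sup_upper[OF x] dense_times_subset[OF T]
    by (intro cSUP_least) (auto simp: dense_times_def)
qed

lemma path_sup_square:
  assumes x: "rcll_on T x" and T: "0 \<le> T"
  shows "ennreal ((path_sup T x)\<^sup>2) = (SUP t\<in>{0..T}. ennreal (\<bar>x t\<bar>\<^sup>2))"
proof (rule antisym)
  show "(SUP t\<in>{0..T}. ennreal (\<bar>x t\<bar>\<^sup>2)) \<le> ennreal ((path_sup T x)\<^sup>2)"
    by (intro SUP_least ennreal_leI power_mono path_sup_upper[OF x]) auto
  let ?S = "SUP t\<in>{0..T}. ennreal (\<bar>x t\<bar>\<^sup>2)"
  show "ennreal ((path_sup T x)\<^sup>2) \<le> ?S"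
  proof (cases "?S = \<top>")
    case False
    then obtain r where r: "0 \<le> r" "?S = ennreal r" by (cases "?S") auto
    have "\<bar>x t\<bar> \<le> sqrt r" if "t \<in> {0..T}" for t
    proof (rule real_le_rsqrt)
      have "ennreal (\<bar>x t\<bar>\<^sup>2) \<le> ennreal r" unfolding r(2)[symmetric] using that by (rule SUP_upper)
      then show "\<bar>x t\<bar>\<^sup>2 \<le> r" using r(1) by (simp del: power2_abs)
    qed
    then have "path_sup T x \<le> sqrt r" by (rule path_sup_least[OF T])
    then have "(path_sup T x)\<^sup>2 \<le> r"
      using path_sup_nonneg[OF x T] r(1) by (metis power_mono real_sqrt_pow2)
    then show ?thesis using r by (simp add: ennreal_leI)
  next
    case True
    then show ?thesis by (simp only: top_greatest)
  qed
qed

text \<open>The limits \<open>l n\<close> form a Cauchy sequence because \<open>f m - f n\<close> is uniformly small; so their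
  convergence is part of the conclusion.\<close>

lemma tendsto_within_uniform_limit:
  fixes f :: "nat \<Rightarrow> real \<Rightarrow> real"
  assumes lim: "\<And>n. (f n \<longlongrightarrow> l n) (at t within S)"
    and unif: "uniform_limit S f h sequentially" and S: "at t within S \<noteq> bot"
  shows "\<exists>y. l \<longlonglongrightarrow> y \<and> (h \<longlongrightarrow> y) (at t within S)"
proof -
  have "Cauchy l"
  proof (rule metric_CauchyI)
    fix e :: real assume e: "0 < e"
    then have "\<forall>\<^sub>F n in sequentially. \<forall>x\<in>S. dist (f n x) (h x) < e / 4"
      by (intro uniform_limitD[OF unif]) simp
    then obtain N where N: "\<And>n x. N \<le> n \<Longrightarrow> x \<in> S \<Longrightarrow> dist (f n x) (h x) < e / 4"
      by (auto simp: eventually_sequentially)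
    have "dist (l m) (l n) < e" if mn: "N \<le> m" "N \<le> n" for m n
    proof -
      have "dist (l m) (l n) \<le> e / 2"
      proof (rule tendsto_upperbound[OF tendsto_dist[OF lim lim] _ S])
        show "\<forall>\<^sub>F x in at t within S. dist (f m x) (f n x) \<le> e / 2"
          unfolding eventually_at_filter
        proof (intro always_eventually allI impI)
          fix x assume "x \<in> S"
          then show "dist (f m x) (f n x) \<le> e / 2"
            using N[OF mn(1), of x] N[OF mn(2), of x] dist_triangle2[of "f m x" "f n x" "h x"] by simp
        qed
      qed
      then show ?thesis using e by simp
    qed
    then show "\<exists>N. \<forall>m\<ge>N. \<forall>n\<ge>N. dist (l m) (l n) < e" by blast
  qed
  then obtain y where "l \<longlonglongrightarrow> y" by (auto simp: Cauchy_convergent_iff convergent_def)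
  with swap_uniform_limit[OF _ this unif] lim S show ?thesis by auto
qed

lemma tendsto_at_right_uniform_limit:
  fixes f :: "nat \<Rightarrow> real \<Rightarrow> real"
  assumes f: "\<And>n. rcll_on T (f n)" and unif: "uniform_limit {0..T} f h sequentially"
    and t: "0 \<le> t" "t < T"
  shows "(h \<longlongrightarrow> h t) (at_right t)"
proof -
  have eq: "at t within {t..T} = at_right t" using t by (simp add: at_within_Icc_at_right)
  have "uniform_limit {t..T} f h sequentially"
    by (rule uniform_limit_on_subset[OF unif]) (use t in auto)
  from tendsto_within_uniform_limit[OF _ this, where t=t and l="\<lambda>n. f n t"]
  obtain y where y: "(\<lambda>n. f n t) \<longlonglongrightarrow> y" "(h \<longlongrightarrow> y) (at_right t)"
    using rcll_onD_right[OF f t] by (auto simp: eq)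
  moreover have "(\<lambda>n. f n t) \<longlonglongrightarrow> h t"
    using tendsto_uniform_limitI[OF unif] t by simp
  ultimately show ?thesis using LIMSEQ_unique by blast
qed

lemma tendsto_at_left_uniform_limit:
  fixes f :: "nat \<Rightarrow> real \<Rightarrow> real"
  assumes f: "\<And>n. rcll_on T (f n)" and unif: "uniform_limit {0..T} f h sequentially"
    and t: "0 < t" "t \<le> T"
  shows "\<exists>y. (\<lambda>n. Lim (at_left t) (f n)) \<longlonglongrightarrow> y \<and> (h \<longlongrightarrow> y) (at_left t)"
proof -
  have eq: "at t within {0..t} = at_left t" using t by (simp add: at_within_Icc_at_left)
  have "uniform_limit {0..t} f h sequentially"
    by (rule uniform_limit_on_subset[OF unif]) (use t in auto)
  from tendsto_within_uniform_limit[OF _ this, where t=t and l="\<lambda>n. Lim (at_left t) (f n)"]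
  show ?thesis using rcll_onD_left[OF f t] by (simp add: eq)
qed


section \<open>The flat-off condition on a path\<close>

text \<open>The left limit at \<open>t\<close> is the limit of the values at the last points strictly before \<open>t\<close> of
  finer and finer grids.\<close>

lemma left_limit_measurable:
  assumes x: "rcll_on T x"
  shows "(\<lambda>t. indicator {0<..T} t * Lim (at_left t) x) \<in> borel_measurable borel"
proof (rule borel_measurable_LIMSEQ_real)
  define s where "s k t = (real_of_int \<lceil>real (Suc k) * t\<rceil> - 1) / real (Suc k)" for k and t :: real
  show "(\<lambda>t. indicator {0<..T} t * x (s k t)) \<in> borel_measurable borel" for k
  proof -
    have "(\<lambda>t. x ((real_of_int \<lceil>real (Suc k) * t\<rceil> - 1) / real (Suc k))) \<in> borel_measurable borel"
      by (rule measurable_compose_countable[where f="\<lambda>j t. x ((real_of_int j - 1) / real (Suc k))"])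
         measurable
    then show ?thesis unfolding s_def by measurable
  qed
  show "(\<lambda>k. indicator {0<..T} t * x (s k t)) \<longlonglongrightarrow> indicator {0<..T} t * Lim (at_left t) x" for t
  proof (cases "t \<in> {0<..T}")
    case True
    have lt: "s k t < t" for k
    proof -
      have "real_of_int \<lceil>real (Suc k) * t\<rceil> - 1 < real (Suc k) * t" by linarith
      then show ?thesis by (simp add: s_def divide_less_eq mult.commute)
    qed
    have ge: "t - 1 / real (Suc k) \<le> s k t" for k
    proof -
      have "real (Suc k) * t - 1 \<le> real_of_int \<lceil>real (Suc k) * t\<rceil> - 1" by linarith
      then have "(real (Suc k) * t - 1) / real (Suc k) \<le> s k t"
        unfolding s_def by (rule divide_right_mono) simp
      then show ?thesis by (simp add: diff_divide_distrib)
    qed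
    have "(\<lambda>k. s k t) \<longlonglongrightarrow> t"
    proof (rule tendsto_sandwich[OF always_eventually always_eventually _ tendsto_const])
      show "(\<lambda>k. t - 1 / real (Suc k)) \<longlonglongrightarrow> t"
        using tendsto_diff[OF tendsto_const LIMSEQ_inverse_real_of_nat, of t] by (simp add: inverse_eq_divide)
    qed (use lt ge in \<open>auto intro: less_imp_le\<close>)
    then have "filterlim (\<lambda>k. s k t) (at_left t) sequentially"
      using lt by (auto simp: filterlim_at order_less_imp_not_eq intro!: always_eventually)
    moreover have "(x \<longlongrightarrow> Lim (at_left t) x) (at_left t)"
      using rcll_onD_left[OF x] True by auto
    ultimately have "(\<lambda>k. x (s k t)) \<longlonglongrightarrow> Lim (at_left t) x"
      by (rule filterlim_compose[rotated])
    then show ?thesis using True by simp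
  qed simp
qed

text \<open>
  The integrand of the flat-off condition is the left-limit function of the nonnegative path
  \<open>x - y\<close>. If this path stays above a positive level on an interval, then so do its left limits, and
  the Stieltjes measure of the interval vanishes.
\<close>

lemma flat_off_barrier:
  assumes T: "0 < T" and x: "rcll_on T x" and y: "rcll_on T y" and a: "rcll_on T a"
    and mono: "mono_on {0..T} a"
    and ge: "\<And>t. t \<in> {0..T} \<Longrightarrow> y t \<le> x t"
    and zero: "(LINT t:{0<..T}|stieltjes_measure T a. Lim (at_left t) x - Lim (at_left t) y) = 0"
    and \<tau>: "0 \<le> s" "s \<le> \<tau>" "\<tau> \<le> T"
    and \<delta>: "0 < \<delta>" "\<And>t. s \<le> t \<Longrightarrow> t < \<tau> \<Longrightarrow> \<delta> \<le> x t - y t"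
  shows "a \<tau> = a s"
proof -
  define \<nu> where "\<nu> = stieltjes_measure T a"
  define v where "v t = Lim (at_left t) x - Lim (at_left t) y" for t
  define b where "b t = a (max 0 (min t T))" for t
  have \<nu>: "\<nu> = interval_measure b" by (simp add: \<nu>_def stieltjes_measure_def b_def[abs_def])
  have sets [simp]: "sets \<nu> = sets borel" by (simp add: \<nu>)
  have b_mono: "b r \<le> b r'" if "r \<le> r'" for r r'
    unfolding b_def using that T by (intro mono_onD[OF mono]) auto
  have b_right: "continuous (at_right r) b" for r
  proof -
    have "continuous (at r within {r..}) b"
      unfolding continuous_within_sequentially o_def
    proof (intro allI impI)
      fix z :: "nat \<Rightarrow> real" assume z: "(\<forall>n. z n \<in> {r..}) \<and> z \<longlonglongrightarrow> r"
      show "(\<lambda>n. b (z n)) \<longlonglongrightarrow> b r"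
        unfolding b_def
      proof (rule right_limit_seq[where T=T and x=a and s="\<lambda>k. max 0 (min (z k) T)"])
        show "(a \<longlongrightarrow> a (max 0 (min r T))) (at_right (max 0 (min r T)))" if "max 0 (min r T) < T"
          using that by (intro rcll_onD_right[OF a]) auto
        show "(\<lambda>k. max 0 (min (z k) T)) \<longlonglongrightarrow> max 0 (min r T)"
          using z by (intro tendsto_intros) auto
        show "max 0 (min r T) \<le> max 0 (min (z k) T)" for k
          using z by (intro max.mono min.mono) auto
      qed (use T in auto)
    qed
    then show ?thesis by (rule continuous_within_subset) auto
  qed
  have em: "emeasure \<nu> {r<..r'} = ennreal (a r' - a r)" if "0 \<le> r" "r \<le> r'" "r' \<le> T" for r r'
    using that unfolding \<nu> by (subst emeasure_interval_measure_Ioc; (intro b_right b_mono)?) (auto simp: b_def max_def min_def)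
  have v_lim: "((\<lambda>r. x r - y r) \<longlongrightarrow> v t) (at_left t)" if "t \<in> {0<..T}" for t
    unfolding v_def using that by (intro tendsto_diff rcll_onD_left[OF x] rcll_onD_left[OF y]) auto
  have v_nonneg: "0 \<le> v t" if t: "t \<in> {0<..T}" for t
  proof (rule tendsto_lowerbound[OF v_lim[OF t]])
    have "\<forall>\<^sub>F r in at_left t. 0 < r \<and> r < t"
      using t by (auto simp: eventually_at_left_field)
    then show "\<forall>\<^sub>F r in at_left t. 0 \<le> x r - y r"
      by eventually_elim (use ge t in auto)
  qed simp
  have v_ge: "\<delta> \<le> v t" if t: "t \<in> {s<..\<tau>}" for t
  proof (rule tendsto_lowerbound[OF v_lim])
    have "\<forall>\<^sub>F r in at_left t. s < r \<and> r < t"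
      using t by (auto simp: eventually_at_left_field)
    then show "\<forall>\<^sub>F r in at_left t. \<delta> \<le> x r - y r"
      by eventually_elim (use \<delta>(2) t in auto)
  qed (use t \<tau> in auto)
  have v_eq: "(\<lambda>t. indicator {0<..T} t * v t) =
      (\<lambda>t. indicator {0<..T} t * Lim (at_left t) x - indicator {0<..T} t * Lim (at_left t) y)"
    by (auto simp: v_def fun_eq_iff algebra_simps)
  have v_meas: "(\<lambda>t. indicator {0<..T} t * v t) \<in> borel_measurable borel"
    unfolding v_eq by (intro borel_measurable_diff left_limit_measurable x y)
  obtain C where C: "\<And>t. t \<in> {0..T} \<Longrightarrow> \<bar>x t - y t\<bar> \<le> C"
    using rcll_bounded[OF rcll_on_diff[OF x y]] unfolding bounded_iff by (metis image_eqI real_norm_def)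
  have v_le: "v t \<le> C" if t: "t \<in> {0<..T}" for t
  proof (rule tendsto_upperbound[OF v_lim[OF t]])
    have "\<forall>\<^sub>F r in at_left t. 0 < r \<and> r < t"
      using t by (auto simp: eventually_at_left_field)
    then show "\<forall>\<^sub>F r in at_left t. x r - y r \<le> C"
      by eventually_elim (use C t in \<open>auto simp: abs_le_iff\<close>)
  qed simp
  have C0: "0 \<le> C" using C[of 0] T by simp
  have int: "integrable \<nu> (\<lambda>t. indicator {0<..T} t * v t)"
  proof (rule integrableI_bounded_set[where A="{0<..T}" and B=C])
    show "emeasure \<nu> {0<..T} < \<infinity>" using T by (subst em) auto
    show "(\<lambda>t. indicator {0<..T} t * v t) \<in> borel_measurable \<nu>"
      using v_meas by (simp add: measurable_cong_sets[OF sets refl])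
  qed (use v_nonneg v_le C0 in auto)
  have "(\<integral>t. indicator {0<..T} t * v t \<partial>\<nu>) = 0"
    using zero by (simp add: set_lebesgue_integral_def \<nu>_def v_def)
  then have ae: "AE t in \<nu>. indicator {0<..T} t * v t = 0"
    using int v_nonneg by (subst (asm) integral_nonneg_eq_0_iff_AE) (auto simp: indicator_def)
  have "emeasure \<nu> {s<..\<tau>} = 0"
  proof (subst AE_iff_measurable[symmetric, where P="\<lambda>t. t \<notin> {s<..\<tau>}"])
    show "AE t in \<nu>. t \<notin> {s<..\<tau>}"
      using ae by eventually_elim (use v_ge \<delta>(1) \<tau> in \<open>force simp: indicator_def\<close>)
  qed (auto simp: \<nu>)
  then have "a \<tau> - a s \<le> 0" using em \<tau> by (simp add: ennreal_eq_0_iff)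
  moreover have "a s \<le> a \<tau>" using \<tau> by (intro mono_onD[OF mono]) auto
  ultimately show ?thesis by simp
qed


section \<open>Filtrations under the usual conditions\<close>

locale usual_conditions =
  fixes M :: "'a measure" and F :: "real \<Rightarrow> 'a measure" and T :: real
  assumes T_pos: "0 < T"
    and basis: "filtered_prob_space M F"
    and complete: "complete_filtration M F"
    and right_cont: "right_continuous_filtration F"

sublocale usual_conditions \<subseteq> prob_space M
  using basis by (simp add: filtered_prob_space_def)

sublocale usual_conditions \<subseteq> filtration "space M" F
  using basis by (simp add: filtered_prob_space_def)

context usual_conditions
begin

lemma sets_F_le: "sets (F t) \<subseteq> sets M"
  using basis unfolding filtered_prob_space_def subalgebra_def by blast

lemma sets_F0_le: "sets (F 0) \<subseteq> sets (F t)"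
proof (cases "0 \<le> t")
  case False
  then have "sets (F t) = sets (F 0)"
    using basis unfolding filtered_prob_space_def by (metis not_le)
  then show ?thesis by blast
qed (rule sets_F_mono)

lemma measurable_F_mono: "f \<in> measurable (F s) N \<Longrightarrow> s \<le> t \<Longrightarrow> f \<in> measurable (F t) N"
  using sets_F_mono[of s t] unfolding measurable_def space_F by blast

lemma measurable_F_M: "f \<in> measurable (F s) N \<Longrightarrow> f \<in> measurable M N"
  using sets_F_le[of s] unfolding measurable_def space_F by blast

lemma negligible_in_F0:
  assumes "AE \<omega> in M. \<omega> \<notin> A" "A \<subseteq> space M"
  shows "A \<in> sets (F 0)"
proof -
  obtain N where "{\<omega> \<in> space M. \<not> \<omega> \<notin> A} \<subseteq> N" "emeasure M N = 0" "N \<in> sets M"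
    using assms(1) by (rule AE_E)
  then have "A \<subseteq> N" "N \<in> null_sets M" using assms(2) by (blast, simp add: null_setsI)
  then show ?thesis using complete unfolding complete_filtration_def by blast
qed

lemma sets_cong_AE:
  assumes G: "sets (F 0) \<subseteq> sets G" "space G = space M"
    and A: "A \<in> sets G" "B \<subseteq> space M" and ae: "AE \<omega> in M. \<omega> \<in> A \<longleftrightarrow> \<omega> \<in> B"
  shows "B \<in> sets G"
proof -
  have sub: "A \<subseteq> space M" using sets.sets_into_space[OF A(1)] G(2) by simp
  have "A - B \<in> sets G"
    by (intro subsetD[OF G(1)] negligible_in_F0) (use ae sub in \<open>auto elim: eventually_mono\<close>)
  moreover have "B - A \<in> sets G"
    by (intro subsetD[OF G(1)] negligible_in_F0) (use ae A in \<open>auto elim: eventually_mono\<close>)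
  moreover have "B = (A - (A - B)) \<union> (B - A)" by auto
  ultimately show ?thesis using A(1) by (metis sets.Diff sets.Un)
qed

text \<open>Since \<open>F 0\<close> contains all negligible sets, measurability with respect to any larger
  \<open>\<sigma>\<close>-algebra is insensitive to modifications on negligible sets.\<close>

lemma measurable_cong_AE:
  assumes G: "sets (F 0) \<subseteq> sets G" "space G = space M"
    and f: "f \<in> borel_measurable G" and ae: "AE \<omega> in M. f \<omega> = f' \<omega>"
  shows "f' \<in> borel_measurable G"
proof (rule measurableI)
  fix B :: "'b set" assume "B \<in> sets borel"
  then have "f -` B \<inter> space G \<in> sets G" using f by (rule measurable_sets[rotated])
  then show "f' -` B \<inter> space G \<in> sets G"
  proof (rule sets_cong_AE[OF G])
    show "AE \<omega> in M. (\<omega> \<in> f -` B \<inter> space G) = (\<omega> \<in> f' -` B \<inter> space G)"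
      using ae by eventually_elim auto
  qed (simp add: G(2))
qed simp

lemma measurable_M_cong_AE:
  "f \<in> borel_measurable M \<Longrightarrow> AE \<omega> in M. f \<omega> = f' \<omega> \<Longrightarrow> f' \<in> borel_measurable M"
  by (rule measurable_cong_AE[OF sets_F_le refl])

lemma measurable_F_cong_AE:
  "f \<in> borel_measurable (F t) \<Longrightarrow> AE \<omega> in M. f \<omega> = f' \<omega> \<Longrightarrow> f' \<in> borel_measurable (F t)"
  by (rule measurable_cong_AE[OF sets_F0_le space_F])


subsection \<open>Stopping times with values in \<open>{0..T}\<close>\<close>

lemma space_sigma_at: "space (sigma_at M F S) = space M"
  by (simp add: sigma_at_def space_pre_sigma)

lemma sets_sigma_at:
  "stopping_time F S \<Longrightarrow> sets (sigma_at M F S) = {A. \<forall>t. {\<omega> \<in> A. S \<omega> \<le> t} \<in> sets (F t)}"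
  by (simp add: sigma_at_def sets_pre_sigma)

lemma sets_F0_le_sigma_at:
  assumes S: "stopping_time F S"
  shows "sets (F 0) \<subseteq> sets (sigma_at M F S)"
  unfolding sets_sigma_at[OF S]
proof safe
  fix A t assume A: "A \<in> sets (F 0)"
  then have "A \<inter> {\<omega> \<in> space (F t). S \<omega> \<le> t} \<in> sets (F t)"
    using sets_F0_le stopping_timeD[OF S, of t] by (intro sets.Int) (auto simp: pred_def)
  also have "A \<inter> {\<omega> \<in> space (F t). S \<omega> \<le> t} = {\<omega> \<in> A. S \<omega> \<le> t}"
    using sets.sets_into_space[OF A] by (auto simp: space_F)
  finally show "{\<omega> \<in> A. S \<omega> \<le> t} \<in> sets (F t)" .
qed

lemma subalgebra_sigma_at:
  assumes S: "stopping_time F S"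
  shows "subalgebra M (sigma_at M F S)"
  unfolding subalgebra_def space_sigma_at
proof (intro conjI refl subsetI)
  fix A assume A: "A \<in> sets (sigma_at M F S)"
  then have "(\<Union>n. {\<omega> \<in> A. S \<omega> \<le> real n}) \<in> sets M"
    using S sets_F_le by (intro sets.countable_UN) (auto simp: sets_sigma_at)
  also have "(\<Union>n. {\<omega> \<in> A. S \<omega> \<le> real n}) = A"
    using real_arch_simple by auto
  finally show "A \<in> sets M" .
qed

lemma measurable_sigma_at_M:
  "stopping_time F S \<Longrightarrow> f \<in> measurable (sigma_at M F S) N \<Longrightarrow> f \<in> measurable M N"
  using subalgebra_sigma_at measurable_from_subalg by blast

lemma sigma_at_mono:
  assumes "stopping_time F S" "stopping_time F S'" "\<And>\<omega>. \<omega> \<in> space M \<Longrightarrow> S \<omega> \<le> S' \<omega>"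
  shows "sets (sigma_at M F S) \<subseteq> sets (sigma_at M F S')"
  unfolding sigma_at_def by (rule mono_pre_sigma) (use assms in auto)

lemma sigma_at_cong_AE:
  assumes S: "stopping_time F S" "stopping_time F S'" and ae: "AE \<omega> in M. S \<omega> = S' \<omega>"
  shows "sets (sigma_at M F S) = sets (sigma_at M F S')"
proof -
  have sub: "A \<in> sets (sigma_at M F S')"
    if S: "stopping_time F S" "stopping_time F S'" and ae: "AE \<omega> in M. S \<omega> = S' \<omega>"
      and A: "A \<in> sets (sigma_at M F S)" for S S' A
    unfolding sets_sigma_at[OF S(2)]
  proof safe
    fix t
    have "{\<omega> \<in> A. S \<omega> \<le> t} \<in> sets (F t)"
      using A S by (simp add: sets_sigma_at)
    then show "{\<omega> \<in> A. S' \<omega> \<le> t} \<in> sets (F t)"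
    proof (rule sets_cong_AE[OF sets_F0_le space_F])
      show "{\<omega> \<in> A. S' \<omega> \<le> t} \<subseteq> space M"
        using sets.sets_into_space[OF A] by (auto simp: space_sigma_at)
      show "AE \<omega> in M. (\<omega> \<in> {\<omega> \<in> A. S \<omega> \<le> t}) = (\<omega> \<in> {\<omega> \<in> A. S' \<omega> \<le> t})"
        using ae by eventually_elim auto
    qed
  qed
  have "AE \<omega> in M. S' \<omega> = S \<omega>" using ae by eventually_elim auto
  then show ?thesis using sub S ae by (intro equalityI subsetI) blast+
qed

text \<open>Almost sure bounds on stopping times can be replaced by bounds that hold everywhere.\<close>

definition bounded_time :: "('a \<Rightarrow> real) \<Rightarrow> bool" where
  "bounded_time S \<longleftrightarrow> stopping_time F S \<and> (\<forall>\<omega>. 0 \<le> S \<omega> \<and> S \<omega> \<le> T)"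

definition clamp :: "('a \<Rightarrow> real) \<Rightarrow> 'a \<Rightarrow> real" where
  "clamp S \<omega> = max 0 (min (S \<omega>) T)"

lemma bounded_timeD:
  assumes "bounded_time S"
  shows "stopping_time F S" "0 \<le> S \<omega>" "S \<omega> \<le> T" "S \<omega> \<in> {0..T}"
  using assms by (auto simp: bounded_time_def)

lemma bounded_time_clamp: "stopping_time F S \<Longrightarrow> bounded_time (clamp S)"
  using T_pos unfolding bounded_time_def clamp_def
  by (auto intro!: stopping_time_max stopping_time_min stopping_time_const)

lemma bounded_time_const: "t \<in> {0..T} \<Longrightarrow> bounded_time (\<lambda>_. t)"
  by (auto simp: bounded_time_def stopping_time_const)

lemma bounded_time_min: "bounded_time S \<Longrightarrow> bounded_time S' \<Longrightarrow> bounded_time (\<lambda>\<omega>. min (S \<omega>) (S' \<omega>))"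
  by (auto simp: bounded_time_def intro: stopping_time_min min.coboundedI1)

lemma bounded_time_max: "bounded_time S \<Longrightarrow> bounded_time S' \<Longrightarrow> bounded_time (\<lambda>\<omega>. max (S \<omega>) (S' \<omega>))"
  by (auto simp: bounded_time_def intro: stopping_time_max max.coboundedI1)

lemma bounded_time_stopping_times0: "bounded_time S \<Longrightarrow> S \<in> stopping_times0 M F T"
  by (auto simp: bounded_time_def stopping_times_def)

lemma clamp_AE: "S \<in> stopping_times0 M F T \<Longrightarrow> AE \<omega> in M. clamp S \<omega> = S \<omega>"
  by (auto simp: stopping_times_def clamp_def elim: eventually_mono)

lemma bounded_time_measurable: "bounded_time S \<Longrightarrow> S \<in> borel_measurable M"
  using sets_F_le by (intro measurable_stopping_time[of F]) (auto simp: bounded_time_def space_F)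


subsection \<open>Right-continuous adapted processes at stopping times\<close>

lemma adapted_measurable:
  "adapted_process F T X \<Longrightarrow> 0 \<le> s \<Longrightarrow> s \<le> t \<Longrightarrow> s \<le> T \<Longrightarrow> X s \<in> borel_measurable (F t)"
  unfolding adapted_process_def by (metis atLeastAtMost_iff measurable_F_mono)

definition grid :: "nat \<Rightarrow> real \<Rightarrow> real \<Rightarrow> real" where
  "grid k t s = t * real_of_int \<lceil>real (Suc k) * s / t\<rceil> / real (Suc k)"

lemma grid_bounds:
  assumes "0 < t" "0 \<le> s" "s \<le> t"
  shows "s \<le> grid k t s" "grid k t s \<le> t" "grid k t s \<le> s + t / real (Suc k)"
proof -
  let ?n = "real (Suc k)"
  have "?n * s / t \<le> of_int \<lceil>?n * s / t\<rceil>" by linarith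
  then have "t * (?n * s / t) / ?n \<le> grid k t s"
    using assms(1) unfolding grid_def by (intro divide_right_mono mult_left_mono) auto
  then show "s \<le> grid k t s" using assms(1) by simp
  have "?n * s / t \<le> ?n" using assms by (simp add: divide_le_eq mult_left_mono)
  then have "\<lceil>?n * s / t\<rceil> \<le> int (Suc k)" by (simp add: ceiling_le_iff)
  then have "real_of_int \<lceil>?n * s / t\<rceil> \<le> ?n" by linarith
  then have "t * real_of_int \<lceil>?n * s / t\<rceil> \<le> t * ?n" using assms(1) by (intro mult_left_mono) auto
  then show "grid k t s \<le> t" unfolding grid_def by (subst pos_divide_le_eq) auto
  have "real_of_int \<lceil>?n * s / t\<rceil> \<le> ?n * s / t + 1" by linarith
  then have "t * real_of_int \<lceil>?n * s / t\<rceil> \<le> t * (?n * s / t + 1)"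
    using assms(1) by (intro mult_left_mono) auto
  then have "grid k t s \<le> t * (?n * s / t + 1) / ?n"
    unfolding grid_def by (intro divide_right_mono) auto
  also have "\<dots> = s + t / ?n"
  proof -
    have "t * (n * s / t + 1) / n = s + t / n" if "0 < n" for n
      using that assms(1) by (simp add: field_simps)
    then show ?thesis by simp
  qed
  finally show "grid k t s \<le> s + t / ?n" .
qed

lemma grid_tendsto:
  assumes x: "rcll_on T x" and t: "0 < t" "t \<le> T" and s: "0 \<le> s" "s \<le> t"
  shows "(\<lambda>k. x (grid k t s)) \<longlonglongrightarrow> x s"
proof (rule right_limit_seq[where T=t and x=x and s="\<lambda>k. grid k t s"])
  show "(x \<longlongrightarrow> x s) (at_right s)" if "s < t"
    using that t s by (intro rcll_onD_right[OF x]) auto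
  show "(\<lambda>k. grid k t s) \<longlonglongrightarrow> s"
  proof (rule tendsto_sandwich[OF always_eventually always_eventually tendsto_const])
    show "(\<lambda>k. s + t / real (Suc k)) \<longlonglongrightarrow> s"
      using tendsto_add[OF tendsto_const tendsto_mult[OF tendsto_const LIMSEQ_inverse_real_of_nat], of s t]
      by (simp add: divide_inverse)
  qed (use grid_bounds[OF t(1) s] in auto)
qed (use grid_bounds[OF t(1) s] in auto)

lemma stopped_measurable_F:
  assumes X: "adapted_process F T X" "rcll_process M T X" and S: "bounded_time S" and t: "0 \<le> t" "t \<le> T"
  shows "(\<lambda>\<omega>. X (min (S \<omega>) t) \<omega>) \<in> borel_measurable (F t)"
proof (cases "t = 0")
  case True
  then have "min (S \<omega>) t = 0" for \<omega> using bounded_timeD(2)[OF S] by simp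
  then show ?thesis using adapted_measurable[OF X(1), of 0 t] t T_pos by simp
next
  case False
  then have t0: "0 < t" using t by simp
  have S_meas [measurable]: "(\<lambda>\<omega>. min (S \<omega>) t) \<in> borel_measurable (F t)"
  proof (rule borel_measurableI_le)
    fix c
    show "{\<omega> \<in> space (F t). min (S \<omega>) t \<le> c} \<in> sets (F t)"
    proof (cases "t \<le> c")
      case False
      have "Measurable.pred (F t) (\<lambda>\<omega>. S \<omega> \<le> c)"
        using False bounded_timeD(1)[OF S] by (intro stopping_time_le_const) auto
      then show ?thesis using False by (simp add: pred_def min_le_iff_disj)
    qed (simp add: min_le_iff_disj)
  qed
  show ?thesis
  proof (rule borel_measurable_LIMSEQ_real)
    show "(\<lambda>k. X (grid k t (min (S \<omega>) t)) \<omega>) \<longlonglongrightarrow> X (min (S \<omega>) t) \<omega>" if "\<omega> \<in> space (F t)" for \<omega>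
      using that X(2) t t0 bounded_timeD(2-4)[OF S, of \<omega>]
      by (intro grid_tendsto) (auto simp: rcll_process_def space_F)
    show "(\<lambda>\<omega>. X (grid k t (min (S \<omega>) t)) \<omega>) \<in> borel_measurable (F t)" for k
    proof -
      let ?q = "\<lambda>j::int. max 0 (min t (t * real_of_int j / real (Suc k)))"
      have [measurable]: "X (?q j) \<in> borel_measurable (F t)" for j
        using t by (intro adapted_measurable[OF X(1)]) auto
      have "(\<lambda>\<omega>. X (?q \<lceil>real (Suc k) * min (S \<omega>) t / t\<rceil>) \<omega>) \<in> borel_measurable (F t)"
        by (rule measurable_compose_countable) measurable
      moreover have "?q \<lceil>real (Suc k) * min (S \<omega>) t / t\<rceil> = grid k t (min (S \<omega>) t)" for \<omega>
        using grid_bounds[OF t0, of "min (S \<omega>) t" k] bounded_timeD(2-4)[OF S, of \<omega>] t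
        by (simp add: grid_def)
      ultimately show ?thesis by simp
    qed
  qed
qed

lemma stopped_measurable:
  assumes X: "adapted_process F T X" "rcll_process M T X" and S: "bounded_time S"
  shows "(\<lambda>\<omega>. X (S \<omega>) \<omega>) \<in> borel_measurable (sigma_at M F S)"
proof (rule borel_measurableI_le)
  fix c
  show "{\<omega> \<in> space (sigma_at M F S). X (S \<omega>) \<omega> \<le> c} \<in> sets (sigma_at M F S)"
    unfolding sets_sigma_at[OF bounded_timeD(1)[OF S]]
  proof safe
    fix t
    show "{\<omega> \<in> {\<omega> \<in> space (sigma_at M F S). X (S \<omega>) \<omega> \<le> c}. S \<omega> \<le> t} \<in> sets (F t)" (is "?A \<in> _")
    proof (cases "0 \<le> t")
      case True
      let ?u = "min t T"
      have u: "0 \<le> ?u" "?u \<le> T" "?u \<le> t" using True T_pos by auto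
      have "{\<omega> \<in> space (F ?u). X (min (S \<omega>) ?u) \<omega> \<le> c} \<inter> {\<omega> \<in> space (F ?u). S \<omega> \<le> ?u} \<in> sets (F ?u)"
        using stopped_measurable_F[OF X S u(1,2)] stopping_timeD[OF bounded_timeD(1)[OF S], of ?u]
        by (intro sets.Int) (auto simp: pred_def)
      also have "{\<omega> \<in> space (F ?u). X (min (S \<omega>) ?u) \<omega> \<le> c} \<inter> {\<omega> \<in> space (F ?u). S \<omega> \<le> ?u} = ?A"
        using bounded_timeD[OF S] by (auto simp: space_F space_sigma_at min_absorb1)
      finally show ?thesis using sets_F_mono[OF u(3)] by blast
    next
      case False
      have "\<not> S \<omega> \<le> t" for \<omega>
        using False bounded_timeD(2)[OF S, of \<omega>] by linarith
      then have "?A = {}" by blast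
      then show ?thesis by (simp only: sets.empty_sets)
    qed
  qed
qed

lemma stopped_integrable:
  assumes X: "adapted_process F T X" "rcll_process M T X" and S: "bounded_time S"
    and R: "integrable M R" "AE \<omega> in M. \<forall>t\<in>{0..T}. \<bar>X t \<omega>\<bar> \<le> R \<omega>"
  shows "integrable M (\<lambda>\<omega>. X (S \<omega>) \<omega>)"
proof (rule Bochner_Integration.integrable_bound[OF R(1)])
  show "(\<lambda>\<omega>. X (S \<omega>) \<omega>) \<in> borel_measurable M"
    using stopped_measurable[OF X S] bounded_timeD(1)[OF S] by (rule measurable_sigma_at_M[rotated])
  show "AE \<omega> in M. norm (X (S \<omega>) \<omega>) \<le> norm (R \<omega>)"
    using R(2)
  proof eventually_elim
    case (elim \<omega>)
    then have "\<bar>X (S \<omega>) \<omega>\<bar> \<le> R \<omega>" using bounded_timeD(4)[OF S] by blast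
    then show ?case by simp
  qed
qed


text \<open>
  The first time after \<open>S\<close> at which the path is below a level. For a right-continuous process and
  the open half line, the event that it occurs before \<open>t\<close> is decided at rational times, so the
  right-continuity of the filtration makes it a stopping time. Its value is \<open>T\<close> if the level is not
  undercut.
\<close>

definition hitting :: "(real \<Rightarrow> 'a \<Rightarrow> real) \<Rightarrow> real \<Rightarrow> ('a \<Rightarrow> real) \<Rightarrow> 'a \<Rightarrow> real" where
  "hitting V c S \<omega> = Inf (insert T {t. S \<omega> \<le> t \<and> t \<le> T \<and> V t \<omega> < c})"

lemma hitting_ge: "bounded_time S \<Longrightarrow> S \<omega> \<le> hitting V c S \<omega>"
  unfolding hitting_def using bounded_timeD(3)[of S \<omega>] by (intro cInf_greatest) auto

lemma hitting_bdd: "bdd_below (insert T {t. S \<omega> \<le> t \<and> t \<le> T \<and> V t \<omega> < c})"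
  by (intro bdd_belowI[of _ "min T (S \<omega>)"]) auto

lemma hitting_le_T: "hitting V c S \<omega> \<le> T"
  unfolding hitting_def by (rule cInf_lower[OF _ hitting_bdd]) simp

lemma hitting_le: "S \<omega> \<le> t \<Longrightarrow> t \<le> T \<Longrightarrow> V t \<omega> < c \<Longrightarrow> hitting V c S \<omega> \<le> t"
  unfolding hitting_def by (rule cInf_lower[OF _ hitting_bdd]) simp

lemma before_hitting: "S \<omega> \<le> t \<Longrightarrow> t < hitting V c S \<omega> \<Longrightarrow> c \<le> V t \<omega>"
  using hitting_le[of S \<omega> t V c] hitting_le_T[of V c S \<omega>] by force

lemma at_hitting:
  assumes V: "rcll_process M T V" and \<omega>: "\<omega> \<in> space M" and S: "bounded_time S"
    and hit: "\<exists>t. S \<omega> \<le> t \<and> t \<le> T \<and> V t \<omega> < c"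
  shows "V (hitting V c S \<omega>) \<omega> \<le> c"
proof (rule ccontr)
  let ?h = "hitting V c S \<omega>"
  assume gt: "\<not> V ?h \<omega> \<le> c"
  show False
  proof (cases "?h < T")
    case True
    have "0 \<le> ?h" using hitting_ge[OF S, of \<omega> V c] bounded_timeD(2)[OF S, of \<omega>] by simp
    then have "((\<lambda>t. V t \<omega>) \<longlongrightarrow> V ?h \<omega>) (at_right ?h)"
      using V \<omega> True by (intro rcll_onD_right) (auto simp: rcll_process_def)
    then have "\<forall>\<^sub>F t in at_right ?h. c < V t \<omega>"
      using gt by (intro order_tendstoD) auto
    then obtain b where b: "?h < b" "\<And>t. ?h < t \<Longrightarrow> t < b \<Longrightarrow> c < V t \<omega>"
      by (auto simp: eventually_at_right_field)
    have "min b T \<le> ?h"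
      unfolding hitting_def
    proof (rule cInf_greatest)
      fix t assume "t \<in> insert T {t. S \<omega> \<le> t \<and> t \<le> T \<and> V t \<omega> < c}"
      then consider "t = T" | "S \<omega> \<le> t" "t \<le> T" "V t \<omega> < c" by auto
      then show "min b T \<le> t"
      proof cases
        case 2
        then have "?h \<le> t" by (rule hitting_le)
        moreover have "t \<noteq> ?h" using 2 gt by auto
        ultimately show ?thesis using b(2)[of t] 2 by force
      qed simp
    qed simp
    then show False using b(1) True by simp
  next
    case False
    obtain t where t: "S \<omega> \<le> t" "t \<le> T" "V t \<omega> < c" using hit by blast
    then have "?h \<le> t" by (rule hitting_le)
    then have "t = ?h" using False t(2) by simp
    then show False using t gt by simp
  qed
qed

lemma bounded_time_hitting:
  assumes V: "adapted_process F T V" "rcll_process M T V" and S: "bounded_time S"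
  shows "bounded_time (hitting V c S)"
proof -
  let ?h = "hitting V c S"
  have strict: "{\<omega> \<in> space M. ?h \<omega> < v} \<in> sets (F v)" if v: "0 \<le> v" "v \<le> T" for v
  proof -
    have "{\<omega> \<in> space M. ?h \<omega> < v} =
        (\<Union>q\<in>\<rat> \<inter> {0..<v}. {\<omega> \<in> space (F v). S \<omega> \<le> q} \<inter> {\<omega> \<in> space (F v). V q \<omega> < c})" (is "_ = ?U")
    proof (intro equalityI subsetI)
      fix \<omega> assume "\<omega> \<in> {\<omega> \<in> space M. ?h \<omega> < v}"
      then have \<omega>: "\<omega> \<in> space M" "?h \<omega> < v" by auto
      obtain r where r: "r \<in> insert T {t. S \<omega> \<le> t \<and> t \<le> T \<and> V t \<omega> < c}" "r < v"
        using cInf_lessD[OF _ \<omega>(2)[unfolded hitting_def]] by blast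
      then have r': "S \<omega> \<le> r" "V r \<omega> < c" using v by auto
      have "rcll_on T (\<lambda>t. 0 - V t \<omega>)"
        using V(2) \<omega>(1) rcll_on_diff[OF rcll_on_continuous[OF continuous_on_const]]
        unfolding rcll_process_def by blast
      moreover have "0 \<le> r" using bounded_timeD(2)[OF S, of \<omega>] r'(1) by simp
      ultimately obtain q where "q \<in> \<rat>" "r < q" "q < v" "V q \<omega> < c"
        using rcll_gt_dense[of T "\<lambda>t. 0 - V t \<omega>" r v "- c"] r r' v by auto
      then show "\<omega> \<in> ?U"
        using r' \<omega> \<open>0 \<le> r\<close> by (auto simp: space_F intro!: bexI[of _ q])
    next
      fix \<omega> assume "\<omega> \<in> ?U"
      then show "\<omega> \<in> {\<omega> \<in> space M. ?h \<omega> < v}"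
        using hitting_le[of S \<omega> _ V c] v by (force simp: space_F)
    qed
    also have "?U \<in> sets (F v)"
    proof (intro sets.countable_UN'' sets.Int)
      fix q assume q: "q \<in> \<rat> \<inter> {0..<v}"
      show "{\<omega> \<in> space (F v). S \<omega> \<le> q} \<in> sets (F v)"
        using stopping_time_le_const[OF bounded_timeD(1)[OF S], of q v] q by (simp add: pred_def)
      have "V q \<in> borel_measurable (F v)"
        using q v by (intro adapted_measurable[OF V(1)]) auto
      then show "{\<omega> \<in> space (F v). V q \<omega> < c} \<in> sets (F v)" by measurable
    qed (auto intro: countable_subset[OF _ countable_rat])
    finally show ?thesis .
  qed
  have "{\<omega> \<in> space M. ?h \<omega> \<le> t} \<in> sets (F t)" for t
  proof -
    consider "t < 0" | "T \<le> t" | "0 \<le> t" "t < T" by linarith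
    then show ?thesis
    proof cases
      case 1
      have "0 \<le> ?h \<omega>" for \<omega>
        using hitting_ge[OF S, of \<omega> V c] bounded_timeD(2)[OF S, of \<omega>] by simp
      then have "\<not> ?h \<omega> \<le> t" for \<omega> using 1 by (metis not_less order_trans)
      then have "{\<omega> \<in> space M. ?h \<omega> \<le> t} = {}" by blast
      then show ?thesis by (simp only: sets.empty_sets)
    next
      case 2
      have "?h \<omega> \<le> t" for \<omega>
        using 2 hitting_le_T[of V c S \<omega>] by linarith
      then have "{\<omega> \<in> space M. ?h \<omega> \<le> t} = space (F t)"
        by (auto simp: space_F)
      then show ?thesis by simp
    next
      case 3
      have "{\<omega> \<in> space M. ?h \<omega> \<le> t} \<in> sets (F u)" if u: "t < u" for u
      proof -
        define v where "v n = t + (min u T - t) / real (Suc n)" for n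
        have v: "t < v n" "v n \<le> min u T" for n
        proof -
          have "(min u T - t) / real (Suc n) \<le> (min u T - t) / 1"
            using 3 u by (intro divide_left_mono) auto
          then show "v n \<le> min u T"
            unfolding v_def div_by_1 le_diff_eq by (subst add.commute)
          show "t < v n" using 3 u by (simp add: v_def)
        qed
        have "{\<omega> \<in> space M. ?h \<omega> \<le> t} = (\<Inter>n. {\<omega> \<in> space M. ?h \<omega> < v n})"
        proof (intro equalityI subsetI)
          fix \<omega> assume \<omega>: "\<omega> \<in> {\<omega> \<in> space M. ?h \<omega> \<le> t}"
          then have "?h \<omega> \<le> t" by simp
          then have "?h \<omega> < v n" for n using v(1)[of n] by linarith
          then show "\<omega> \<in> (\<Inter>n. {\<omega> \<in> space M. ?h \<omega> < v n})" using \<omega> by blast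
        next
          fix \<omega> assume \<omega>: "\<omega> \<in> (\<Inter>n. {\<omega> \<in> space M. ?h \<omega> < v n})"
          have "v \<longlonglongrightarrow> t"
            unfolding v_def
            using tendsto_add[OF tendsto_const tendsto_mult[OF tendsto_const LIMSEQ_inverse_real_of_nat],
                of t "min u T - t"] by (simp add: divide_inverse)
          then have "?h \<omega> \<le> t"
            by (rule LIMSEQ_le_const) (use \<omega> in \<open>auto intro: less_imp_le\<close>)
          then show "\<omega> \<in> {\<omega> \<in> space M. ?h \<omega> \<le> t}" using \<omega> by auto
        qed
        also have "\<dots> \<in> sets (F u)"
        proof -
          have "{\<omega> \<in> space M. ?h \<omega> < v n} \<in> sets (F u)" for n
          proof -
            have "0 \<le> v n" "v n \<le> T" "v n \<le> u" using v[of n] 3 by auto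
            then show ?thesis using strict[of "v n"] sets_F_mono[of "v n" u] by blast
          qed
          then show ?thesis by (intro sets.countable_INT) auto
        qed
        finally show ?thesis .
      qed
      then have "{\<omega> \<in> space M. ?h \<omega> \<le> t} \<in> (\<Inter>u\<in>{t<..}. sets (F u))" by simp
      also have "(\<Inter>u\<in>{t<..}. sets (F u)) = sets (F t)"
        using right_cont 3(1) unfolding right_continuous_filtration_def by (metis (no_types))
      finally show ?thesis .
    qed
  qed
  then have "stopping_time F ?h"
    by (intro stopping_timeI) (simp add: pred_def space_F)
  moreover have "0 \<le> ?h \<omega>" for \<omega>
    using hitting_ge[OF S, of \<omega> V c] bounded_timeD(2)[OF S, of \<omega>] by simp
  ultimately show ?thesis by (simp add: bounded_time_def hitting_le_T)
qed



section \<open>Martingales closed by their terminal value\<close>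

text \<open>The identity \<open>Z t = E[Z T | F t]\<close> in integrated form, which is the one that passes to limits.\<close>

definition closed_martingale :: "(real \<Rightarrow> 'a \<Rightarrow> real) \<Rightarrow> bool" where
  "closed_martingale Z \<longleftrightarrow>
     (\<forall>t\<in>{0..T}. integrable M (Z t)) \<and>
     (\<forall>t\<in>{0..T}. \<forall>A\<in>sets (F t).
        (\<integral>\<omega>. indicator A \<omega> * Z T \<omega> \<partial>M) = (\<integral>\<omega>. indicator A \<omega> * Z t \<omega> \<partial>M))"

lemma integrable_indicator_mult:
  "A \<in> sets M \<Longrightarrow> integrable M f \<Longrightarrow> integrable M (\<lambda>\<omega>. indicator A \<omega> * f \<omega> :: real)"
  using integrable_real_mult_indicator[of A M f] by (simp add: mult.commute)

text \<open>
  Rounding the stopping time up to a finite grid reduces optional sampling to finitely many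
  deterministic times; the dominating variable then allows the mesh to tend to 0.
\<close>

lemma optional_sampling:
  assumes Z: "closed_martingale Z" "adapted_process F T Z" "rcll_process M T Z"
    and R: "integrable M R" "AE \<omega> in M. \<forall>t\<in>{0..T}. \<bar>Z t \<omega>\<bar> \<le> R \<omega>"
    and S: "bounded_time S" and A: "A \<in> sets (sigma_at M F S)"
  shows "(\<integral>\<omega>. indicator A \<omega> * Z (S \<omega>) \<omega> \<partial>M) = (\<integral>\<omega>. indicator A \<omega> * Z T \<omega> \<partial>M)"
proof -
  have AM [measurable]: "A \<in> sets M"
    using A subalgebra_sigma_at[OF bounded_timeD(1)[OF S]] by (auto simp: subalgebra_def)
  have int: "integrable M (Z t)" if "t \<in> {0..T}" for t
    using Z(1) that by (auto simp: closed_martingale_def)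
  have step: "integrable M (\<lambda>\<omega>. indicator A \<omega> * Z (grid k T (S \<omega>)) \<omega>) \<and>
      (\<integral>\<omega>. indicator A \<omega> * Z (grid k T (S \<omega>)) \<omega> \<partial>M) = (\<integral>\<omega>. indicator A \<omega> * Z T \<omega> \<partial>M)" for k
  proof -
    let ?n = "real (Suc k)"
    define J where "J \<omega> = \<lceil>?n * S \<omega> / T\<rceil>" for \<omega>
    define q where "q j = T * real_of_int j / ?n" for j
    define B where "B j = {\<omega> \<in> A. J \<omega> = j}" for j
    let ?I = "{0..int (Suc k)}"
    have JI: "J \<omega> \<in> ?I" for \<omega>
    proof -
      have "0 \<le> ?n * S \<omega> / T" "?n * S \<omega> / T \<le> ?n"
        using bounded_timeD(2-4)[OF S, of \<omega>] T_pos by (auto simp: divide_le_eq mult_left_mono)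
      then have "0 \<le> \<lceil>?n * S \<omega> / T\<rceil>" "\<lceil>?n * S \<omega> / T\<rceil> \<le> int (Suc k)"
        by (linarith, simp add: ceiling_le_iff)
      then show ?thesis by (simp add: J_def)
    qed
    have q: "q j \<in> {0..T}" if "j \<in> ?I" for j
    proof -
      have "real_of_int j \<le> ?n" using that by simp
      then have "T * real_of_int j \<le> T * ?n" using T_pos by (intro mult_left_mono) auto
      then have "q j \<le> T" unfolding q_def by (subst pos_divide_le_eq) auto
      then show ?thesis using that T_pos by (simp add: q_def)
    qed
    have B: "B j \<in> sets (F (q j))" for j
    proof -
      have "J \<omega> = j \<longleftrightarrow> S \<omega> \<le> q j \<and> \<not> S \<omega> \<le> q (j - 1)" for \<omega>
      proof -
        have "S \<omega> \<le> q i \<longleftrightarrow> J \<omega> \<le> i" for i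
          using T_pos by (simp add: q_def J_def ceiling_le_iff field_simps)
        then show ?thesis by auto
      qed
      then have B_eq: "B j = {\<omega> \<in> A. S \<omega> \<le> q j} - {\<omega> \<in> A. S \<omega> \<le> q (j - 1)}"
        by (auto simp: B_def)
      have le: "{\<omega> \<in> A. S \<omega> \<le> t} \<in> sets (F t)" for t
        using A by (simp add: sets_sigma_at[OF bounded_timeD(1)[OF S]])
      have "q (j - 1) \<le> q j"
        using T_pos unfolding q_def by (intro divide_right_mono mult_left_mono) auto
      then have "sets (F (q (j - 1))) \<subseteq> sets (F (q j))" by (rule sets_F_mono)
      then show ?thesis unfolding B_eq using le by (intro sets.Diff) blast+
    qed
    have BM: "B j \<in> sets M" for j using B sets_F_le by blast
    have split: "indicator A \<omega> * y (J \<omega>) = (\<Sum>j\<in>?I. indicator (B j) \<omega> * y j)" for \<omega> and y :: "int \<Rightarrow> real"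
    proof -
      have "(\<Sum>j\<in>?I. indicator (B j) \<omega> * y j) = (\<Sum>j\<in>?I. if j = J \<omega> then indicator A \<omega> * y j else 0)"
        by (intro sum.cong) (auto simp: B_def indicator_def)
      then show ?thesis using JI[of \<omega>] by simp
    qed
    have eq: "indicator A \<omega> * Z (grid k T (S \<omega>)) \<omega> = (\<Sum>j\<in>?I. indicator (B j) \<omega> * Z (q j) \<omega>)" for \<omega>
      using split[of \<omega> "\<lambda>j. Z (q j) \<omega>"] by (simp add: grid_def q_def J_def)
    have intB: "integrable M (\<lambda>\<omega>. indicator (B j) \<omega> * Z t \<omega>)" if "t \<in> {0..T}" for j t
      using BM int[OF that] by (rule integrable_indicator_mult)
    have "(\<integral>\<omega>. indicator A \<omega> * Z (grid k T (S \<omega>)) \<omega> \<partial>M) = (\<Sum>j\<in>?I. \<integral>\<omega>. indicator (B j) \<omega> * Z (q j) \<omega> \<partial>M)"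
      unfolding eq by (intro Bochner_Integration.integral_sum intB q)
    also have "\<dots> = (\<Sum>j\<in>?I. \<integral>\<omega>. indicator (B j) \<omega> * Z T \<omega> \<partial>M)"
    proof (rule sum.cong[OF refl])
      fix j assume "j \<in> ?I"
      from Z(1)[unfolded closed_martingale_def, THEN conjunct2, rule_format, OF q[OF this] B]
      show "(\<integral>\<omega>. indicator (B j) \<omega> * Z (q j) \<omega> \<partial>M) = (\<integral>\<omega>. indicator (B j) \<omega> * Z T \<omega> \<partial>M)"
        by (rule sym)
    qed
    also have "\<dots> = (\<integral>\<omega>. (\<Sum>j\<in>?I. indicator (B j) \<omega> * Z T \<omega>) \<partial>M)"
      using T_pos by (intro Bochner_Integration.integral_sum[symmetric] intB) auto
    also have "\<dots> = (\<integral>\<omega>. indicator A \<omega> * Z T \<omega> \<partial>M)"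
      by (intro Bochner_Integration.integral_cong refl split[symmetric])
    finally have "(\<integral>\<omega>. indicator A \<omega> * Z (grid k T (S \<omega>)) \<omega> \<partial>M) = (\<integral>\<omega>. indicator A \<omega> * Z T \<omega> \<partial>M)" .
    moreover have "integrable M (\<lambda>\<omega>. indicator A \<omega> * Z (grid k T (S \<omega>)) \<omega>)"
      unfolding eq by (intro Bochner_Integration.integrable_sum intB q)
    ultimately show ?thesis by blast
  qed
  have "(\<lambda>k. \<integral>\<omega>. indicator A \<omega> * Z (grid k T (S \<omega>)) \<omega> \<partial>M) \<longlonglongrightarrow> (\<integral>\<omega>. indicator A \<omega> * Z (S \<omega>) \<omega> \<partial>M)"
  proof (rule integral_dominated_convergence[where w=R])
    show "(\<lambda>\<omega>. indicator A \<omega> * Z (S \<omega>) \<omega>) \<in> borel_measurable M"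
      using stopped_integrable[OF Z(2,3) S R] by measurable
    show "(\<lambda>\<omega>. indicator A \<omega> * Z (grid k T (S \<omega>)) \<omega>) \<in> borel_measurable M" for k
      using step by blast
    show "AE \<omega> in M. (\<lambda>k. indicator A \<omega> * Z (grid k T (S \<omega>)) \<omega>) \<longlonglongrightarrow> indicator A \<omega> * Z (S \<omega>) \<omega>"
    proof (rule AE_I2)
      fix \<omega> assume "\<omega> \<in> space M"
      then show "(\<lambda>k. indicator A \<omega> * Z (grid k T (S \<omega>)) \<omega>) \<longlonglongrightarrow> indicator A \<omega> * Z (S \<omega>) \<omega>"
        using Z(3) T_pos bounded_timeD(2-4)[OF S, of \<omega>]
        by (intro tendsto_mult_left grid_tendsto) (auto simp: rcll_process_def)
    qed
    show "AE \<omega> in M. norm (indicator A \<omega> * Z (grid k T (S \<omega>)) \<omega>) \<le> R \<omega>" for k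
      using R(2)
    proof eventually_elim
      case (elim \<omega>)
      have "grid k T (S \<omega>) \<in> {0..T}"
        using grid_bounds[OF T_pos, of "S \<omega>" k] bounded_timeD(2-4)[OF S, of \<omega>]
        by auto
      then have "\<bar>Z (grid k T (S \<omega>)) \<omega>\<bar> \<le> R \<omega>" using elim by blast
      then show ?case by (auto simp: indicator_def)
    qed
  qed (rule R(1))
  then have "(\<lambda>k::nat. \<integral>\<omega>. indicator A \<omega> * Z T \<omega> \<partial>M) \<longlonglongrightarrow> (\<integral>\<omega>. indicator A \<omega> * Z (S \<omega>) \<omega> \<partial>M)"
    using step by simp
  then show ?thesis by (simp add: LIMSEQ_const_iff)
qed

lemma AE_eq_if_integrals_eq:
  fixes U V :: "'a \<Rightarrow> real"
  assumes G: "subalgebra M G" and U: "integrable M U" "U \<in> borel_measurable G"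
    and V: "integrable M V" "V \<in> borel_measurable G"
    and eq: "\<And>A. A \<in> sets G \<Longrightarrow> (\<integral>\<omega>. indicator A \<omega> * U \<omega> \<partial>M) = (\<integral>\<omega>. indicator A \<omega> * V \<omega> \<partial>M)"
  shows "AE \<omega> in M. U \<omega> = V \<omega>"
proof -
  interpret G: finite_measure_subalgebra M G
    by unfold_locales (rule G)
  have "AE \<omega> in M. real_cond_exp M G U \<omega> = V \<omega>"
    by (rule G.real_cond_exp_charact) (use assms in \<open>auto simp: set_lebesgue_integral_def\<close>)
  moreover have "AE \<omega> in M. real_cond_exp M G U \<omega> = U \<omega>"
    using U by (rule G.real_cond_exp_F_meas)
  ultimately show ?thesis by eventually_elim simp
qed

text \<open>
  At a predictable time announced by \<open>\<sigma>\<close>, the values at \<open>\<sigma> k\<close> tend to the left limit, which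
  therefore has the same integral as the terminal value over every set of the form
  \<open>A \<inter> {t < \<tau>}\<close> with \<open>A \<in> F t\<close>. These sets, together with \<open>F 0\<close>, generate the \<open>\<sigma>\<close>-algebra
  strictly before \<open>\<tau>\<close>, which by quasi-left-continuity is all of the \<open>\<sigma>\<close>-algebra at \<open>\<tau>\<close>. So the
  left limit and the value at \<open>\<tau>\<close> are both the conditional expectation of the terminal value.
\<close>

lemma martingale_no_predictable_jump:
  assumes qlc: "quasi_left_continuous M F"
    and Z: "closed_martingale Z" "adapted_process F T Z" "rcll_process M T Z"
    and R: "integrable M R" "AE \<omega> in M. \<forall>t\<in>{0..T}. \<bar>Z t \<omega>\<bar> \<le> R \<omega>"
    and \<tau>: "\<tau> \<in> predictable_times0 M F T"
  shows "AE \<omega> in M. 0 < \<tau> \<omega> \<longrightarrow> Lim (at_left (\<tau> \<omega>)) (\<lambda>t. Z t \<omega>) = Z (\<tau> \<omega>) \<omega>"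
proof -
  have \<tau>0: "\<tau> \<in> stopping_times0 M F T" and pred: "predictable_time M F \<tau>"
    using \<tau> by (auto simp: predictable_times0_def)
  obtain \<sigma> :: "nat \<Rightarrow> 'a \<Rightarrow> real" where \<sigma>: "\<And>n. stopping_time F (\<sigma> n)"
    and \<sigma>_ae: "AE \<omega> in M. (\<forall>n. 0 \<le> \<sigma> n \<omega>) \<and> incseq (\<lambda>n. \<sigma> n \<omega>) \<and> (\<lambda>n. \<sigma> n \<omega>) \<longlonglongrightarrow> \<tau> \<omega> \<and>
      (0 < \<tau> \<omega> \<longrightarrow> (\<forall>n. \<sigma> n \<omega> < \<tau> \<omega>))"
    using pred by (auto simp: predictable_time_def)
  define r where "r = clamp \<tau>"
  define s where "s n \<omega> = min (clamp (\<sigma> n) \<omega>) (r \<omega>)" for n \<omega>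
  have r: "bounded_time r"
    using pred by (simp add: r_def bounded_time_clamp predictable_time_def)
  have s: "bounded_time (s n)" for n
    unfolding s_def by (intro bounded_time_min bounded_time_clamp \<sigma> r)
  have r_eq: "AE \<omega> in M. r \<omega> = \<tau> \<omega>" unfolding r_def using \<tau>0 by (rule clamp_AE)
  have ann: "AE \<omega> in M. (\<lambda>n. s n \<omega>) \<longlonglongrightarrow> r \<omega> \<and> (0 < r \<omega> \<longrightarrow> (\<forall>n. s n \<omega> < r \<omega>))"
    using \<sigma>_ae r_eq
  proof eventually_elim
    case (elim \<omega>)
    have le: "\<sigma> n \<omega> \<le> \<tau> \<omega>" for n
      using elim incseq_le by blast
    have "\<tau> \<omega> \<le> T" using elim bounded_timeD(3)[OF r, of \<omega>] by simp
    then have "\<sigma> n \<omega> \<le> T" for n using le[of n] by linarith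
    with le have "s n \<omega> = \<sigma> n \<omega>" for n
      using elim by (simp add: s_def clamp_def min_absorb1 max_absorb2)
    then show ?case using elim by simp
  qed
  have pred_r: "predictable_time M F r"
    unfolding predictable_time_def
  proof (intro conjI exI[of _ \<sigma>] allI \<sigma>)
    show "AE \<omega> in M. (\<forall>n. 0 \<le> \<sigma> n \<omega>) \<and> incseq (\<lambda>n. \<sigma> n \<omega>) \<and> (\<lambda>n. \<sigma> n \<omega>) \<longlonglongrightarrow> r \<omega> \<and>
      (0 < r \<omega> \<longrightarrow> (\<forall>n. \<sigma> n \<omega> < r \<omega>))"
      using \<sigma>_ae r_eq by eventually_elim simp
  qed (use bounded_timeD[OF r] in auto)
  define U where "U \<omega> = lim (\<lambda>n. Z (s n \<omega>) \<omega>)" for \<omega>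
  have conv: "AE \<omega> in M. (\<lambda>n. Z (s n \<omega>) \<omega>) \<longlonglongrightarrow> U \<omega> \<and>
      (0 < r \<omega> \<longrightarrow> Lim (at_left (r \<omega>)) (\<lambda>t. Z t \<omega>) = U \<omega>)"
    using ann AE_space
  proof eventually_elim
    case (elim \<omega>)
    show ?case
    proof (cases "0 < r \<omega>")
      case True
      then have "filterlim (\<lambda>n. s n \<omega>) (at_left (r \<omega>)) sequentially"
        using elim by (auto simp: filterlim_at order_less_imp_not_eq intro!: always_eventually)
      moreover have "((\<lambda>t. Z t \<omega>) \<longlongrightarrow> Lim (at_left (r \<omega>)) (\<lambda>t. Z t \<omega>)) (at_left (r \<omega>))"
        using Z(3) elim True bounded_timeD(2-4)[OF r, of \<omega>]
        by (intro rcll_onD_left) (auto simp: rcll_process_def)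
      ultimately have lim: "(\<lambda>n. Z (s n \<omega>) \<omega>) \<longlonglongrightarrow> Lim (at_left (r \<omega>)) (\<lambda>t. Z t \<omega>)"
        by (rule filterlim_compose[rotated])
      then show ?thesis using limI[OF lim] by (simp add: U_def)
    next
      case False
      then have "s n \<omega> = 0" for n
        using bounded_timeD(2-4)[OF s, of n \<omega>] by (simp add: s_def)
      then show ?thesis using False by (simp add: U_def)
    qed
  qed
  have bound: "AE \<omega> in M. norm (Z (s n \<omega>) \<omega>) \<le> R \<omega>" for n
    using R(2) by eventually_elim (use bounded_timeD(4)[OF s] in auto)
  have Zs_meas: "(\<lambda>\<omega>. Z (s n \<omega>) \<omega>) \<in> borel_measurable (sigma_at M F r)" for n
  proof -
    have "sets (sigma_at M F (s n)) \<subseteq> sets (sigma_at M F r)"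
      using bounded_timeD(1)[OF s] bounded_timeD(1)[OF r] by (rule sigma_at_mono) (simp add: s_def)
    then show ?thesis
      using stopped_measurable[OF Z(2,3) s, of n] by (auto simp: measurable_def space_sigma_at)
  qed
  have U_meas: "U \<in> borel_measurable (sigma_at M F r)"
    unfolding U_def by (rule borel_measurable_lim_metric) (rule Zs_meas)
  have U_meas_M [measurable]: "U \<in> borel_measurable M"
    using U_meas bounded_timeD(1)[OF r] by (rule measurable_sigma_at_M[rotated])
  have Zs_meas_M [measurable]: "(\<lambda>\<omega>. Z (s n \<omega>) \<omega>) \<in> borel_measurable M" for n
    using Zs_meas bounded_timeD(1)[OF r] by (rule measurable_sigma_at_M[rotated])
  have U_int: "integrable M U"
  proof (rule Bochner_Integration.integrable_bound[OF R(1)])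
    have "AE \<omega> in M. \<forall>n. norm (Z (s n \<omega>) \<omega>) \<le> R \<omega>"
      using bound by (simp add: AE_all_countable)
    then show "AE \<omega> in M. norm (U \<omega>) \<le> norm (R \<omega>)"
      using conv
    proof eventually_elim
      case (elim \<omega>)
      then have "norm (U \<omega>) \<le> R \<omega>" by (intro LIMSEQ_le_const2[OF tendsto_norm]) auto
      then show ?case by simp
    qed
  qed measurable
  have ZT: "integrable M (Z T)" using Z(1) T_pos by (auto simp: closed_martingale_def)
  have limit: "(\<integral>\<omega>. indicator B \<omega> * U \<omega> \<partial>M) = (\<integral>\<omega>. indicator B \<omega> * Z T \<omega> \<partial>M)"
    if Bn: "\<And>n. Bn n \<in> sets (sigma_at M F (s n))" and B: "B \<in> sets M"
      and ev: "AE \<omega> in M. (\<lambda>n. indicator (Bn n) \<omega> :: real) \<longlonglongrightarrow> indicator B \<omega>" for Bn B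
  proof -
    have [measurable]: "Bn n \<in> sets M" for n
      using Bn subalgebra_sigma_at[OF bounded_timeD(1)[OF s]] by (auto simp: subalgebra_def)
    note [measurable] = B
    have [measurable]: "Z T \<in> borel_measurable M" using ZT by auto
    have "(\<lambda>n. \<integral>\<omega>. indicator (Bn n) \<omega> * Z (s n \<omega>) \<omega> \<partial>M) \<longlonglongrightarrow> (\<integral>\<omega>. indicator B \<omega> * U \<omega> \<partial>M)"
    proof (rule integral_dominated_convergence[where w=R])
      show "AE \<omega> in M. (\<lambda>n. indicator (Bn n) \<omega> * Z (s n \<omega>) \<omega>) \<longlonglongrightarrow> indicator B \<omega> * U \<omega>"
        using ev conv by eventually_elim (auto intro: tendsto_mult)
      show "AE \<omega> in M. norm (indicator (Bn n) \<omega> * Z (s n \<omega>) \<omega>) \<le> R \<omega>" for n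
        using bound[of n] by eventually_elim (auto simp: indicator_def)
    qed (use R(1) in measurable)
    moreover have "(\<lambda>n. \<integral>\<omega>. indicator (Bn n) \<omega> * Z T \<omega> \<partial>M) \<longlonglongrightarrow> (\<integral>\<omega>. indicator B \<omega> * Z T \<omega> \<partial>M)"
    proof (rule integral_dominated_convergence[where w="\<lambda>\<omega>. \<bar>Z T \<omega>\<bar>"])
      show "AE \<omega> in M. (\<lambda>n. indicator (Bn n) \<omega> * Z T \<omega>) \<longlonglongrightarrow> indicator B \<omega> * Z T \<omega>"
        using ev by eventually_elim (auto intro: tendsto_mult)
      show "AE \<omega> in M. norm (indicator (Bn n) \<omega> * Z T \<omega>) \<le> \<bar>Z T \<omega>\<bar>" for n
        by (auto simp: indicator_def)
    qed (use ZT in \<open>measurable, auto\<close>)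
    moreover have "(\<integral>\<omega>. indicator (Bn n) \<omega> * Z (s n \<omega>) \<omega> \<partial>M) = (\<integral>\<omega>. indicator (Bn n) \<omega> * Z T \<omega> \<partial>M)" for n
      by (rule optional_sampling[OF Z R s Bn])
    ultimately show ?thesis using LIMSEQ_unique by auto
  qed
  define \<G> where "\<G> = sets (F 0) \<union> {A \<inter> {\<omega> \<in> space M. t < r \<omega>} | A t. 0 \<le> t \<and> A \<in> sets (F t)}"
  have \<G>_sub: "\<G> \<subseteq> Pow (space M)"
    using sets.sets_into_space[of _ "F _"] by (auto simp: \<G>_def space_F)
  have \<G>_cases: "B \<in> sets (F 0) \<or>
      (\<exists>A t. B = A \<inter> {\<omega> \<in> space M. t < r \<omega>} \<and> 0 \<le> t \<and> A \<in> sets (F t))" if "B \<in> \<G>" for B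
    using that unfolding \<G>_def by simp
  have \<G>I: "A \<inter> {\<omega> \<in> space M. t < r \<omega>} \<in> \<G>" if "0 \<le> t" "A \<in> sets (F t)" for A t
    unfolding \<G>_def using that by (intro UnI2 CollectI exI[of _ A] exI[of _ t]) simp
  have F0_Int: "a \<inter> b \<in> \<G>" if a: "a \<in> sets (F 0)" and b: "b \<in> \<G>" for a b
    using \<G>_cases[OF b]
  proof (elim disjE exE conjE)
    assume "b \<in> sets (F 0)"
    then show ?thesis using a by (simp add: \<G>_def)
  next
    fix A t assume b: "b = A \<inter> {\<omega> \<in> space M. t < r \<omega>}" and A: "0 \<le> t" "A \<in> sets (F t)"
    have "a \<inter> b = (a \<inter> A) \<inter> {\<omega> \<in> space M. t < r \<omega>}" by (simp add: b Int_assoc)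
    then show ?thesis using \<G>I[of t "a \<inter> A"] a A sets_F0_le[of t] by auto
  qed
  have \<G>_Int: "Int_stable \<G>"
  proof (rule Int_stableI)
    fix a b assume a: "a \<in> \<G>" and b: "b \<in> \<G>"
    from \<G>_cases[OF a] show "a \<inter> b \<in> \<G>"
    proof (elim disjE exE conjE)
      assume "a \<in> sets (F 0)"
      then show ?thesis using b by (rule F0_Int)
    next
      fix A t assume aA: "a = A \<inter> {\<omega> \<in> space M. t < r \<omega>}" and A: "0 \<le> t" "A \<in> sets (F t)"
      from \<G>_cases[OF b] show ?thesis
      proof (elim disjE exE conjE)
        assume "b \<in> sets (F 0)"
        then have "b \<inter> a \<in> \<G>" using a by (rule F0_Int)
        then show ?thesis by (simp add: Int_commute)
      next
        fix B u assume bB: "b = B \<inter> {\<omega> \<in> space M. u < r \<omega>}" and B: "0 \<le> u" "B \<in> sets (F u)"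
        have "a \<inter> b = (A \<inter> B) \<inter> {\<omega> \<in> space M. max t u < r \<omega>}" by (auto simp: aA bB)
        moreover have "A \<inter> B \<in> sets (F (max t u))"
          using A B sets_F_mono[of t "max t u"] sets_F_mono[of u "max t u"] by auto
        ultimately show ?thesis using \<G>I[of "max t u" "A \<inter> B"] A by simp
      qed
    qed
  qed
  have \<G>_eq: "(\<integral>\<omega>. indicator B \<omega> * U \<omega> \<partial>M) = (\<integral>\<omega>. indicator B \<omega> * Z T \<omega> \<partial>M)" if B: "B \<in> \<G>" for B
  proof -
    consider (0) "B \<in> sets (F 0)"
      | (1) A t where "B = A \<inter> {\<omega> \<in> space M. t < r \<omega>}" "0 \<le> t" "A \<in> sets (F t)"
      using \<G>_cases[OF B] by metis
    then show ?thesis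
    proof cases
      case 0
      then show ?thesis
        using sets_F0_le_sigma_at[OF bounded_timeD(1)[OF s]] sets_F_le
        by (intro limit[of "\<lambda>_. B"]) auto
    next
      case 1
      show ?thesis
      proof (rule limit[of "\<lambda>n. A \<inter> {\<omega> \<in> space M. t < s n \<omega>}"])
        show "A \<inter> {\<omega> \<in> space M. t < s n \<omega>} \<in> sets (sigma_at M F (s n))" for n
          unfolding sets_sigma_at[OF bounded_timeD(1)[OF s]]
        proof safe
          fix u
          show "{\<omega> \<in> A \<inter> {\<omega> \<in> space M. t < s n \<omega>}. s n \<omega> \<le> u} \<in> sets (F u)" (is "?E \<in> _")
          proof (cases "t \<le> u")
            case True
            have "?E = A \<inter> ({\<omega> \<in> space (F u). s n \<omega> \<le> u} - {\<omega> \<in> space (F u). s n \<omega> \<le> t})"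
              by (auto simp: space_F)
            also have "\<dots> \<in> sets (F u)"
              using stopping_time_le_const[OF bounded_timeD(1)[OF s], of _ u n] True 1(3) sets_F_mono[OF True]
              by (intro sets.Int sets.Diff) (auto simp: pred_def)
            finally show ?thesis .
          next
            case False
            then have "?E = {}" by auto
            then show ?thesis by (simp only: sets.empty_sets)
          qed
        qed
        show "B \<in> sets M"
          unfolding 1 using bounded_time_measurable[OF r] 1(3) sets_F_le by (intro sets.Int) auto
        show "AE \<omega> in M. (\<lambda>n. indicator (A \<inter> {\<omega> \<in> space M. t < s n \<omega>}) \<omega> :: real) \<longlonglongrightarrow> indicator B \<omega>"
          using ann
        proof eventually_elim
          case (elim \<omega>)
          show ?case
          proof (rule tendsto_eventually)
            show "\<forall>\<^sub>F n in sequentially.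
                indicator (A \<inter> {\<omega> \<in> space M. t < s n \<omega>}) \<omega> = (indicator B \<omega> :: real)"
            proof (cases "t < r \<omega>")
              case True
              then have "\<forall>\<^sub>F n in sequentially. t < s n \<omega>" using elim by (intro order_tendstoD) auto
              then show ?thesis
                by eventually_elim (use True in \<open>auto simp: 1 indicator_def\<close>)
            next
              case False
              then have "\<not> t < s n \<omega>" for n by (auto simp: s_def)
              then show ?thesis using False by (auto simp: 1 indicator_def)
            qed
          qed
        qed
      qed
    qed
  qed
  have sub: "sigma_sets (space M) \<G> \<subseteq> sets M"
  proof (rule sets.sigma_sets_subset)
    have [measurable]: "r \<in> borel_measurable M" by (rule bounded_time_measurable[OF r])
    have "A \<inter> {\<omega> \<in> space M. t < r \<omega>} \<in> sets M" if "A \<in> sets (F t)" for A t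
    proof (rule sets.Int)
      show "A \<in> sets M" using that sets_F_le by blast
    qed measurable
    then show "\<G> \<subseteq> sets M" using sets_F_le by (auto simp: \<G>_def)
  qed
  have before: "(\<integral>\<omega>. indicator B \<omega> * U \<omega> \<partial>M) = (\<integral>\<omega>. indicator B \<omega> * Z T \<omega> \<partial>M)"
    if B: "B \<in> sigma_sets (space M) \<G>" for B
    using \<G>_Int \<G>_sub B
  proof (induction rule: sigma_sets_induct_disjoint)
    case (basic A)
    then show ?case by (rule \<G>_eq)
  next
    case empty
    then show ?case by simp
  next
    case (compl A)
    have [measurable]: "A \<in> sets M" using compl sub by blast
    have eq: "(\<integral>\<omega>. indicator (space M - A) \<omega> * f \<omega> \<partial>M)
        = (\<integral>\<omega>. f \<omega> \<partial>M) - (\<integral>\<omega>. indicator A \<omega> * f \<omega> \<partial>M)" if "integrable M f" for f :: "'a \<Rightarrow> real"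
    proof -
      have "(\<integral>\<omega>. indicator (space M - A) \<omega> * f \<omega> \<partial>M) = (\<integral>\<omega>. f \<omega> - indicator A \<omega> * f \<omega> \<partial>M)"
        by (intro Bochner_Integration.integral_cong) (auto simp: indicator_def)
      then show ?thesis using that by (simp add: integrable_indicator_mult)
    qed
    have "(\<integral>\<omega>. U \<omega> \<partial>M) = (\<integral>\<omega>. indicator (space M) \<omega> * U \<omega> \<partial>M)"
      by (intro Bochner_Integration.integral_cong) auto
    also have "\<dots> = (\<integral>\<omega>. indicator (space M) \<omega> * Z T \<omega> \<partial>M)"
      by (rule \<G>_eq) (use sets.top[of "F 0"] in \<open>auto simp: \<G>_def space_F\<close>)
    also have "\<dots> = (\<integral>\<omega>. Z T \<omega> \<partial>M)"
      by (intro Bochner_Integration.integral_cong) auto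
    finally show ?case using compl by (simp add: eq U_int ZT)
  next
    case (union A)
    have eq: "(\<integral>\<omega>. indicator (\<Union>i. A i) \<omega> * f \<omega> \<partial>M) = (\<Sum>i. \<integral>\<omega>. indicator (A i) \<omega> * f \<omega> \<partial>M)"
      if f: "integrable M f" for f :: "'a \<Rightarrow> real"
    proof -
      have "(LINT \<omega>:(\<Union>i. A i)|M. f \<omega>) = (\<Sum>i. LINT \<omega>:A i|M. f \<omega>)"
      proof (rule lebesgue_integral_countable_add)
        show AM: "A i \<in> sets M" for i using union(2) sub by auto
        show "A i \<inter> A j = {}" if "i \<noteq> j" for i j
          using union(1) that by (auto simp: disjoint_family_on_def)
        show "set_integrable M (\<Union>i. A i) f"
          unfolding set_integrable_def using AM f by (intro integrable_mult_indicator) auto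
      qed
      then show ?thesis by (simp add: set_lebesgue_integral_def)
    qed
    show ?case using union by (simp add: eq[OF U_int] eq[OF ZT])
  qed
  have "AE \<omega> in M. U \<omega> = Z (r \<omega>) \<omega>"
  proof (rule AE_eq_if_integrals_eq[OF subalgebra_sigma_at[OF bounded_timeD(1)[OF r]] U_int U_meas])
    show "integrable M (\<lambda>\<omega>. Z (r \<omega>) \<omega>)" by (rule stopped_integrable[OF Z(2,3) r R])
    show "(\<lambda>\<omega>. Z (r \<omega>) \<omega>) \<in> borel_measurable (sigma_at M F r)"
      by (rule stopped_measurable[OF Z(2,3) r])
    fix B assume B: "B \<in> sets (sigma_at M F r)"
    then have "B \<in> sets (sigma_before M F r)"
      using qlc pred_r by (auto simp: quasi_left_continuous_def)
    then have "B \<in> sigma_sets (space M) \<G>"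
      unfolding sigma_before_def \<G>_def[symmetric] using \<G>_sub by (simp add: sets_measure_of)
    then show "(\<integral>\<omega>. indicator B \<omega> * U \<omega> \<partial>M) = (\<integral>\<omega>. indicator B \<omega> * Z (r \<omega>) \<omega> \<partial>M)"
      using optional_sampling[OF Z R r B] by (simp add: before)
  qed
  with conv r_eq show ?thesis by eventually_elim auto
qed

end


section \<open>The stochastic integrals are closed martingales\<close>

context usual_conditions
begin

text \<open>A bound on the second moment controls the integrals over all events at once.\<close>

lemma small_L2:
  fixes f :: "'a \<Rightarrow> real"
  assumes [measurable]: "f \<in> borel_measurable M"
    and le: "(\<integral>\<^sup>+\<omega>. ennreal ((f \<omega>)\<^sup>2) \<partial>M) \<le> ennreal (\<epsilon>\<^sup>2)" and \<epsilon>: "0 \<le> \<epsilon>"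
  shows "integrable M f" and "A \<in> sets M \<Longrightarrow> \<bar>\<integral>\<omega>. indicator A \<omega> * f \<omega> \<partial>M\<bar> \<le> \<epsilon>"
proof -
  have sq: "integrable M (\<lambda>\<omega>. (f \<omega>)\<^sup>2)"
    using le by (intro integrableI_nonneg) (auto simp: le_less_trans[OF _ ennreal_less_top])
  show int: "integrable M f" by (rule square_integrable_imp_integrable[OF _ sq]) simp
  assume A [measurable]: "A \<in> sets M"
  let ?g = "\<lambda>\<omega>. indicator A \<omega> * f \<omega>"
  have g: "integrable M ?g" by (rule integrable_indicator_mult[OF A int])
  have g2: "(?g \<omega>)\<^sup>2 = indicator A \<omega> * (f \<omega>)\<^sup>2" for \<omega> by (simp add: indicator_def)
  have g2_int: "integrable M (\<lambda>\<omega>. (?g \<omega>)\<^sup>2)" unfolding g2 by (rule integrable_indicator_mult[OF A sq])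
  have "(expectation ?g)\<^sup>2 \<le> expectation (\<lambda>\<omega>. (?g \<omega>)\<^sup>2)"
    using variance_positive[of ?g] variance_eq[OF g g2_int] by simp
  also have "\<dots> \<le> expectation (\<lambda>\<omega>. (f \<omega>)\<^sup>2)"
    by (intro integral_mono g2_int sq) (auto simp: indicator_def)
  also have "\<dots> \<le> \<epsilon>\<^sup>2"
  proof -
    have "ennreal (expectation (\<lambda>\<omega>. (f \<omega>)\<^sup>2)) \<le> ennreal (\<epsilon>\<^sup>2)"
      using le by (subst (asm) nn_integral_eq_integral[OF sq]) auto
    then show ?thesis by simp
  qed
  finally have "\<bar>expectation ?g\<bar> \<le> \<bar>\<epsilon>\<bar>" by (simp only: abs_le_square_iff)
  then show "\<bar>expectation ?g\<bar> \<le> \<epsilon>" using \<epsilon> by simp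
qed

lemma closed_martingale_add:
  assumes X: "closed_martingale X" and Y: "closed_martingale Y"
  shows "closed_martingale (\<lambda>t \<omega>. X t \<omega> + Y t \<omega>)"
proof -
  have int: "integrable M (X t)" "integrable M (Y t)" if "t \<in> {0..T}" for t
    using X Y that by (auto simp: closed_martingale_def)
  have split: "(\<integral>\<omega>. indicator A \<omega> * (X t \<omega> + Y t \<omega>) \<partial>M)
      = (\<integral>\<omega>. indicator A \<omega> * X t \<omega> \<partial>M) + (\<integral>\<omega>. indicator A \<omega> * Y t \<omega> \<partial>M)"
    if "A \<in> sets M" "t \<in> {0..T}" for A t
    using integrable_indicator_mult[OF that(1) int(1)[OF that(2)]]
      integrable_indicator_mult[OF that(1) int(2)[OF that(2)]]
    by (simp add: distrib_left)
  show ?thesis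
    unfolding closed_martingale_def
  proof (intro conjI ballI)
    fix t A assume t: "t \<in> {0..T}" and A: "A \<in> sets (F t)"
    have AM: "A \<in> sets M" using A sets_F_le by blast
    have T: "T \<in> {0..T}" using T_pos by simp
    have "(\<integral>\<omega>. indicator A \<omega> * X T \<omega> \<partial>M) = (\<integral>\<omega>. indicator A \<omega> * X t \<omega> \<partial>M)"
      "(\<integral>\<omega>. indicator A \<omega> * Y T \<omega> \<partial>M) = (\<integral>\<omega>. indicator A \<omega> * Y t \<omega> \<partial>M)"
      using X Y t A by (auto simp: closed_martingale_def)
    then show "(\<integral>\<omega>. indicator A \<omega> * (X T \<omega> + Y T \<omega>) \<partial>M) = (\<integral>\<omega>. indicator A \<omega> * (X t \<omega> + Y t \<omega>) \<partial>M)"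
      by (simp add: split[OF AM t] split[OF AM T])
  qed (use int in auto)
qed

lemma closed_martingale_zero: "closed_martingale (\<lambda>t \<omega>. 0)"
  by (simp add: closed_martingale_def)

lemma closed_martingale_L2_limit:
  assumes X: "\<And>n::nat. closed_martingale (X n)" and I: "adapted_process F T I"
    and lim: "\<And>t. t \<in> {0..T} \<Longrightarrow> (\<lambda>n. \<integral>\<^sup>+\<omega>. ennreal ((I t \<omega> - X n t \<omega>)\<^sup>2) \<partial>M) \<longlonglongrightarrow> 0"
  shows "closed_martingale I"
proof -
  have I_meas [measurable]: "I t \<in> borel_measurable M" if "t \<in> {0..T}" for t
    using I that by (auto simp: adapted_process_def intro: measurable_F_M)
  have X_int: "integrable M (X n t)" if "t \<in> {0..T}" for n t
    using X that by (auto simp: closed_martingale_def)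
  have near: "\<forall>\<^sub>F n in sequentially. integrable M (I t) \<and> (\<forall>A\<in>sets M.
      \<bar>(\<integral>\<omega>. indicator A \<omega> * I t \<omega> \<partial>M) - (\<integral>\<omega>. indicator A \<omega> * X n t \<omega> \<partial>M)\<bar> \<le> \<epsilon>)"
    if \<epsilon>: "0 < \<epsilon>" and t: "t \<in> {0..T}" for \<epsilon> t
  proof -
    have "\<forall>\<^sub>F n in sequentially. (\<integral>\<^sup>+\<omega>. ennreal ((I t \<omega> - X n t \<omega>)\<^sup>2) \<partial>M) < ennreal (\<epsilon>\<^sup>2)"
      using \<epsilon> by (intro order_tendstoD(2)[OF lim[OF t]]) simp
    then show ?thesis
    proof eventually_elim
      case (elim n)
      have meas: "(\<lambda>\<omega>. I t \<omega> - X n t \<omega>) \<in> borel_measurable M"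
        using I_meas[OF t] X_int[OF t, of n] by (intro borel_measurable_diff) auto
      note small = small_L2[OF meas less_imp_le[OF elim] less_imp_le[OF \<epsilon>]]
      have "integrable M (\<lambda>\<omega>. (I t \<omega> - X n t \<omega>) + X n t \<omega>)"
        by (intro Bochner_Integration.integrable_add small(1) X_int t)
      then have int: "integrable M (I t)" by simp
      moreover have "\<bar>(\<integral>\<omega>. indicator A \<omega> * I t \<omega> \<partial>M) - (\<integral>\<omega>. indicator A \<omega> * X n t \<omega> \<partial>M)\<bar> \<le> \<epsilon>"
        if A: "A \<in> sets M" for A
        using small(2)[OF A] integrable_indicator_mult[OF A int]
          integrable_indicator_mult[OF A X_int[OF t, of n]]
        by (simp add: right_diff_distrib)
      ultimately show ?case by blast
    qed
  qed
  show ?thesis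
    unfolding closed_martingale_def
  proof (intro conjI ballI)
    fix t assume t: "t \<in> {0..T}"
    show "integrable M (I t)"
      using eventually_happens'[OF sequentially_bot near[OF zero_less_one t]] by blast
    fix A assume A: "A \<in> sets (F t)"
    have AM: "A \<in> sets M" using A sets_F_le by blast
    have T: "T \<in> {0..T}" using T_pos by simp
    let ?d = "\<bar>(\<integral>\<omega>. indicator A \<omega> * I T \<omega> \<partial>M) - (\<integral>\<omega>. indicator A \<omega> * I t \<omega> \<partial>M)\<bar>"
    have "?d \<le> \<epsilon>" if "0 < \<epsilon>" for \<epsilon>
    proof -
      have \<epsilon>2: "0 < \<epsilon> / 2" using that by simp
      obtain n where n:
        "\<bar>(\<integral>\<omega>. indicator A \<omega> * I t \<omega> \<partial>M) - (\<integral>\<omega>. indicator A \<omega> * X n t \<omega> \<partial>M)\<bar> \<le> \<epsilon> / 2"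
        "\<bar>(\<integral>\<omega>. indicator A \<omega> * I T \<omega> \<partial>M) - (\<integral>\<omega>. indicator A \<omega> * X n T \<omega> \<partial>M)\<bar> \<le> \<epsilon> / 2"
        using eventually_happens'[OF sequentially_bot eventually_conj[OF near[OF \<epsilon>2 t] near[OF \<epsilon>2 T]]] AM
        by blast
      have "(\<integral>\<omega>. indicator A \<omega> * X n T \<omega> \<partial>M) = (\<integral>\<omega>. indicator A \<omega> * X n t \<omega> \<partial>M)"
        using X[of n] t A by (auto simp: closed_martingale_def)
      then show ?thesis using n by linarith
    qed
    then have "?d \<le> 0" by (rule field_le_epsilon[where y=0, simplified])
    then show "(\<integral>\<omega>. indicator A \<omega> * I T \<omega> \<partial>M) = (\<integral>\<omega>. indicator A \<omega> * I t \<omega> \<partial>M)" by simp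
  qed
qed

lemma integral_mult_indep:
  fixes K X :: "'a \<Rightarrow> real"
  assumes K: "K \<in> borel_measurable (F a)" "integrable M K" and X: "integrable M X"
    and indep: "indep_set (sets (F a)) (generated_events M J V)"
    and gen: "\<And>B. B \<in> sets borel \<Longrightarrow> X -` B \<inter> space M \<in> generated_events M J V"
  shows "integrable M (\<lambda>\<omega>. K \<omega> * X \<omega>)" "(\<integral>\<omega>. K \<omega> * X \<omega> \<partial>M) = (\<integral>\<omega>. K \<omega> \<partial>M) * (\<integral>\<omega>. X \<omega> \<partial>M)"
proof -
  have K_sub: "sigma_sets (space M) {K -` B \<inter> space M | B. B \<in> sets borel} \<subseteq> sets (F a)"
  proof -
    have "sigma_sets (space (F a)) {K -` B \<inter> space M | B. B \<in> sets borel} \<subseteq> sets (F a)"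
      using measurable_sets[OF K(1)] by (intro sets.sigma_sets_subset) (auto simp: space_F)
    then show ?thesis by (simp add: space_F)
  qed
  have X_sub: "sigma_sets (space M) {X -` B \<inter> space M | B. B \<in> sets borel} \<subseteq> generated_events M J V"
    unfolding generated_events_def
    by (rule sigma_sets_mono) (use gen in \<open>auto simp: generated_events_def\<close>)
  have "indep_var borel K borel X"
    unfolding indep_var_eq
  proof (intro conjI)
    show "indep_set (sigma_sets (space M) {K -` B \<inter> space M | B. B \<in> sets borel})
        (sigma_sets (space M) {X -` B \<inter> space M | B. B \<in> sets borel})"
      using indep K_sub X_sub unfolding indep_sets2_eq by (meson order_trans subsetD)
  qed (use K X in auto)
  then show "integrable M (\<lambda>\<omega>. K \<omega> * X \<omega>)" "(\<integral>\<omega>. K \<omega> * X \<omega> \<partial>M) = (\<integral>\<omega>. K \<omega> \<partial>M) * (\<integral>\<omega>. X \<omega> \<partial>M)"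
    using K(2) X by (auto intro: indep_var_integrable indep_var_lebesgue_integral)
qed

lemma bounded_integrable:
  fixes H :: "'a \<Rightarrow> real"
  assumes "H \<in> borel_measurable M" "bounded (H ` space M)"
  shows "integrable M H"
proof -
  obtain c where "\<And>\<omega>. \<omega> \<in> space M \<Longrightarrow> \<bar>H \<omega>\<bar> \<le> c"
    using assms(2) unfolding bounded_iff by (metis image_eqI real_norm_def)
  then show ?thesis using assms(1) by (intro integrable_const_bound[where B=c]) auto
qed

text \<open>
  A simple integral is a sum of terms \<open>H\<close> times an increment. If \<open>C a b\<close> is the increment over
  \<open>(a, b]\<close>, the part of the term accumulated after time \<open>r\<close> is \<open>H\<close> times the increment over
  \<open>(max s (min t r), t]\<close>. Unless this interval is empty, its left end point is \<open>max s r\<close>, and the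
  increment is centred and independent of the past at that time.
\<close>

lemma closed_martingale_increments:
  fixes C :: "real \<Rightarrow> real \<Rightarrow> 'a \<Rightarrow> real"
  assumes st: "0 \<le> s" "s \<le> t" "t \<le> T" and H: "H \<in> borel_measurable (F s)" "bounded (H ` space M)"
    and int: "\<And>a b. s \<le> b \<Longrightarrow> 0 \<le> a \<Longrightarrow> a \<le> b \<Longrightarrow> b \<le> t \<Longrightarrow> integrable M (C a b)"
    and int': "\<And>r. 0 \<le> r \<Longrightarrow> r \<le> T \<Longrightarrow> integrable M (\<lambda>\<omega>. H \<omega> * C (min s r) (min t r) \<omega>)"
    and mean: "\<And>a. s \<le> a \<Longrightarrow> a < t \<Longrightarrow> (\<integral>\<omega>. C a t \<omega> \<partial>M) = 0"
    and indep: "\<And>a. s \<le> a \<Longrightarrow> a < t \<Longrightarrow> indep_set (sets (F a)) (generated_events M (J a) (V a))"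
    and gen: "\<And>a B. s \<le> a \<Longrightarrow> a < t \<Longrightarrow> B \<in> sets borel \<Longrightarrow>
      C a t -` B \<inter> space M \<in> generated_events M (J a) (V a)"
    and add: "\<And>r. 0 \<le> r \<Longrightarrow> AE \<omega> in M. C s t \<omega> = C (min s r) (min t r) \<omega> + C (max s (min t r)) t \<omega>"
    and refl: "\<And>\<omega>. C t t \<omega> = 0"
  shows "closed_martingale (\<lambda>r \<omega>. H \<omega> * C (min s r) (min t r) \<omega>)"
  unfolding closed_martingale_def
proof (intro conjI ballI)
  fix r assume r: "r \<in> {0..T}"
  then show "integrable M (\<lambda>\<omega>. H \<omega> * C (min s r) (min t r) \<omega>)" by (intro int') auto
  fix A assume A: "A \<in> sets (F r)"
  have AM [measurable]: "A \<in> sets M" using A sets_F_le by blast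
  define a where "a = max s (min t r)"
  have rest: "integrable M (\<lambda>\<omega>. indicator A \<omega> * H \<omega> * C a t \<omega>)"
    "(\<integral>\<omega>. indicator A \<omega> * H \<omega> * C a t \<omega> \<partial>M) = 0"
  proof -
    have "a = t \<or> s \<le> a \<and> a < t \<and> r \<le> a"
      unfolding a_def using st by (cases "r < t"; cases "s \<le> r") auto
    then consider "a = t" | "s \<le> a" "a < t" "r \<le> a" by metis
    then have "integrable M (\<lambda>\<omega>. indicator A \<omega> * H \<omega> * C a t \<omega>) \<and>
      (\<integral>\<omega>. indicator A \<omega> * H \<omega> * C a t \<omega> \<partial>M) = 0"
    proof cases
      case 1
      then show ?thesis by (simp add: refl)
    next
      case 2
      have [measurable]: "H \<in> borel_measurable (F a)" using H(1) 2(1) by (rule measurable_F_mono)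
      have [measurable]: "A \<in> sets (F a)" using A sets_F_mono[OF 2(3)] by blast
      have K: "(\<lambda>\<omega>. indicator A \<omega> * H \<omega>) \<in> borel_measurable (F a)" by measurable
      have K_int: "integrable M (\<lambda>\<omega>. indicator A \<omega> * H \<omega>)"
        by (intro integrable_indicator_mult AM bounded_integrable H(2) measurable_F_M[OF H(1)])
      have C_int: "integrable M (C a t)" using 2 st by (intro int) auto
      from integral_mult_indep[OF K K_int C_int indep[OF 2(1,2)] gen[OF 2(1,2)]] mean[OF 2(1,2)]
      show ?thesis by simp
    qed
    then show "integrable M (\<lambda>\<omega>. indicator A \<omega> * H \<omega> * C a t \<omega>)"
      "(\<integral>\<omega>. indicator A \<omega> * H \<omega> * C a t \<omega> \<partial>M) = 0" by auto
  qed
  have int_r: "integrable M (\<lambda>\<omega>. indicator A \<omega> * (H \<omega> * C (min s r) (min t r) \<omega>))"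
    using r by (intro integrable_indicator_mult AM int') auto
  have int_T: "integrable M (\<lambda>\<omega>. indicator A \<omega> * (H \<omega> * C (min s T) (min t T) \<omega>))"
    using T_pos by (intro integrable_indicator_mult AM int') auto
  have r0: "0 \<le> r" using r by simp
  have sT: "min s T = s" "min t T = t" using st by auto
  have "(\<integral>\<omega>. indicator A \<omega> * (H \<omega> * C (min s T) (min t T) \<omega>) \<partial>M)
      = (\<integral>\<omega>. indicator A \<omega> * (H \<omega> * C (min s r) (min t r) \<omega>) + indicator A \<omega> * H \<omega> * C a t \<omega> \<partial>M)"
  proof (rule integral_cong_AE)
    show "AE \<omega> in M. indicator A \<omega> * (H \<omega> * C (min s T) (min t T) \<omega>)
      = indicator A \<omega> * (H \<omega> * C (min s r) (min t r) \<omega>) + indicator A \<omega> * H \<omega> * C a t \<omega>"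
      unfolding sT a_def using add[OF r0] by eventually_elim (simp add: algebra_simps)
  qed (use int_r int_T rest in auto)
  then show "(\<integral>\<omega>. indicator A \<omega> * (H \<omega> * C (min s T) (min t T) \<omega>) \<partial>M)
      = (\<integral>\<omega>. indicator A \<omega> * (H \<omega> * C (min s r) (min t r) \<omega>) \<partial>M)"
    using int_r rest by simp
qed

lemma closed_martingale_simple_W:
  assumes W: "brownian_motion M F W" and xs: "simple_W_integrand M F T xs"
  shows "closed_martingale (simple_W_integral W xs)"
  using xs
proof (induction xs)
  case Nil
  have "simple_W_integral W [] = (\<lambda>r \<omega>. 0)" by (simp add: simple_W_integral_def fun_eq_iff)
  then show ?case using closed_martingale_zero by simp
next
  case (Cons x xs)
  obtain s t H where x: "x = (s, t, H)" by (cases x) auto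
  have st: "0 \<le> s" "s \<le> t" "t \<le> T" and H: "H \<in> borel_measurable (F s)" "bounded (H ` space M)"
    using Cons.prems by (auto simp: x simple_W_integrand_def)
  let ?C = "\<lambda>a b \<omega>. W b \<omega> - W a \<omega>"
  have dist: "distributed M lborel (?C a b) (\<lambda>x. ennreal (normal_density 0 (sqrt (b - a)) x))"
    "indep_set (sets (F a)) (generated_events M {()} (\<lambda>_. ?C a b))"
    if "0 \<le> a" "a < b" for a b
    using W that by (auto simp: brownian_motion_def)
  have int: "integrable M (?C a b)" if "0 \<le> a" "a \<le> b" for a b
  proof (cases "a = b")
    case False
    then have ab: "a < b" using that by simp
    then have "integrable lborel (\<lambda>x. normal_density 0 (sqrt (b - a)) x * x)"
      by (intro integrable_normal_moment_nz_1) simp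
    then show ?thesis
      by (rule distributed_integrable_var[OF dist(1)[OF that(1) ab], rotated]) simp
  qed simp
  have gen: "?C a b -` B \<inter> space M \<in> generated_events M {()} (\<lambda>_. ?C a b)" if "B \<in> sets borel" for a b B
    unfolding generated_events_def by (rule sigma_sets.Basic) (use that in blast)
  have "closed_martingale (\<lambda>r \<omega>. H \<omega> * ?C (min s r) (min t r) \<omega>)"
  proof (rule closed_martingale_increments[where C="?C" and J="\<lambda>_. {()}" and V="\<lambda>a _. ?C a t"])
    show "integrable M (?C a b)" if "s \<le> b" "0 \<le> a" "a \<le> b" "b \<le> t" for a b
      using that by (intro int) auto
    show "integrable M (\<lambda>\<omega>. H \<omega> * ?C (min s r) (min t r) \<omega>)" if r: "0 \<le> r" "r \<le> T" for r
    proof (cases "s < min t r")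
      case True
      have H_int: "integrable M H" by (intro bounded_integrable H(2) measurable_F_M[OF H(1)])
      have sr: "min s r = s" using True by simp
      show ?thesis
        unfolding sr by (rule integral_mult_indep(1)[OF H(1) H_int int dist(2) gen]) (use st True in auto)
    next
      case False
      then have "min s r = min t r" using st by (auto simp: min_def)
      then show ?thesis by simp
    qed
    show "(\<integral>\<omega>. ?C a t \<omega> \<partial>M) = 0" if "s \<le> a" "a < t" for a
      using that st by (intro normal_distributed_expectation[OF _ dist(1)]) auto
    show "indep_set (sets (F a)) (generated_events M {()} (\<lambda>_. ?C a t))" if "s \<le> a" "a < t" for a
      using that st by (intro dist) auto
    show "AE \<omega> in M. ?C s t \<omega> = ?C (min s r) (min t r) \<omega> + ?C (max s (min t r)) t \<omega>" if "0 \<le> r" for r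
      using st by (auto simp: max_def min_def)
  qed (use st H gen in auto)
  moreover have "closed_martingale (simple_W_integral W xs)"
    using Cons by (auto simp: simple_W_integrand_def)
  ultimately have "closed_martingale (\<lambda>r \<omega>. H \<omega> * ?C (min s r) (min t r) \<omega> + simple_W_integral W xs r \<omega>)"
    by (rule closed_martingale_add)
  moreover have "simple_W_integral W (x # xs) =
      (\<lambda>r \<omega>. H \<omega> * ?C (min s r) (min t r) \<omega> + simple_W_integral W xs r \<omega>)"
    by (simp add: simple_W_integral_def x fun_eq_iff)
  ultimately show ?case by simp
qed

lemma closed_martingale_W_integral:
  assumes W: "brownian_motion M F W" and I: "is_W_integral M F T W Z I"
  shows "closed_martingale I"
proof -
  obtain xs where "\<And>n. simple_W_integrand M F T (xs n)"
    and "\<And>t. t \<in> {0..T} \<Longrightarrow> (\<lambda>n. \<integral>\<^sup>+\<omega>. ennreal ((I t \<omega> - simple_W_integral W (xs n) t \<omega>)\<^sup>2) \<partial>M) \<longlonglongrightarrow> 0"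
    using I unfolding is_W_integral_def by blast
  moreover have "adapted_process F T I" using I by (simp add: is_W_integral_def)
  ultimately show ?thesis
    using closed_martingale_L2_limit[of "\<lambda>n. simple_W_integral W (xs n)"] closed_martingale_simple_W[OF W]
    by blast
qed

end

text \<open>The Poisson weights sum to 1, so \<open>X\<close> is almost surely one of the natural numbers and in
  particular finite.\<close>

lemma (in prob_space) poisson_mean:
  fixes X :: "'a \<Rightarrow> ennreal"
  assumes [measurable]: "X \<in> borel_measurable M" and r: "0 \<le> r"
    and dist: "\<And>k::nat. measure M {\<omega> \<in> space M. X \<omega> = of_nat k} = exp (- r) * r ^ k / fact k"
  shows "AE \<omega> in M. X \<omega> < \<infinity>" "integrable M (\<lambda>\<omega>. enn2real (X \<omega>))" "(\<integral>\<omega>. enn2real (X \<omega>) \<partial>M) = r"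
proof -
  define p where "p k = exp (- r) * r ^ k / fact k" for k
  define E where "E k = {\<omega> \<in> space M. X \<omega> = of_nat k}" for k :: nat
  have [measurable]: "E k \<in> sets M" for k by (simp add: E_def)
  have pE: "emeasure M (E k) = ennreal (p k)" for k
    using dist[of k] by (simp add: emeasure_eq_measure E_def p_def)
  have p_nonneg: "0 \<le> p k" for k using r by (simp add: p_def)
  have p_sums: "p sums 1"
  proof -
    have "(\<lambda>k. exp (- r) * (r ^ k /\<^sub>R fact k)) sums (exp (- r) * exp r)"
      by (intro sums_mult exp_converges)
    then show ?thesis by (simp add: p_def[abs_def] divide_inverse mult_ac flip: exp_add)
  qed
  have kp_sums: "(\<lambda>k. real k * p k) sums r"
  proof -
    have "real (Suc k) * p (Suc k) = r * p k" for k by (simp add: p_def field_simps del: of_nat_Suc)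
    then have "(\<lambda>k. real (Suc k) * p (Suc k)) sums (r * 1)"
      using sums_mult[OF p_sums, of r] by simp
    then show ?thesis by (subst (asm) sums_Suc_iff) simp
  qed
  have disj: "disjoint_family E"
    by (auto simp: disjoint_family_on_def E_def)
  have "(\<lambda>k. measure M (E k)) sums measure M (\<Union>k. E k)"
    using disj by (intro finite_measure_UNION) auto
  moreover have "measure M (E k) = p k" for k by (simp add: E_def p_def dist)
  ultimately have "measure M (\<Union>k. E k) = 1" using p_sums sums_unique2 by auto
  then have ae: "AE \<omega> in M. \<omega> \<in> (\<Union>k. E k)" by (subst (asm) prob_eq_1) auto
  then show fin: "AE \<omega> in M. X \<omega> < \<infinity>"
    by eventually_elim (auto simp: E_def ennreal_of_nat_eq_real_of_nat)
  have "(\<integral>\<^sup>+\<omega>. X \<omega> \<partial>M) = (\<integral>\<^sup>+\<omega>. (\<Sum>k. of_nat k * indicator (E k) \<omega>) \<partial>M)"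
  proof (rule nn_integral_cong_AE)
    show "AE \<omega> in M. X \<omega> = (\<Sum>k. of_nat k * indicator (E k) \<omega>)"
      using ae
    proof eventually_elim
      case (elim \<omega>)
      then obtain j where j: "\<omega> \<in> E j" by auto
      then have "(of_nat k * indicator (E k) \<omega> :: ennreal) = (if k = j then of_nat k else 0)" for k
        using disj by (auto simp: disjoint_family_on_def indicator_def)
      then show ?case
        using j sums_unique[OF sums_single[of j "of_nat :: nat \<Rightarrow> ennreal"]] by (simp add: E_def)
    qed
  qed
  also have "\<dots> = (\<Sum>k. of_nat k * emeasure M (E k))"
    by (subst nn_integral_suminf) (auto simp: nn_integral_cmult)
  also have "\<dots> = (\<Sum>k. ennreal (real k * p k))"
    by (simp add: pE ennreal_mult p_nonneg ennreal_of_nat_eq_real_of_nat)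
  also have "\<dots> = ennreal r"
    using kp_sums r by (subst suminf_ennreal2) (auto simp: p_nonneg sums_iff)
  finally have "(\<integral>\<^sup>+\<omega>. X \<omega> \<partial>M) = ennreal r" .
  moreover have "(\<integral>\<^sup>+\<omega>. ennreal (enn2real (X \<omega>)) \<partial>M) = (\<integral>\<^sup>+\<omega>. X \<omega> \<partial>M)"
    by (rule nn_integral_cong_AE) (use fin in \<open>eventually_elim, simp\<close>)
  ultimately have nn: "(\<integral>\<^sup>+\<omega>. ennreal (enn2real (X \<omega>)) \<partial>M) = ennreal r" by simp
  show "integrable M (\<lambda>\<omega>. enn2real (X \<omega>))"
    by (rule integrableI_nonneg) (use nn in auto)
  show "(\<integral>\<omega>. enn2real (X \<omega>) \<partial>M) = r"
    using nn r by (intro integral_eq_nn_integral[THEN trans]) auto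
qed

context usual_conditions
begin

lemma closed_martingale_simple_N:
  assumes \<mu>: "sigma_finite_measure \<mu>" and N: "poisson_random_measure M F \<mu> N"
    and xs: "simple_N_integrand M F T \<mu> xs"
  shows "closed_martingale (simple_N_integral \<mu> N xs)"
  using xs
proof (induction xs)
  case Nil
  have "simple_N_integral \<mu> N [] = (\<lambda>r \<omega>. 0)" by (simp add: simple_N_integral_def fun_eq_iff)
  then show ?case using closed_martingale_zero by simp
next
  case (Cons x xs)
  interpret \<mu>: sigma_finite_measure \<mu> by (rule \<mu>)
  obtain s t B H where x: "x = (s, t, B, H)" by (cases x) auto
  have st: "0 \<le> s" "s \<le> t" "t \<le> T" and H: "H \<in> borel_measurable (F s)" "bounded (H ` space M)"
    and B [measurable]: "B \<in> sets \<mu>" and B_fin: "emeasure \<mu> B < \<infinity>"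
    using Cons.prems by (auto simp: x simple_N_integrand_def)
  let ?\<nu> = "time_mark_space \<mu>"
  let ?R = "\<lambda>a b. {a<..b} \<times> B"
  let ?C = "\<lambda>a b \<omega>. compensated \<mu> N \<omega> (?R a b)"
  have R_sets: "?R a b \<in> sets ?\<nu>" and R_fin: "emeasure ?\<nu> (?R a b) < \<infinity>" if "0 \<le> a" for a b
  proof -
    have I: "{a<..b} \<in> sets (restrict_space lborel {0..})"
      using that by (subst sets_restrict_space_iff) auto
    then show "?R a b \<in> sets ?\<nu>"
      unfolding time_mark_space_def using B by (rule pair_measureI)
    have "emeasure (restrict_space lborel {0..}) {a<..b} = emeasure lborel {a<..b}"
      using that by (subst emeasure_restrict_space) auto
    then have "emeasure (restrict_space lborel {0..}) {a<..b} < \<infinity>"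
      by (cases "a \<le> b") auto
    then show "emeasure ?\<nu> (?R a b) < \<infinity>"
      unfolding time_mark_space_def using I B_fin
      by (subst \<mu>.emeasure_pair_measure_Times) (auto simp: ennreal_mult_less_top)
  qed
  have N_meas [measurable]: "(\<lambda>\<omega>. emeasure (N \<omega>) (?R a b)) \<in> borel_measurable M" if "0 \<le> a" for a b
    using N R_sets[OF that] by (auto simp: poisson_random_measure_def)
  have N_sets: "sets (N \<omega>) = sets ?\<nu>" if "\<omega> \<in> space M" for \<omega>
    using N that by (auto simp: poisson_random_measure_def)
  have pois: "AE \<omega> in M. emeasure (N \<omega>) (?R a b) < \<infinity>"
    "integrable M (\<lambda>\<omega>. enn2real (emeasure (N \<omega>) (?R a b)))"
    "(\<integral>\<omega>. enn2real (emeasure (N \<omega>) (?R a b)) \<partial>M) = measure ?\<nu> (?R a b)" if a: "0 \<le> a" for a b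
  proof -
    have "\<And>k::nat. measure M {\<omega> \<in> space M. emeasure (N \<omega>) (?R a b) = of_nat k} =
        exp (- measure ?\<nu> (?R a b)) * measure ?\<nu> (?R a b) ^ k / fact k"
      using N R_sets[OF a] R_fin[OF a] by (auto simp: poisson_random_measure_def)
    note mean = poisson_mean[OF N_meas[OF a] measure_nonneg this]
    show "AE \<omega> in M. emeasure (N \<omega>) (?R a b) < \<infinity>"
      "integrable M (\<lambda>\<omega>. enn2real (emeasure (N \<omega>) (?R a b)))"
      "(\<integral>\<omega>. enn2real (emeasure (N \<omega>) (?R a b)) \<partial>M) = measure ?\<nu> (?R a b)"
      by (rule mean)+
  qed
  have C_eq: "?C a b = (\<lambda>\<omega>. enn2real (emeasure (N \<omega>) (?R a b)) - measure ?\<nu> (?R a b))" for a b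
    by (simp add: compensated_def measure_def fun_eq_iff)
  have C_int: "integrable M (?C a b)" if "0 \<le> a" for a b
    unfolding C_eq using pois(2)[OF that] by simp
  have C_mean: "(\<integral>\<omega>. ?C a b \<omega> \<partial>M) = 0" if "0 \<le> a" for a b
    unfolding C_eq using pois(2,3)[OF that] by (simp add: prob_space)
  have indep: "indep_set (sets (F a)) (generated_events M {B \<in> sets ?\<nu>. B \<subseteq> {a<..} \<times> space \<mu>}
      (\<lambda>B \<omega>. emeasure (N \<omega>) B))" if "0 \<le> a" for a
    using N that by (auto simp: poisson_random_measure_def)
  have gen: "?C a b -` D \<inter> space M \<in> generated_events M {B \<in> sets ?\<nu>. B \<subseteq> {a<..} \<times> space \<mu>}
      (\<lambda>B \<omega>. emeasure (N \<omega>) B)" if "0 \<le> a" "D \<in> sets borel" for a b D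
  proof -
    let ?D = "(\<lambda>y. enn2real y - measure ?\<nu> (?R a b)) -` D \<inter> space borel"
    have "?D \<in> sets borel" using that(2) by (intro measurable_sets[OF _ that(2)]) measurable
    moreover have "?C a b -` D \<inter> space M = (\<lambda>\<omega>. emeasure (N \<omega>) (?R a b)) -` ?D \<inter> space M"
      unfolding C_eq by auto
    moreover have "?R a b \<in> {B \<in> sets ?\<nu>. B \<subseteq> {a<..} \<times> space \<mu>}"
      using R_sets[OF that(1)] sets.sets_into_space[OF B] by auto
    ultimately show ?thesis
      unfolding generated_events_def by (intro sigma_sets.Basic) blast
  qed
  have "closed_martingale (\<lambda>r \<omega>. H \<omega> * ?C (min s r) (min t r) \<omega>)"
  proof (rule closed_martingale_increments[where C="?C" and V="\<lambda>_ B \<omega>. emeasure (N \<omega>) B" and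
        J="\<lambda>a. {B \<in> sets ?\<nu>. B \<subseteq> {a<..} \<times> space \<mu>}"])
    show "integrable M (\<lambda>\<omega>. H \<omega> * ?C (min s r) (min t r) \<omega>)" if r: "0 \<le> r" "r \<le> T" for r
    proof (cases "s < min t r")
      case True
      then have "min s r = s" by simp
      moreover have H_int: "integrable M H" by (intro bounded_integrable H(2) measurable_F_M[OF H(1)])
      moreover have "integrable M (\<lambda>\<omega>. H \<omega> * ?C s (min t r) \<omega>)"
        by (rule integral_mult_indep(1)[OF H(1) H_int C_int indep gen]) (use st in auto)
      ultimately show ?thesis by simp
    next
      case False
      then have "min s r = min t r" using st by (auto simp: min_def)
      then show ?thesis by (simp add: compensated_def)
    qed
    show "AE \<omega> in M. ?C s t \<omega> = ?C (min s r) (min t r) \<omega> + ?C (max s (min t r)) t \<omega>" if r: "0 \<le> r" for r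
      using pois(1)[OF st(1), of t] AE_space
    proof eventually_elim
      case (elim \<omega>)
      let ?a = "max s (min t r)"
      have R: "?R s t = ?R (min s r) (min t r) \<union> ?R ?a t" "?R (min s r) (min t r) \<inter> ?R ?a t = {}"
        using st by (auto simp: max_def min_def split: if_splits)
      have sets: "?R (min s r) (min t r) \<in> sets ?\<nu>" "?R ?a t \<in> sets ?\<nu>"
        using st r by (auto intro!: R_sets)
      have add: "measure m (?R s t) = measure m (?R (min s r) (min t r)) + measure m (?R ?a t)"
        if m: "sets m = sets ?\<nu>" and fin: "emeasure m (?R s t) < \<infinity>" for m
      proof -
        have sub: "?R (min s r) (min t r) \<subseteq> ?R s t" "?R ?a t \<subseteq> ?R s t" using R(1) by blast+
        have "?R s t \<in> sets m" using R_sets[OF st(1)] m by simp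
        then have "emeasure m (?R (min s r) (min t r)) \<noteq> \<infinity>" "emeasure m (?R ?a t) \<noteq> \<infinity>"
          using emeasure_mono[OF sub(1), of m] emeasure_mono[OF sub(2), of m] fin by auto
        then show ?thesis
          using m sets R(2) by (subst R(1)) (intro measure_Union, auto)
      qed
      have "measure (N \<omega>) (?R s t) = measure (N \<omega>) (?R (min s r) (min t r)) + measure (N \<omega>) (?R ?a t)"
        by (rule add) (use elim N_sets in auto)
      moreover have "measure ?\<nu> (?R s t) = measure ?\<nu> (?R (min s r) (min t r)) + measure ?\<nu> (?R ?a t)"
        by (rule add) (use R_fin[OF st(1)] in auto)
      ultimately show ?case by (simp add: compensated_def)
    qed
    show "?C t t \<omega> = 0" for \<omega> by (simp add: compensated_def)
  qed (use st H C_int C_mean indep gen in auto)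
  moreover have "closed_martingale (simple_N_integral \<mu> N xs)"
    using Cons by (auto simp: simple_N_integrand_def)
  ultimately have "closed_martingale (\<lambda>r \<omega>. H \<omega> * ?C (min s r) (min t r) \<omega> + simple_N_integral \<mu> N xs r \<omega>)"
    by (rule closed_martingale_add)
  moreover have "simple_N_integral \<mu> N (x # xs) =
      (\<lambda>r \<omega>. H \<omega> * ?C (min s r) (min t r) \<omega> + simple_N_integral \<mu> N xs r \<omega>)"
    by (simp add: simple_N_integral_def x fun_eq_iff)
  ultimately show ?case by simp
qed

lemma closed_martingale_N_integral:
  assumes \<mu>: "sigma_finite_measure \<mu>" and N: "poisson_random_measure M F \<mu> N"
    and J: "is_N_integral M F T \<mu> N l J"
  shows "closed_martingale J"
proof -
  obtain xs where "\<And>n. simple_N_integrand M F T \<mu> (xs n)"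
    and "\<And>t. t \<in> {0..T} \<Longrightarrow> (\<lambda>n. \<integral>\<^sup>+\<omega>. ennreal ((J t \<omega> - simple_N_integral \<mu> N (xs n) t \<omega>)\<^sup>2) \<partial>M) \<longlonglongrightarrow> 0"
    using J unfolding is_N_integral_def by blast
  moreover have "adapted_process F T J" using J by (simp add: is_N_integral_def)
  ultimately show ?thesis
    using closed_martingale_L2_limit[of "\<lambda>n. simple_N_integral \<mu> N (xs n)"] closed_martingale_simple_N[OF \<mu> N]
    by blast
qed

end


section \<open>Square-integrable right-continuous processes\<close>

lemma abs_le_one_plus_square: "\<bar>x\<bar> \<le> 1 + (x::real)\<^sup>2"
proof (cases "\<bar>x\<bar> \<le> 1")
  case False
  then have "\<bar>x\<bar> * 1 \<le> \<bar>x\<bar> * \<bar>x\<bar>" by (intro mult_left_mono) auto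
  then show ?thesis by (simp add: power2_eq_square)
qed (use zero_le_power2[of x] in linarith)

context usual_conditions
begin

lemma path_sup_measurable:
  assumes X: "\<And>t. t \<in> {0..T} \<Longrightarrow> X t \<in> borel_measurable M" "rcll_process M T X"
  shows "(\<lambda>\<omega>. path_sup T (\<lambda>t. X t \<omega>)) \<in> borel_measurable M"
proof -
  have "(\<lambda>\<omega>. SUP t\<in>dense_times T. \<bar>X t \<omega>\<bar>) \<in> borel_measurable M"
  proof (rule borel_measurable_cSUP[OF countable_dense_times])
    show "(\<lambda>\<omega>. \<bar>X t \<omega>\<bar>) \<in> borel_measurable M" if "t \<in> dense_times T" for t
      using that dense_times_subset[of T] T_pos by (intro borel_measurable_abs X) auto
    show "bdd_above ((\<lambda>t. \<bar>X t \<omega>\<bar>) ` dense_times T)" if "\<omega> \<in> space M" for \<omega>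
      using X(2) that T_pos dense_times_subset[of T]
      by (intro bdd_above_mono[OF rcll_bdd_above[of T "\<lambda>t. X t \<omega>"]]) (auto simp: rcll_process_def)
  qed
  then show ?thesis
    by (rule measurable_cong[THEN iffD1, rotated])
       (use X(2) T_pos in \<open>auto simp: rcll_process_def intro!: path_sup_dense_times[symmetric]\<close>)
qed

lemma adapted_measurable_M: "adapted_process F T X \<Longrightarrow> t \<in> {0..T} \<Longrightarrow> X t \<in> borel_measurable M"
  by (auto simp: adapted_process_def intro: measurable_F_M)

definition square_rcll :: "(real \<Rightarrow> 'a \<Rightarrow> real) \<Rightarrow> bool" where
  "square_rcll X \<longleftrightarrow> adapted_process F T X \<and> rcll_process M T X \<and>
     integrable M (\<lambda>\<omega>. (path_sup T (\<lambda>t. X t \<omega>))\<^sup>2)"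

lemma square_rcllD:
  assumes "square_rcll X"
  shows "adapted_process F T X" "rcll_process M T X" "integrable M (\<lambda>\<omega>. (path_sup T (\<lambda>t. X t \<omega>))\<^sup>2)"
    "integrable M (\<lambda>\<omega>. path_sup T (\<lambda>t. X t \<omega>))"
    "(\<lambda>\<omega>. path_sup T (\<lambda>t. X t \<omega>)) \<in> borel_measurable M"
    "\<omega> \<in> space M \<Longrightarrow> t \<in> {0..T} \<Longrightarrow> \<bar>X t \<omega>\<bar> \<le> path_sup T (\<lambda>t. X t \<omega>)"
    "\<omega> \<in> space M \<Longrightarrow> 0 \<le> path_sup T (\<lambda>t. X t \<omega>)"
proof -
  show X: "adapted_process F T X" "rcll_process M T X"
    and sq: "integrable M (\<lambda>\<omega>. (path_sup T (\<lambda>t. X t \<omega>))\<^sup>2)"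
    using assms by (auto simp: square_rcll_def)
  show meas: "(\<lambda>\<omega>. path_sup T (\<lambda>t. X t \<omega>)) \<in> borel_measurable M"
    using X by (intro path_sup_measurable adapted_measurable_M) auto
  show "integrable M (\<lambda>\<omega>. path_sup T (\<lambda>t. X t \<omega>))"
    by (rule square_integrable_imp_integrable[OF meas sq])
  show "\<omega> \<in> space M \<Longrightarrow> t \<in> {0..T} \<Longrightarrow> \<bar>X t \<omega>\<bar> \<le> path_sup T (\<lambda>t. X t \<omega>)"
    using X(2) path_sup_upper[of T "\<lambda>t. X t \<omega>" t] by (auto simp: rcll_process_def)
  show "\<omega> \<in> space M \<Longrightarrow> 0 \<le> path_sup T (\<lambda>t. X t \<omega>)"
    using X(2) T_pos path_sup_nonneg[of T "\<lambda>t. X t \<omega>"] by (auto simp: rcll_process_def)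
qed

lemma square_rcll_AE_bound:
  "square_rcll X \<Longrightarrow> AE \<omega> in M. \<forall>t\<in>{0..T}. \<bar>X t \<omega>\<bar> \<le> path_sup T (\<lambda>t. X t \<omega>)"
  using square_rcllD(6)[of X] by (intro AE_I2) blast

lemma square_rcll_stopped:
  assumes "square_rcll X" "bounded_time S"
  shows "integrable M (\<lambda>\<omega>. X (S \<omega>) \<omega>)"
  by (rule stopped_integrable[OF square_rcllD(1,2)[OF assms(1)] assms(2) square_rcllD(4)[OF assms(1)]
        square_rcll_AE_bound[OF assms(1)]])

lemma square_rcllI:
  assumes X: "adapted_process F T X" "rcll_process M T X" and fin: "sup_norm_sq M T X < \<infinity>"
  shows "square_rcll X"
proof -
  have [measurable]: "(\<lambda>\<omega>. path_sup T (\<lambda>t. X t \<omega>)) \<in> borel_measurable M"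
    using X by (intro path_sup_measurable adapted_measurable_M) auto
  have "(\<integral>\<^sup>+\<omega>. ennreal ((path_sup T (\<lambda>t. X t \<omega>))\<^sup>2) \<partial>M) = sup_norm_sq M T X"
    unfolding sup_norm_sq_def
    using X(2) T_pos by (intro nn_integral_cong path_sup_square) (auto simp: rcll_process_def)
  then have "integrable M (\<lambda>\<omega>. (path_sup T (\<lambda>t. X t \<omega>))\<^sup>2)"
    using fin by (intro integrableI_nonneg) auto
  then show ?thesis using X by (simp add: square_rcll_def)
qed

lemma square_rcll_diff:
  assumes X: "square_rcll X" and Y: "square_rcll Y"
  shows "square_rcll (\<lambda>t \<omega>. X t \<omega> - Y t \<omega>)"
proof -
  note X = square_rcllD[OF X] and Y = square_rcllD[OF Y]
  have ad: "adapted_process F T (\<lambda>t \<omega>. X t \<omega> - Y t \<omega>)"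
    using X(1) Y(1) by (auto simp: adapted_process_def intro: borel_measurable_diff)
  have rc: "rcll_process M T (\<lambda>t \<omega>. X t \<omega> - Y t \<omega>)"
    using X(2) Y(2) by (auto simp: rcll_process_def intro: rcll_on_diff)
  let ?p = "\<lambda>\<omega>. path_sup T (\<lambda>t. X t \<omega> - Y t \<omega>)"
  have meas [measurable]: "?p \<in> borel_measurable M"
    using ad rc by (intro path_sup_measurable adapted_measurable_M) auto
  have "integrable M (\<lambda>\<omega>. (?p \<omega>)\<^sup>2)"
  proof (rule Bochner_Integration.integrable_bound)
    show "integrable M (\<lambda>\<omega>. 2 * (path_sup T (\<lambda>t. X t \<omega>))\<^sup>2 + 2 * (path_sup T (\<lambda>t. Y t \<omega>))\<^sup>2)"
      using X(3) Y(3) by simp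
    show "AE \<omega> in M. norm ((?p \<omega>)\<^sup>2)
        \<le> norm (2 * (path_sup T (\<lambda>t. X t \<omega>))\<^sup>2 + 2 * (path_sup T (\<lambda>t. Y t \<omega>))\<^sup>2)"
    proof (rule AE_I2)
      fix \<omega> assume \<omega>: "\<omega> \<in> space M"
      let ?a = "path_sup T (\<lambda>t. X t \<omega>)" and ?b = "path_sup T (\<lambda>t. Y t \<omega>)"
      have "?p \<omega> \<le> ?a + ?b"
      proof (rule path_sup_least)
        fix t assume t: "t \<in> {0..T}"
        show "\<bar>X t \<omega> - Y t \<omega>\<bar> \<le> ?a + ?b" using X(6)[OF \<omega> t] Y(6)[OF \<omega> t] by linarith
      qed (use T_pos in simp)
      moreover have "0 \<le> ?p \<omega>"
        using rc \<omega> T_pos path_sup_nonneg[of T "\<lambda>t. X t \<omega> - Y t \<omega>"] by (auto simp: rcll_process_def)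
      ultimately have "(?p \<omega>)\<^sup>2 \<le> (?a + ?b)\<^sup>2" by (intro power_mono) auto
      also have "\<dots> \<le> 2 * ?a\<^sup>2 + 2 * ?b\<^sup>2" using sum_squares_bound[of ?a ?b] by (simp add: power2_sum)
      finally show "norm ((?p \<omega>)\<^sup>2) \<le> norm (2 * ?a\<^sup>2 + 2 * ?b\<^sup>2)" by simp
    qed
  qed measurable
  then show ?thesis using ad rc by (simp add: square_rcll_def)
qed

lemma optional_adapted:
  assumes "optional_process M F T X"
  shows "adapted_process F T X"
  unfolding adapted_process_def
proof
  fix t assume t: "t \<in> {0..T}"
  let ?G = "{{(t, \<omega>) \<in> {0..T} \<times> space M. X t \<omega> \<in> B} | X B.
        rcll_process M T X \<and> adapted_process F T X \<and> B \<in> sets borel}"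
  have "(\<lambda>\<omega>. (t, \<omega>)) \<in> measurable (F t) (optional_sigma M F T)"
    unfolding optional_sigma_def
  proof (rule measurable_measure_of)
    show "?G \<subseteq> Pow ({0..T} \<times> space M)" by auto
  next
    show "(\<lambda>\<omega>. (t, \<omega>)) \<in> space (F t) \<rightarrow> {0..T} \<times> space M" using t by (auto simp: space_F)
  next
    fix A assume "A \<in> ?G"
    then obtain Z B where A: "A = {(t, \<omega>) \<in> {0..T} \<times> space M. Z t \<omega> \<in> B}"
      and Z: "adapted_process F T Z" "B \<in> sets borel" by auto
    have "(\<lambda>\<omega>. (t, \<omega>)) -` A \<inter> space (F t) = Z t -` B \<inter> space (F t)"
      using t by (auto simp: A space_F)
    moreover have "Z t -` B \<inter> space (F t) \<in> sets (F t)"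
      using Z t by (intro measurable_sets[of _ _ borel]) (auto simp: adapted_process_def)
    ultimately show "(\<lambda>\<omega>. (t, \<omega>)) -` A \<inter> space (F t) \<in> sets (F t)" by simp
  qed
  from measurable_compose[OF this assms[unfolded optional_process_def]]
  show "X t \<in> borel_measurable (F t)" by simp
qed

lemma rcll_adapted_optional:
  assumes "rcll_process M T X" "adapted_process F T X"
  shows "optional_process M F T X"
  unfolding optional_process_def
proof (rule measurableI)
  let ?G = "{{(t, \<omega>) \<in> {0..T} \<times> space M. X t \<omega> \<in> B} | X B.
        rcll_process M T X \<and> adapted_process F T X \<and> B \<in> sets borel}"
  have sub: "?G \<subseteq> Pow ({0..T} \<times> space M)" by auto
  fix B :: "real set" assume "B \<in> sets borel"
  then have "{(t, \<omega>) \<in> {0..T} \<times> space M. X t \<omega> \<in> B} \<in> ?G" using assms by blast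
  then have "{(t, \<omega>) \<in> {0..T} \<times> space M. X t \<omega> \<in> B} \<in> sets (optional_sigma M F T)"
    unfolding optional_sigma_def using sub by (simp add: sets_measure_of)
  moreover have "(\<lambda>(t, \<omega>). X t \<omega>) -` B \<inter> space (optional_sigma M F T)
      = {(t, \<omega>) \<in> {0..T} \<times> space M. X t \<omega> \<in> B}"
    unfolding optional_sigma_def using sub by (auto simp: space_measure_of)
  ultimately show "(\<lambda>(t, \<omega>). X t \<omega>) -` B \<inter> space (optional_sigma M F T) \<in> sets (optional_sigma M F T)"
    by simp
qed simp

lemma predictable_adapted:
  assumes "predictable_process M F T X"
  shows "adapted_process F T X"
  unfolding adapted_process_def
proof
  fix t assume t: "t \<in> {0..T}"
  let ?G = "{{0} \<times> A | A. A \<in> sets (F 0)} \<union>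
      {{s<..t} \<times> A | s t A. 0 \<le> s \<and> s \<le> t \<and> t \<le> T \<and> A \<in> sets (F s)}"
  have in_space: "A \<subseteq> space M" if "A \<in> sets (F s)" for A s
    using sets.sets_into_space[OF that] by (simp add: space_F)
  have "(\<lambda>\<omega>. (t, \<omega>)) \<in> measurable (F t) (predictable_sigma M F T)"
    unfolding predictable_sigma_def
  proof (rule measurable_measure_of)
    show "?G \<subseteq> Pow ({0..T} \<times> space M)" using in_space T_pos by fastforce
  next
    show "(\<lambda>\<omega>. (t, \<omega>)) \<in> space (F t) \<rightarrow> {0..T} \<times> space M" using t by (auto simp: space_F)
  next
    fix C assume "C \<in> ?G"
    then consider A where "C = {0} \<times> A" "A \<in> sets (F 0)"
      | s u A where "C = {s<..u} \<times> A" "A \<in> sets (F s)" by blast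
    then show "(\<lambda>\<omega>. (t, \<omega>)) -` C \<inter> space (F t) \<in> sets (F t)"
    proof cases
      case (1 A)
      have "(\<lambda>\<omega>. (t, \<omega>)) -` C \<inter> space (F t) = (if t = 0 then A else {})"
        using in_space[OF 1(2)] by (auto simp: 1 space_F)
      then show ?thesis using 1 by auto
    next
      case (2 s u A)
      have eq: "(\<lambda>\<omega>. (t, \<omega>)) -` C \<inter> space (F t) = (if s < t \<and> t \<le> u then A else {})"
        using in_space[OF 2(2)] by (auto simp: 2 space_F)
      show ?thesis
      proof (cases "s < t \<and> t \<le> u")
        case True
        then have "A \<in> sets (F t)" using 2(2) sets_F_mono[of s t] by auto
        then show ?thesis unfolding eq using True by simp
      qed (simp only: eq if_False sets.empty_sets)
    qed
  qed
  from measurable_compose[OF this assms[unfolded predictable_process_def]]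
  show "X t \<in> borel_measurable (F t)" by simp
qed


section \<open>The integral of the driver\<close>

text \<open>
  The primitive \<open>G\<close> is set to 0 on the negligible set where the driver is not square integrable
  in time. Then all its paths are continuous, and it is adapted because the filtration is complete.
\<close>

lemma driver_integral:
  assumes prog: "progressive_process F T g" and L2: "H2_norm_sq M T g < \<infinity>"
  shows "\<exists>G R. adapted_process F T G \<and> (\<forall>\<omega>\<in>space M. continuous_on {0..T} (\<lambda>t. G t \<omega>)) \<and>
    integrable M R \<and> (AE \<omega> in M. \<forall>t\<in>{0..T}. \<bar>G t \<omega>\<bar> \<le> R \<omega>) \<and>
    (AE \<omega> in M. \<forall>s t. 0 \<le> s \<and> s \<le> t \<and> t \<le> T \<longrightarrow> (LINT u:{s..t}|lborel. g u \<omega>) = G t \<omega> - G s \<omega>)"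
proof -
  define h where "h t \<omega> u = (if u \<in> {0..t} then g u \<omega> else 0)" for t \<omega> and u :: real
  have h_meas: "(\<lambda>(\<omega>, u). h t \<omega> u) \<in> borel_measurable (F t \<Otimes>\<^sub>M lborel)" if t: "t \<in> {0..T}" for t
  proof -
    let ?P = "F t \<Otimes>\<^sub>M (lborel :: real measure)"
    have "(\<lambda>x. (snd x, fst x)) \<in> measurable (restrict_space ?P {x. snd x \<in> {0..t}})
        (restrict_space borel {0..t} \<Otimes>\<^sub>M F t)"
      by (intro measurable_Pair measurable_restrict_space2 measurable_restrict_space1)
        (auto simp: space_restrict_space)
    from measurable_compose[OF this, of "\<lambda>(s, \<omega>). g s \<omega>" borel]
    have g_meas: "(\<lambda>x. g (snd x) (fst x)) \<in> borel_measurable (restrict_space ?P {x. snd x \<in> {0..t}})"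
      using prog t by (simp add: progressive_process_def)
    have "(\<lambda>x. if snd x \<in> {0..t} then g (snd x) (fst x) else 0) \<in> borel_measurable ?P"
    proof (subst measurable_If_restrict_space_iff)
      show "{x \<in> space ?P. snd x \<in> {0..t}} \<in> sets ?P" by measurable
    qed (use g_meas in auto)
    then show ?thesis by (simp add: h_def case_prod_beta')
  qed
  have T: "T \<in> {0..T}" using T_pos by simp
  define q where "q \<omega> = (\<integral>\<^sup>+u. ennreal ((h T \<omega> u)\<^sup>2) \<partial>lborel)" for \<omega>
  have hT_meas: "(\<lambda>(\<omega>, u). h T \<omega> u) \<in> borel_measurable (M \<Otimes>\<^sub>M lborel)"
  proof -
    have "(\<lambda>x. x) \<in> measurable (M \<Otimes>\<^sub>M lborel) (F T \<Otimes>\<^sub>M lborel)"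
    proof (rule measurable_Pair[of fst _ _ snd, simplified])
      show "fst \<in> measurable (M \<Otimes>\<^sub>M lborel) (F T)"
        using sets_F_le by (intro measurable_compose[OF measurable_fst]) (auto simp: measurable_def space_F)
    qed simp
    from measurable_compose[OF this h_meas[OF T]] show ?thesis by simp
  qed
  have q_meas [measurable]: "q \<in> borel_measurable M"
    unfolding q_def
    by (rule lborel.borel_measurable_nn_integral) (use hT_meas in \<open>simp add: case_prod_beta'\<close>)
  have q_eq: "q \<omega> = (\<integral>\<^sup>+t\<in>{0..T}. ennreal ((g t \<omega>)\<^sup>2) \<partial>lborel)" for \<omega>
    unfolding q_def by (intro nn_integral_cong) (auto simp: h_def)
  have q_int: "(\<integral>\<^sup>+\<omega>. q \<omega> \<partial>M) < \<infinity>"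
    using L2 by (simp add: H2_norm_sq_def q_eq)
  have q_fin: "AE \<omega> in M. q \<omega> < \<infinity>"
    using nn_integral_noteq_infinite[of q M] q_int by (auto simp: less_top)
  have h_int: "integrable lborel (h T \<omega>) \<and> (\<integral>u. \<bar>h T \<omega> u\<bar> \<partial>lborel) \<le> T + enn2real (q \<omega>)"
    if \<omega>: "\<omega> \<in> space M" and fin: "q \<omega> < \<infinity>" for \<omega>
  proof -
    have [measurable]: "h T \<omega> \<in> borel_measurable lborel"
      using measurable_compose[OF measurable_Pair1'[OF \<omega>] hT_meas] by simp
    have sq: "integrable lborel (\<lambda>u. (h T \<omega> u)\<^sup>2)"
      using fin unfolding q_def by (intro integrableI_nonneg) auto
    have ind: "integrable lborel (indicator {0..T} :: real \<Rightarrow> real)"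
      using T_pos by (intro integrable_real_indicator) auto
    have bound: "\<bar>h T \<omega> u\<bar> \<le> indicator {0..T} u + (h T \<omega> u)\<^sup>2" for u
      using abs_le_one_plus_square[of "h T \<omega> u"] by (auto simp: h_def)
    have int: "integrable lborel (h T \<omega>)"
      by (rule Bochner_Integration.integrable_bound[OF Bochner_Integration.integrable_add[OF ind sq]])
         (use bound in \<open>auto simp: abs_of_nonneg\<close>)
    moreover have "(\<integral>u. \<bar>h T \<omega> u\<bar> \<partial>lborel) \<le> (\<integral>u. indicator {0..T} u + (h T \<omega> u)\<^sup>2 \<partial>lborel)"
      by (intro integral_mono integrable_abs Bochner_Integration.integrable_add ind sq int bound)
    moreover have "(\<integral>u. indicator {0..T} u + (h T \<omega> u)\<^sup>2 \<partial>lborel) = T + enn2real (q \<omega>)"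
      using ind sq T_pos by (simp add: q_def integral_eq_nn_integral)
    ultimately show ?thesis by simp
  qed
  have set_int: "set_integrable lborel {0..T} (\<lambda>u. g u \<omega>)" if "\<omega> \<in> space M" "q \<omega> < \<infinity>" for \<omega>
  proof -
    have "(\<lambda>u. indicator {0..T} u *\<^sub>R g u \<omega>) = h T \<omega>" by (auto simp: h_def fun_eq_iff)
    then show ?thesis using h_int[OF that] by (simp add: set_integrable_def)
  qed
  define G where "G t \<omega> = (if q \<omega> < \<infinity> then LINT u:{0..t}|lborel. g u \<omega> else 0)" for t \<omega>
  define R where "R \<omega> = T + enn2real (q \<omega>)" for \<omega>
  have LINT_eq: "(LINT u:{s..t}|lborel. g u \<omega>) = integral {s..t} (\<lambda>u. g u \<omega>)"
    if "\<omega> \<in> space M" "q \<omega> < \<infinity>" "0 \<le> s" "t \<le> T" for \<omega> s t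
    using that by (intro set_borel_integral_eq_integral set_integrable_subset[OF set_int]) auto
  have g_on: "(\<lambda>u. g u \<omega>) integrable_on {0..T}" if "\<omega> \<in> space M" "q \<omega> < \<infinity>" for \<omega>
    using set_int[OF that] by (rule set_borel_integral_eq_integral)
  have "adapted_process F T G"
    unfolding adapted_process_def
  proof
    fix t assume t: "t \<in> {0..T}"
    have "(\<lambda>\<omega>. \<integral>u. h t \<omega> u \<partial>lborel) \<in> borel_measurable (F t)"
      using h_meas[OF t] by (rule lborel.borel_measurable_lebesgue_integral)
    then show "G t \<in> borel_measurable (F t)"
    proof (rule measurable_F_cong_AE)
      show "AE \<omega> in M. (\<integral>u. h t \<omega> u \<partial>lborel) = G t \<omega>"
        using q_fin
      proof eventually_elim
        case (elim \<omega>)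
        have "(\<lambda>u. indicator {0..t} u *\<^sub>R g u \<omega>) = h t \<omega>" by (auto simp: h_def fun_eq_iff)
        then show ?case using elim by (simp add: G_def set_lebesgue_integral_def)
      qed
    qed
  qed
  moreover have "\<forall>\<omega>\<in>space M. continuous_on {0..T} (\<lambda>t. G t \<omega>)"
  proof
    fix \<omega> assume \<omega>: "\<omega> \<in> space M"
    show "continuous_on {0..T} (\<lambda>t. G t \<omega>)"
    proof (cases "q \<omega> < \<infinity>")
      case True
      have "continuous_on {0..T} (\<lambda>t. integral {0..t} (\<lambda>u. g u \<omega>))"
        by (rule indefinite_integral_continuous_1[OF g_on[OF \<omega> True]])
      then show ?thesis
        by (rule continuous_on_cong[THEN iffD1, OF refl, rotated])
           (use LINT_eq[OF \<omega> True] True in \<open>auto simp: G_def\<close>)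
    next
      case False
      then have "G t \<omega> = 0" for t by (simp add: G_def)
      then show ?thesis by simp
    qed
  qed
  moreover have "integrable M R"
  proof -
    have "integrable M (\<lambda>\<omega>. enn2real (q \<omega>))"
    proof (rule integrableI_nonneg)
      have "(\<integral>\<^sup>+\<omega>. ennreal (enn2real (q \<omega>)) \<partial>M) = (\<integral>\<^sup>+\<omega>. q \<omega> \<partial>M)"
        by (rule nn_integral_cong_AE) (use q_fin in \<open>eventually_elim, simp\<close>)
      then show "(\<integral>\<^sup>+\<omega>. ennreal (enn2real (q \<omega>)) \<partial>M) < \<infinity>" using q_int by simp
    qed auto
    then show ?thesis by (simp add: R_def[abs_def])
  qed
  moreover have "AE \<omega> in M. \<forall>t\<in>{0..T}. \<bar>G t \<omega>\<bar> \<le> R \<omega>"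
    using q_fin AE_space
  proof eventually_elim
    case (elim \<omega>)
    show ?case
    proof
      fix t assume t: "t \<in> {0..T}"
      have eq: "(\<lambda>u. indicator {0..t} u *\<^sub>R g u \<omega>) = h t \<omega>" by (auto simp: h_def fun_eq_iff)
      have "set_integrable lborel {0..t} (\<lambda>u. g u \<omega>)"
        using t elim by (intro set_integrable_subset[OF set_int]) auto
      then have int: "integrable lborel (h t \<omega>)" by (simp only: set_integrable_def eq)
      have "\<bar>G t \<omega>\<bar> = \<bar>\<integral>u. h t \<omega> u \<partial>lborel\<bar>" using elim by (simp only: G_def set_lebesgue_integral_def eq if_True)
      also have "\<dots> \<le> (\<integral>u. \<bar>h t \<omega> u\<bar> \<partial>lborel)" using integral_norm_bound[of lborel "h t \<omega>"] by simp
      also have "\<dots> \<le> (\<integral>u. \<bar>h T \<omega> u\<bar> \<partial>lborel)"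
      proof (intro integral_mono integrable_abs int)
        show "integrable lborel (h T \<omega>)" using h_int[of \<omega>] elim by simp
        show "\<bar>h t \<omega> u\<bar> \<le> \<bar>h T \<omega> u\<bar>" for u using t by (auto simp: h_def)
      qed
      also have "\<dots> \<le> R \<omega>" using h_int[of \<omega>] elim by (simp add: R_def)
      finally show "\<bar>G t \<omega>\<bar> \<le> R \<omega>" .
    qed
  qed
  moreover have "AE \<omega> in M. \<forall>s t. 0 \<le> s \<and> s \<le> t \<and> t \<le> T \<longrightarrow>
      (LINT u:{s..t}|lborel. g u \<omega>) = G t \<omega> - G s \<omega>"
    using q_fin AE_space
  proof eventually_elim
    case (elim \<omega>)
    show ?case
    proof (intro allI impI)
      fix s t assume st: "0 \<le> s \<and> s \<le> t \<and> t \<le> T"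
      have "(\<lambda>u. g u \<omega>) integrable_on {0..t}"
        using g_on[of \<omega>] elim st by (auto intro: integrable_subinterval_real)
      then have "integral {0..s} (\<lambda>u. g u \<omega>) + integral {s..t} (\<lambda>u. g u \<omega>) = integral {0..t} (\<lambda>u. g u \<omega>)"
        using st by (intro Henstock_Kurzweil_Integration.integral_combine) auto
      then show "(LINT u:{s..t}|lborel. g u \<omega>) = G t \<omega> - G s \<omega>"
        using LINT_eq[of \<omega>] elim st by (simp add: G_def)
    qed
  qed
  ultimately show ?thesis by blast
qed

end


section \<open>Doob's inequality from its weak form\<close>

text \<open>
  Integrating the weak inequality against \<open>2 c dc\<close> gives \<open>E[N\<^sup>2] \<le> 2 E[D N]\<close>, and
  \<open>2 D N \<le> 2 D\<^sup>2 + N\<^sup>2 / 2\<close>.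
\<close>

lemma (in prob_space) second_moment_from_weak_inequality:
  fixes N D :: "'a \<Rightarrow> real"
  assumes N [measurable]: "N \<in> borel_measurable M" and N2: "integrable M (\<lambda>\<omega>. (N \<omega>)\<^sup>2)"
    and N0: "\<And>\<omega>. \<omega> \<in> space M \<Longrightarrow> 0 \<le> N \<omega>"
    and D [measurable]: "D \<in> borel_measurable M" and D2: "integrable M (\<lambda>\<omega>. (D \<omega>)\<^sup>2)"
    and D0: "\<And>\<omega>. \<omega> \<in> space M \<Longrightarrow> 0 \<le> D \<omega>"
    and weak: "\<And>c. 0 < c \<Longrightarrow>
      c * prob {\<omega> \<in> space M. c < N \<omega>} \<le> (\<integral>\<omega>. indicator {\<omega> \<in> space M. c \<le> N \<omega>} \<omega> * D \<omega> \<partial>M)"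
  shows "(\<integral>\<omega>. (N \<omega>)\<^sup>2 \<partial>M) \<le> 4 * (\<integral>\<omega>. (D \<omega>)\<^sup>2 \<partial>M)"
proof -
  interpret P: pair_sigma_finite M "lborel :: real measure" ..
  have D_int: "integrable M D" by (rule square_integrable_imp_integrable[OF D D2])
  define f where "f \<omega> c = ennreal (2 * c) * (if 0 < c \<and> c < N \<omega> then 1 else 0)" for \<omega> c
  define h where "h \<omega> c = ennreal (2 * D \<omega>) * (if 0 < c \<and> c \<le> N \<omega> then 1 else 0)" for \<omega> c
  have [measurable]: "(\<lambda>(\<omega>, c). f \<omega> c) \<in> borel_measurable (M \<Otimes>\<^sub>M lborel)"
    "(\<lambda>(\<omega>, c). h \<omega> c) \<in> borel_measurable (M \<Otimes>\<^sub>M lborel)"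
    unfolding f_def h_def by measurable
  have f_c: "(\<integral>\<^sup>+c. f \<omega> c \<partial>lborel) = ennreal ((N \<omega>)\<^sup>2)" if \<omega>: "\<omega> \<in> space M" for \<omega>
  proof -
    have "(\<integral>\<^sup>+c. f \<omega> c \<partial>lborel) = (\<integral>\<^sup>+c. ennreal (2 * c) * indicator {0..N \<omega>} c \<partial>lborel)"
    proof (rule nn_integral_cong_AE)
      have "AE c in lborel. c \<noteq> 0" "AE c in lborel. c \<noteq> N \<omega>" by (rule AE_lborel_singleton)+
      then show "AE c in lborel. f \<omega> c = ennreal (2 * c) * indicator {0..N \<omega>} c"
        by eventually_elim (auto simp: f_def indicator_def)
    qed
    also have "\<dots> = ennreal ((N \<omega>)\<^sup>2 - 0\<^sup>2)"
      by (rule nn_integral_FTC_Icc) (use N0[OF \<omega>] in \<open>auto intro!: derivative_eq_intros\<close>)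
    finally show ?thesis by simp
  qed
  have h_c: "(\<integral>\<^sup>+c. h \<omega> c \<partial>lborel) = ennreal (2 * D \<omega> * N \<omega>)" if \<omega>: "\<omega> \<in> space M" for \<omega>
  proof -
    have "(\<integral>\<^sup>+c. h \<omega> c \<partial>lborel) = (\<integral>\<^sup>+c. ennreal (2 * D \<omega>) * indicator {0<..N \<omega>} c \<partial>lborel)"
      by (intro nn_integral_cong) (auto simp: h_def indicator_def)
    then show ?thesis using N0[OF \<omega>] D0[OF \<omega>] by (simp add: nn_integral_cmult_indicator ennreal_mult)
  qed
  have f_h: "(\<integral>\<^sup>+\<omega>. f \<omega> c \<partial>M) \<le> (\<integral>\<^sup>+\<omega>. h \<omega> c \<partial>M)" for c
  proof (cases "0 < c")
    case True
    have "(\<integral>\<^sup>+\<omega>. f \<omega> c \<partial>M) = (\<integral>\<^sup>+\<omega>. ennreal (2 * c) * indicator {\<omega> \<in> space M. c < N \<omega>} \<omega> \<partial>M)"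
      using True by (intro nn_integral_cong) (auto simp: f_def indicator_def)
    also have "\<dots> = ennreal (2 * (c * prob {\<omega> \<in> space M. c < N \<omega>}))"
      using True
      by (subst nn_integral_cmult_indicator) (auto simp: emeasure_eq_measure mult.assoc simp flip: ennreal_mult)
    also have "\<dots> \<le> ennreal (\<integral>\<omega>. 2 * (indicator {\<omega> \<in> space M. c \<le> N \<omega>} \<omega> * D \<omega>) \<partial>M)"
      using weak[OF True] by (intro ennreal_leI) simp
    also have "\<dots> = (\<integral>\<^sup>+\<omega>. ennreal (2 * (indicator {\<omega> \<in> space M. c \<le> N \<omega>} \<omega> * D \<omega>)) \<partial>M)"
    proof (rule nn_integral_eq_integral[symmetric])
      have "integrable M (\<lambda>\<omega>. D \<omega> * indicator {\<omega> \<in> space M. c \<le> N \<omega>} \<omega>)"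
        by (intro integrable_real_mult_indicator D_int) simp
      then show "integrable M (\<lambda>\<omega>. 2 * (indicator {\<omega> \<in> space M. c \<le> N \<omega>} \<omega> * D \<omega>))"
        by (simp add: mult.commute)
    qed (use D0 in \<open>auto simp: indicator_def\<close>)
    also have "\<dots> = (\<integral>\<^sup>+\<omega>. h \<omega> c \<partial>M)"
      using True by (intro nn_integral_cong) (auto simp: h_def indicator_def)
    finally show ?thesis .
  qed (simp add: f_def)
  have "(\<integral>\<^sup>+\<omega>. ennreal ((N \<omega>)\<^sup>2) \<partial>M) = (\<integral>\<^sup>+\<omega>. \<integral>\<^sup>+c. f \<omega> c \<partial>lborel \<partial>M)"
    by (intro nn_integral_cong) (simp add: f_c)
  also have "\<dots> = (\<integral>\<^sup>+c. \<integral>\<^sup>+\<omega>. f \<omega> c \<partial>M \<partial>lborel)"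
    using P.Fubini[of "\<lambda>(\<omega>, c). f \<omega> c"] by simp
  also have "\<dots> \<le> (\<integral>\<^sup>+c. \<integral>\<^sup>+\<omega>. h \<omega> c \<partial>M \<partial>lborel)"
    by (intro nn_integral_mono f_h)
  also have "\<dots> = (\<integral>\<^sup>+\<omega>. \<integral>\<^sup>+c. h \<omega> c \<partial>lborel \<partial>M)"
    using P.Fubini[of "\<lambda>(\<omega>, c). h \<omega> c"] by simp
  also have "\<dots> = (\<integral>\<^sup>+\<omega>. ennreal (2 * D \<omega> * N \<omega>) \<partial>M)"
    by (intro nn_integral_cong) (simp add: h_c)
  also have "\<dots> \<le> (\<integral>\<^sup>+\<omega>. ennreal (2 * (D \<omega>)\<^sup>2 + (N \<omega>)\<^sup>2 / 2) \<partial>M)"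
  proof (intro nn_integral_mono ennreal_leI)
    fix \<omega>
    have "0 \<le> (2 * D \<omega> - N \<omega>)\<^sup>2" by simp
    then show "2 * D \<omega> * N \<omega> \<le> 2 * (D \<omega>)\<^sup>2 + (N \<omega>)\<^sup>2 / 2"
      by (simp add: power2_diff power_mult_distrib)
  qed
  also have "\<dots> = ennreal (\<integral>\<omega>. 2 * (D \<omega>)\<^sup>2 + (N \<omega>)\<^sup>2 / 2 \<partial>M)"
    using N2 D2 by (intro nn_integral_eq_integral) auto
  finally have "ennreal (\<integral>\<omega>. (N \<omega>)\<^sup>2 \<partial>M) \<le> ennreal (\<integral>\<omega>. 2 * (D \<omega>)\<^sup>2 + (N \<omega>)\<^sup>2 / 2 \<partial>M)"
    using N2 by (subst (asm) nn_integral_eq_integral) auto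
  then have "(\<integral>\<omega>. (N \<omega>)\<^sup>2 \<partial>M) \<le> (\<integral>\<omega>. 2 * (D \<omega>)\<^sup>2 + (N \<omega>)\<^sup>2 / 2 \<partial>M)"
    by (subst (asm) ennreal_le_iff) auto
  also have "\<dots> = 2 * (\<integral>\<omega>. (D \<omega>)\<^sup>2 \<partial>M) + (\<integral>\<omega>. (N \<omega>)\<^sup>2 \<partial>M) / 2"
    using N2 D2 by simp
  finally show ?thesis by simp
qed


section \<open>Reflection above a right-continuous barrier\<close>

context usual_conditions
begin

lemma indicator_integral_add:
  fixes f h :: "'a \<Rightarrow> real"
  assumes "B \<in> sets M" "integrable M f" "integrable M h"
  shows "(\<integral>\<omega>. indicator B \<omega> * (f \<omega> + h \<omega>) \<partial>M)
    = (\<integral>\<omega>. indicator B \<omega> * f \<omega> \<partial>M) + (\<integral>\<omega>. indicator B \<omega> * h \<omega> \<partial>M)"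
  using integrable_indicator_mult[OF assms(1,2)] integrable_indicator_mult[OF assms(1,3)]
  by (simp add: distrib_left)

lemma indicator_integral_diff:
  fixes f h :: "'a \<Rightarrow> real"
  assumes "B \<in> sets M" "integrable M f" "integrable M h"
  shows "(\<integral>\<omega>. indicator B \<omega> * (f \<omega> - h \<omega>) \<partial>M)
    = (\<integral>\<omega>. indicator B \<omega> * f \<omega> \<partial>M) - (\<integral>\<omega>. indicator B \<omega> * h \<omega> \<partial>M)"
  using integrable_indicator_mult[OF assms(1,2)] integrable_indicator_mult[OF assms(1,3)]
  by (simp add: right_diff_distrib)

lemma indicator_integral_mono:
  fixes f h :: "'a \<Rightarrow> real"
  assumes "B \<in> sets M" "integrable M f" "integrable M h" "AE \<omega> in M. \<omega> \<in> B \<longrightarrow> f \<omega> \<le> h \<omega>"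
  shows "(\<integral>\<omega>. indicator B \<omega> * f \<omega> \<partial>M) \<le> (\<integral>\<omega>. indicator B \<omega> * h \<omega> \<partial>M)"
proof (intro integral_mono_AE integrable_indicator_mult assms(1-3))
  show "AE \<omega> in M. indicator B \<omega> * f \<omega> \<le> indicator B \<omega> * h \<omega>"
    using assms(4) by eventually_elim (auto simp: indicator_def)
qed

end

text \<open>\<open>G\<close> stands for the primitive of the driver.\<close>

locale driven = usual_conditions +
  fixes G :: "real \<Rightarrow> 'a \<Rightarrow> real" and R :: "'a \<Rightarrow> real"
  assumes G_adapted: "adapted_process F T G"
    and G_cont: "\<omega> \<in> space M \<Longrightarrow> continuous_on {0..T} (\<lambda>t. G t \<omega>)"
    and R_int: "integrable M R"
    and G_bound: "AE \<omega> in M. \<forall>t\<in>{0..T}. \<bar>G t \<omega>\<bar> \<le> R \<omega>"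

text \<open>
  What the reflected equation says, with the stochastic integrals replaced by the mere fact that
  \<open>Y + G + A\<close> is a martingale, and the flat-off condition by its consequence that \<open>A\<close> is constant
  on the intervals on which \<open>Y\<close> stays away from the barrier.
\<close>

locale reflected = driven +
  fixes \<xi> Y A :: "real \<Rightarrow> 'a \<Rightarrow> real"
  assumes Y: "square_rcll Y" and \<xi>: "square_rcll \<xi>"
    and A_adapted: "adapted_process F T A" and A_rcll: "rcll_process M T A"
    and A_zero: "\<omega> \<in> space M \<Longrightarrow> A 0 \<omega> = 0" and A_mono: "\<omega> \<in> space M \<Longrightarrow> mono_on {0..T} (\<lambda>t. A t \<omega>)"
    and A_int: "integrable M (A T)"
    and martingale: "closed_martingale (\<lambda>t \<omega>. Y t \<omega> + G t \<omega> + A t \<omega>)"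
    and above: "AE \<omega> in M. \<forall>t\<in>{0..T}. \<xi> t \<omega> \<le> Y t \<omega>"
    and terminal: "AE \<omega> in M. Y T \<omega> = \<xi> T \<omega>"
    and flat_off: "AE \<omega> in M. \<forall>s t \<delta>. 0 \<le> s \<and> s \<le> t \<and> t \<le> T \<and> 0 < \<delta> \<and>
      (\<forall>u. s \<le> u \<and> u < t \<longrightarrow> \<delta> \<le> Y u \<omega> - \<xi> u \<omega>) \<longrightarrow> A t \<omega> = A s \<omega>"

context driven
begin

lemma G_rcll: "rcll_process M T G"
  using G_cont by (auto simp: rcll_process_def intro: rcll_on_continuous)

lemma G_stopped: "bounded_time S \<Longrightarrow> integrable M (\<lambda>\<omega>. G (S \<omega>) \<omega>)"
  by (rule stopped_integrable[OF G_adapted G_rcll _ R_int G_bound])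

end

context reflected
begin

lemma A_bounds: "\<omega> \<in> space M \<Longrightarrow> t \<in> {0..T} \<Longrightarrow> 0 \<le> A t \<omega> \<and> A t \<omega> \<le> A T \<omega>"
  using mono_onD[OF A_mono, of \<omega> 0 t] mono_onD[OF A_mono, of \<omega> t T] A_zero[of \<omega>] T_pos by auto

lemma A_stopped: "bounded_time S \<Longrightarrow> integrable M (\<lambda>\<omega>. A (S \<omega>) \<omega>)"
  using A_bounds by (intro stopped_integrable[OF A_adapted A_rcll _ A_int] AE_I2) auto

lemma martingale_adapted: "adapted_process F T (\<lambda>t \<omega>. Y t \<omega> + G t \<omega> + A t \<omega>)"
  using square_rcllD(1)[OF Y] G_adapted A_adapted
  by (auto simp: adapted_process_def intro!: borel_measurable_add)

lemma martingale_rcll: "rcll_process M T (\<lambda>t \<omega>. Y t \<omega> + G t \<omega> + A t \<omega>)"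
  using square_rcllD(2)[OF Y] G_rcll A_rcll
  by (auto simp: rcll_process_def intro!: rcll_on_add)

lemma martingale_dominated:
  "integrable M (\<lambda>\<omega>. path_sup T (\<lambda>t. Y t \<omega>) + R \<omega> + A T \<omega>)"
  "AE \<omega> in M. \<forall>t\<in>{0..T}. \<bar>Y t \<omega> + G t \<omega> + A t \<omega>\<bar> \<le> path_sup T (\<lambda>t. Y t \<omega>) + R \<omega> + A T \<omega>"
proof -
  show "integrable M (\<lambda>\<omega>. path_sup T (\<lambda>t. Y t \<omega>) + R \<omega> + A T \<omega>)"
    by (intro Bochner_Integration.integrable_add square_rcllD(4)[OF Y] R_int A_int)
  show "AE \<omega> in M. \<forall>t\<in>{0..T}. \<bar>Y t \<omega> + G t \<omega> + A t \<omega>\<bar> \<le> path_sup T (\<lambda>t. Y t \<omega>) + R \<omega> + A T \<omega>"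
    using square_rcll_AE_bound[OF Y] G_bound AE_space
  proof eventually_elim
    case (elim \<omega>)
    show ?case
    proof
      fix t assume t: "t \<in> {0..T}"
      then have "\<bar>Y t \<omega>\<bar> \<le> path_sup T (\<lambda>t. Y t \<omega>)" "\<bar>G t \<omega>\<bar> \<le> R \<omega>" using elim by auto
      then show "\<bar>Y t \<omega> + G t \<omega> + A t \<omega>\<bar> \<le> path_sup T (\<lambda>t. Y t \<omega>) + R \<omega> + A T \<omega>"
        using A_bounds[OF elim(3) t] by linarith
    qed
  qed
qed

lemma Y_stopped: "bounded_time S \<Longrightarrow> integrable M (\<lambda>\<omega>. Y (S \<omega>) \<omega>)"
  by (rule square_rcll_stopped[OF Y])

lemma increment:
  assumes S: "bounded_time S" and \<tau>: "bounded_time \<tau>" and le: "\<And>\<omega>. S \<omega> \<le> \<tau> \<omega>"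
    and B: "B \<in> sets (sigma_at M F S)"
  shows "(\<integral>\<omega>. indicator B \<omega> * (Y (S \<omega>) \<omega> + G (S \<omega>) \<omega>) \<partial>M)
    = (\<integral>\<omega>. indicator B \<omega> * (Y (\<tau> \<omega>) \<omega> + G (\<tau> \<omega>) \<omega>) \<partial>M)
      + (\<integral>\<omega>. indicator B \<omega> * (A (\<tau> \<omega>) \<omega> - A (S \<omega>) \<omega>) \<partial>M)"
proof -
  have B\<tau>: "B \<in> sets (sigma_at M F \<tau>)"
    using B sigma_at_mono[OF bounded_timeD(1)[OF S] bounded_timeD(1)[OF \<tau>] le] by blast
  have BM: "B \<in> sets M"
    using B subalgebra_sigma_at[OF bounded_timeD(1)[OF S]] by (auto simp: subalgebra_def)
  note sampling = optional_sampling[OF martingale martingale_adapted martingale_rcll martingale_dominated]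
  have "(\<integral>\<omega>. indicator B \<omega> * (Y (S \<omega>) \<omega> + G (S \<omega>) \<omega> + A (S \<omega>) \<omega>) \<partial>M)
      = (\<integral>\<omega>. indicator B \<omega> * (Y (\<tau> \<omega>) \<omega> + G (\<tau> \<omega>) \<omega> + A (\<tau> \<omega>) \<omega>) \<partial>M)"
    using sampling[OF S B] sampling[OF \<tau> B\<tau>] by simp
  then show ?thesis
    using BM Y_stopped[OF S] Y_stopped[OF \<tau>] G_stopped[OF S] G_stopped[OF \<tau>] A_stopped[OF S] A_stopped[OF \<tau>]
    by (simp add: indicator_integral_add indicator_integral_diff)
qed

lemma supermartingale:
  assumes S: "bounded_time S" and \<tau>: "bounded_time \<tau>" and le: "\<And>\<omega>. S \<omega> \<le> \<tau> \<omega>"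
    and B: "B \<in> sets (sigma_at M F S)"
  shows "(\<integral>\<omega>. indicator B \<omega> * (Y (\<tau> \<omega>) \<omega> + G (\<tau> \<omega>) \<omega>) \<partial>M)
    \<le> (\<integral>\<omega>. indicator B \<omega> * (Y (S \<omega>) \<omega> + G (S \<omega>) \<omega>) \<partial>M)"
proof -
  have "0 \<le> (\<integral>\<omega>. indicator B \<omega> * (A (\<tau> \<omega>) \<omega> - A (S \<omega>) \<omega>) \<partial>M)"
  proof (rule Bochner_Integration.integral_nonneg)
    fix \<omega> assume "\<omega> \<in> space M"
    then have "A (S \<omega>) \<omega> \<le> A (\<tau> \<omega>) \<omega>"
      using mono_onD[OF A_mono] bounded_timeD(4)[OF S] bounded_timeD(4)[OF \<tau>] le by blast
    then show "0 \<le> indicator B \<omega> * (A (\<tau> \<omega>) \<omega> - A (S \<omega>) \<omega>)" by simp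
  qed
  then show ?thesis using increment[OF assms] by simp
qed

text \<open>
  Until \<open>Y\<close> comes within \<open>\<epsilon>\<close> of the barrier, \<open>A\<close> does not increase, so \<open>Y + G\<close> is a martingale
  up to that time. It occurs at the latest at \<open>T\<close>, where \<open>Y\<close> is on the barrier.
\<close>

lemma almost_optimal_time:
  assumes S: "bounded_time S" and \<epsilon>: "0 < \<epsilon>"
  shows "\<exists>\<tau>. bounded_time \<tau> \<and> (\<forall>\<omega>. S \<omega> \<le> \<tau> \<omega>) \<and> (AE \<omega> in M. Y (\<tau> \<omega>) \<omega> \<le> \<xi> (\<tau> \<omega>) \<omega> + \<epsilon>) \<and>
    (\<forall>B\<in>sets (sigma_at M F S). (\<integral>\<omega>. indicator B \<omega> * (Y (S \<omega>) \<omega> + G (S \<omega>) \<omega>) \<partial>M)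
      = (\<integral>\<omega>. indicator B \<omega> * (Y (\<tau> \<omega>) \<omega> + G (\<tau> \<omega>) \<omega>) \<partial>M))"
proof -
  define V where "V t \<omega> = Y t \<omega> - \<xi> t \<omega>" for t \<omega>
  have V: "square_rcll V" unfolding V_def by (rule square_rcll_diff[OF Y \<xi>])
  define \<tau> where "\<tau> = hitting V \<epsilon> S"
  have \<tau>: "bounded_time \<tau>"
    unfolding \<tau>_def using square_rcllD(1,2)[OF V] S by (rule bounded_time_hitting)
  have le: "S \<omega> \<le> \<tau> \<omega>" for \<omega> unfolding \<tau>_def by (rule hitting_ge[OF S])
  have "AE \<omega> in M. Y (\<tau> \<omega>) \<omega> \<le> \<xi> (\<tau> \<omega>) \<omega> + \<epsilon>"
    using terminal AE_space
  proof eventually_elim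
    case (elim \<omega>)
    have "V T \<omega> < \<epsilon>" using elim \<epsilon> by (simp add: V_def)
    then have "V (\<tau> \<omega>) \<omega> \<le> \<epsilon>"
      unfolding \<tau>_def using bounded_timeD(3)[OF S, of \<omega>] by (intro at_hitting square_rcllD(2)[OF V] elim(2) S) auto
    then show ?case by (simp add: V_def)
  qed
  moreover have A_eq: "AE \<omega> in M. A (\<tau> \<omega>) \<omega> = A (S \<omega>) \<omega>"
    using flat_off
  proof eventually_elim
    case (elim \<omega>)
    have "\<epsilon> \<le> Y u \<omega> - \<xi> u \<omega>" if "S \<omega> \<le> u" "u < \<tau> \<omega>" for u
      using before_hitting[of S \<omega> u V \<epsilon>] that by (simp add: \<tau>_def V_def)
    then show ?case
      using elim[rule_format, of "S \<omega>" "\<tau> \<omega>" \<epsilon>] \<epsilon> le bounded_timeD(2)[OF S] bounded_timeD(3)[OF \<tau>] by blast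
  qed
  moreover have "(\<integral>\<omega>. indicator B \<omega> * (Y (S \<omega>) \<omega> + G (S \<omega>) \<omega>) \<partial>M)
      = (\<integral>\<omega>. indicator B \<omega> * (Y (\<tau> \<omega>) \<omega> + G (\<tau> \<omega>) \<omega>) \<partial>M)"
    if B: "B \<in> sets (sigma_at M F S)" for B
  proof -
    have "AE \<omega> in M. indicator B \<omega> * (A (\<tau> \<omega>) \<omega> - A (S \<omega>) \<omega>) = 0"
      using A_eq by eventually_elim simp
    then have "(\<integral>\<omega>. indicator B \<omega> * (A (\<tau> \<omega>) \<omega> - A (S \<omega>) \<omega>) \<partial>M) = 0"
      by (rule integral_eq_zero_AE)
    then show ?thesis using increment[OF S \<tau> le B] by simp
  qed
  ultimately show ?thesis using \<tau> le by (intro exI[of _ \<tau>]) simp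
qed

text \<open>
  At a predictable time the martingale does not jump, so \<open>Y\<close> can only jump downwards, by the jump of
  \<open>A\<close>; and \<open>A\<close> does not jump if the left limit of \<open>Y\<close> is strictly above that of the barrier.
\<close>

lemma left_limit_at_predictable_time:
  assumes qlc: "quasi_left_continuous M F" and \<tau>: "\<tau> \<in> predictable_times0 M F T"
  shows "AE \<omega> in M. 0 < \<tau> \<omega> \<longrightarrow> Lim (at_left (\<tau> \<omega>)) (\<lambda>t. Y t \<omega>)
    = max (Lim (at_left (\<tau> \<omega>)) (\<lambda>t. \<xi> t \<omega>)) (Y (\<tau> \<omega>) \<omega>)"
proof -
  have bounds: "AE \<omega> in M. \<tau> \<omega> \<le> T"
    using \<tau> by (auto simp: predictable_times0_def stopping_times_def elim: eventually_mono)
  show ?thesis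
    using martingale_no_predictable_jump[OF qlc martingale martingale_adapted martingale_rcll
        martingale_dominated \<tau>] bounds above flat_off AE_space
  proof eventually_elim
    case (elim \<omega>)
    show ?case
    proof
      assume pos: "0 < \<tau> \<omega>"
      note flat = elim(4)
      define t where "t = \<tau> \<omega>"
      have t: "0 < t" "t \<le> T" using pos elim by (auto simp: t_def)
      define y x a where "y = Lim (at_left t) (\<lambda>t. Y t \<omega>)" and "x = Lim (at_left t) (\<lambda>t. \<xi> t \<omega>)"
        and "a = Lim (at_left t) (\<lambda>t. A t \<omega>)"
      have y: "((\<lambda>t. Y t \<omega>) \<longlongrightarrow> y) (at_left t)" and x: "((\<lambda>t. \<xi> t \<omega>) \<longlongrightarrow> x) (at_left t)"
        and a: "((\<lambda>t. A t \<omega>) \<longlongrightarrow> a) (at_left t)"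
        unfolding y_def x_def a_def
        using square_rcllD(2)[OF Y] square_rcllD(2)[OF \<xi>] A_rcll elim(5) t
        by (auto simp: rcll_process_def intro!: rcll_onD_left)
      have "((\<lambda>t. G t \<omega>) \<longlongrightarrow> G t \<omega>) (at t within {0..T})"
        using G_cont[OF elim(5)] t by (auto simp: continuous_on_def)
      then have "((\<lambda>t. G t \<omega>) \<longlongrightarrow> G t \<omega>) (at t within {0..t})"
        by (rule tendsto_within_subset) (use t in auto)
      then have "((\<lambda>t. G t \<omega>) \<longlongrightarrow> G t \<omega>) (at_left t)"
        using t by (simp add: at_within_Icc_at_left)
      then have "((\<lambda>t. Y t \<omega> + G t \<omega> + A t \<omega>) \<longlongrightarrow> y + G t \<omega> + a) (at_left t)"
        by (intro tendsto_add y a)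
      then have "Lim (at_left t) (\<lambda>t. Y t \<omega> + G t \<omega> + A t \<omega>) = y + G t \<omega> + a"
        by (intro tendsto_Lim) auto
      then have jump: "y - Y t \<omega> = A t \<omega> - a"
        using elim(1) pos by (simp add: t_def)
      have near: "\<forall>\<^sub>F u in at_left t. 0 < u \<and> u < t"
        using t by (auto simp: eventually_at_left_field)
      have "\<forall>\<^sub>F u in at_left t. A u \<omega> \<le> A t \<omega>"
        using near by eventually_elim (use mono_onD[OF A_mono[OF elim(5)]] t in auto)
      then have "a \<le> A t \<omega>" by (intro tendsto_upperbound[OF a]) auto
      moreover have "\<forall>\<^sub>F u in at_left t. \<xi> u \<omega> \<le> Y u \<omega>"
        using near by eventually_elim (use elim(3) t in auto)
      then have "x \<le> y" by (intro tendsto_le[OF _ y x]) auto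
      moreover have "y = Y t \<omega>" if "x < y"
      proof -
        define \<delta> where "\<delta> = (y - x) / 2"
        have \<delta>: "0 < \<delta>" "\<delta> < y - x" using that by (auto simp: \<delta>_def)
        have "\<forall>\<^sub>F u in at_left t. \<delta> < Y u \<omega> - \<xi> u \<omega>"
          by (rule order_tendstoD(1)[OF tendsto_diff[OF y x] \<delta>(2)])
        with near have "\<forall>\<^sub>F u in at_left t. 0 < u \<and> u < t \<and> \<delta> < Y u \<omega> - \<xi> u \<omega>"
          by eventually_elim auto
        then obtain b where b: "b < t" "\<And>u. b < u \<Longrightarrow> u < t \<Longrightarrow> 0 < u \<and> u < t \<and> \<delta> < Y u \<omega> - \<xi> u \<omega>"
          by (auto simp: eventually_at_left_field)
        have "\<forall>\<^sub>F u in at_left t. b < u \<and> u < t"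
          using b(1) by (auto simp: eventually_at_left_field)
        then have "\<forall>\<^sub>F u in at_left t. A u \<omega> = A t \<omega>"
        proof eventually_elim
          case (elim u)
          have "0 \<le> u \<and> u \<le> t \<and> t \<le> T \<and> 0 < \<delta> \<and> (\<forall>v. u \<le> v \<and> v < t \<longrightarrow> \<delta> \<le> Y v \<omega> - \<xi> v \<omega>)"
            using b(2)[of u] b(2) elim t \<delta>(1) by (fastforce intro: less_imp_le)
          then show ?case using flat[THEN spec, of u, THEN spec, of t, THEN spec, of \<delta>] by simp
        qed
        then have "((\<lambda>u. A u \<omega>) \<longlongrightarrow> A t \<omega>) (at_left t)" by (rule tendsto_eventually)
        then have "a = A t \<omega>" using a tendsto_unique trivial_limit_at_left_real by blast
        then show ?thesis using jump by simp
      qed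
      ultimately have "y = max x (Y t \<omega>)" using jump by (cases "x < y") auto
      then show "Lim (at_left (\<tau> \<omega>)) (\<lambda>t. Y t \<omega>)
          = max (Lim (at_left (\<tau> \<omega>)) (\<lambda>t. \<xi> t \<omega>)) (Y (\<tau> \<omega>) \<omega>)"
        by (simp add: y_def x_def t_def)
    qed
  qed
qed

end


subsection \<open>Comparison of two barriers\<close>

context driven
begin

text \<open>
  Stopping almost optimally for the first barrier is a possible choice for the second one, and
  costs at most the distance of the two barriers.
\<close>

lemma reflected_comparison:
  assumes 1: "reflected M F T G R \<xi> Y A" and 2: "reflected M F T G R \<xi>' Y' A'"
    and S: "bounded_time S" and B: "B \<in> sets (sigma_at M F S)"
  shows "(\<integral>\<omega>. indicator B \<omega> * (Y (S \<omega>) \<omega> - Y' (S \<omega>) \<omega>) \<partial>M)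
    \<le> (\<integral>\<omega>. indicator B \<omega> * path_sup T (\<lambda>t. \<xi> t \<omega> - \<xi>' t \<omega>) \<partial>M)"
proof (rule field_le_epsilon)
  fix \<epsilon> :: real assume \<epsilon>: "0 < \<epsilon>"
  interpret r: reflected M F T G R \<xi> Y A by (rule 1)
  interpret r': reflected M F T G R \<xi>' Y' A' by (rule 2)
  have D: "square_rcll (\<lambda>t \<omega>. \<xi> t \<omega> - \<xi>' t \<omega>)" by (rule square_rcll_diff[OF r.\<xi> r'.\<xi>])
  let ?D = "\<lambda>\<omega>. path_sup T (\<lambda>t. \<xi> t \<omega> - \<xi>' t \<omega>)"
  have BM: "B \<in> sets M"
    using B subalgebra_sigma_at[OF bounded_timeD(1)[OF S]] by (auto simp: subalgebra_def)
  obtain \<tau> where \<tau>: "bounded_time \<tau>" "\<And>\<omega>. S \<omega> \<le> \<tau> \<omega>" "AE \<omega> in M. Y (\<tau> \<omega>) \<omega> \<le> \<xi> (\<tau> \<omega>) \<omega> + \<epsilon>"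
    "(\<integral>\<omega>. indicator B \<omega> * (Y (S \<omega>) \<omega> + G (S \<omega>) \<omega>) \<partial>M)
      = (\<integral>\<omega>. indicator B \<omega> * (Y (\<tau> \<omega>) \<omega> + G (\<tau> \<omega>) \<omega>) \<partial>M)"
    using r.almost_optimal_time[OF S \<epsilon>] B by blast
  note [simp] = r.Y_stopped[OF S] r.Y_stopped[OF \<tau>(1)] r'.Y_stopped[OF S] r'.Y_stopped[OF \<tau>(1)]
    G_stopped[OF S] G_stopped[OF \<tau>(1)]
  have "(\<integral>\<omega>. indicator B \<omega> * (Y (S \<omega>) \<omega> - Y' (S \<omega>) \<omega>) \<partial>M)
      \<le> (\<integral>\<omega>. indicator B \<omega> * (Y (\<tau> \<omega>) \<omega> - Y' (\<tau> \<omega>) \<omega>) \<partial>M)"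
    using \<tau>(4) r'.supermartingale[OF S \<tau>(1,2) B] BM
    by (simp add: indicator_integral_add indicator_integral_diff)
  also have "\<dots> \<le> (\<integral>\<omega>. indicator B \<omega> * (?D \<omega> + \<epsilon>) \<partial>M)"
  proof (rule indicator_integral_mono[OF BM])
    show "AE \<omega> in M. \<omega> \<in> B \<longrightarrow> Y (\<tau> \<omega>) \<omega> - Y' (\<tau> \<omega>) \<omega> \<le> ?D \<omega> + \<epsilon>"
      using \<tau>(3) r'.above AE_space
    proof eventually_elim
      case (elim \<omega>)
      have "\<xi>' (\<tau> \<omega>) \<omega> \<le> Y' (\<tau> \<omega>) \<omega>" using elim(2) bounded_timeD(4)[OF \<tau>(1)] by blast
      then show ?case
        using elim(1) square_rcllD(6)[OF D elim(3) bounded_timeD(4)[OF \<tau>(1)], of \<omega>] by linarith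
    qed
  qed (use square_rcllD(4)[OF D] in auto)
  also have "\<dots> = (\<integral>\<omega>. indicator B \<omega> * ?D \<omega> \<partial>M) + \<epsilon> * measure M B"
    using BM square_rcllD(4)[OF D] by (simp add: indicator_integral_add)
  also have "\<dots> \<le> (\<integral>\<omega>. indicator B \<omega> * ?D \<omega> \<partial>M) + \<epsilon>"
    using \<epsilon> by (simp add: mult_left_le)
  finally show "(\<integral>\<omega>. indicator B \<omega> * (Y (S \<omega>) \<omega> - Y' (S \<omega>) \<omega>) \<partial>M) \<le> \<dots>" .
qed

text \<open>
  The maximal inequality follows by applying the comparison at the first time at which \<open>Y - Y'\<close>
  exceeds a given level.
\<close>

lemma reflected_maximal_inequality:
  assumes 1: "reflected M F T G R \<xi> Y A" and 2: "reflected M F T G R \<xi>' Y' A'"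
    and le: "AE \<omega> in M. \<forall>t\<in>{0..T}. Y' t \<omega> \<le> Y t \<omega>"
  shows "(\<integral>\<omega>. (path_sup T (\<lambda>t. Y t \<omega> - Y' t \<omega>))\<^sup>2 \<partial>M)
    \<le> 4 * (\<integral>\<omega>. (path_sup T (\<lambda>t. \<xi> t \<omega> - \<xi>' t \<omega>))\<^sup>2 \<partial>M)"
proof -
  interpret r: reflected M F T G R \<xi> Y A by (rule 1)
  interpret r': reflected M F T G R \<xi>' Y' A' by (rule 2)
  have D: "square_rcll (\<lambda>t \<omega>. \<xi> t \<omega> - \<xi>' t \<omega>)" by (rule square_rcll_diff[OF r.\<xi> r'.\<xi>])
  have V: "square_rcll (\<lambda>t \<omega>. Y t \<omega> - Y' t \<omega>)" by (rule square_rcll_diff[OF r.Y r'.Y])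
  define U where "U t \<omega> = Y' t \<omega> - Y t \<omega>" for t \<omega>
  have U: "square_rcll U" unfolding U_def by (rule square_rcll_diff[OF r'.Y r.Y])
  let ?D = "\<lambda>\<omega>. path_sup T (\<lambda>t. \<xi> t \<omega> - \<xi>' t \<omega>)" and ?N = "\<lambda>\<omega>. path_sup T (\<lambda>t. Y t \<omega> - Y' t \<omega>)"
  note [measurable] = square_rcllD(5)[OF D] square_rcllD(5)[OF V]
  show ?thesis
  proof (rule second_moment_from_weak_inequality)
    fix c :: real assume c: "0 < c"
    have zero: "bounded_time (\<lambda>_. 0)" using T_pos by (intro bounded_time_const) auto
    define S where "S = hitting U (- c) (\<lambda>_. 0)"
    have S: "bounded_time S"
      unfolding S_def using square_rcllD(1,2)[OF U] zero by (rule bounded_time_hitting)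
    define B where "B = {\<omega> \<in> space (sigma_at M F S). U (S \<omega>) \<omega> \<le> - c}"
    have B: "B \<in> sets (sigma_at M F S)"
      unfolding B_def using stopped_measurable[OF square_rcllD(1,2)[OF U] S] by measurable
    have BM [measurable]: "B \<in> sets M"
      using B subalgebra_sigma_at[OF bounded_timeD(1)[OF S]] by (auto simp: subalgebra_def)
    have B_iff: "\<omega> \<in> B \<longleftrightarrow> \<omega> \<in> space M \<and> c \<le> Y (S \<omega>) \<omega> - Y' (S \<omega>) \<omega>" for \<omega>
      by (auto simp: B_def U_def space_sigma_at)
    have "AE \<omega> in M. \<omega> \<in> {\<omega> \<in> space M. c < ?N \<omega>} \<longrightarrow> \<omega> \<in> B"
      using le
    proof eventually_elim
      case (elim \<omega>)
      show ?case
      proof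
        assume \<omega>: "\<omega> \<in> {\<omega> \<in> space M. c < ?N \<omega>}"
        have "\<exists>t\<in>{0..T}. c < \<bar>Y t \<omega> - Y' t \<omega>\<bar>"
        proof (rule ccontr)
          assume "\<not> (\<exists>t\<in>{0..T}. c < \<bar>Y t \<omega> - Y' t \<omega>\<bar>)"
          then have "?N \<omega> \<le> c" using T_pos by (intro path_sup_least) (auto simp: not_less)
          then show False using \<omega> by simp
        qed
        then obtain t where t: "t \<in> {0..T}" "c < \<bar>Y t \<omega> - Y' t \<omega>\<bar>" by blast
        then have "U t \<omega> < - c" using elim by (auto simp: U_def)
        then have "U (S \<omega>) \<omega> \<le> - c"
          unfolding S_def using \<omega> t by (intro at_hitting square_rcllD(2)[OF U] zero) auto
        then show "\<omega> \<in> B" using \<omega> by (simp add: B_def space_sigma_at)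
      qed
    qed
    then have "prob {\<omega> \<in> space M. c < ?N \<omega>} \<le> prob B"
      by (intro finite_measure_mono_AE) auto
    then have "c * prob {\<omega> \<in> space M. c < ?N \<omega>} \<le> c * prob B" using c by simp
    also have "\<dots> = (\<integral>\<omega>. indicator B \<omega> * c \<partial>M)" by simp
    also have "\<dots> \<le> (\<integral>\<omega>. indicator B \<omega> * (Y (S \<omega>) \<omega> - Y' (S \<omega>) \<omega>) \<partial>M)"
      using r.Y_stopped[OF S] r'.Y_stopped[OF S]
      by (intro indicator_integral_mono[OF BM]) (auto simp: B_iff)
    also have "\<dots> \<le> (\<integral>\<omega>. indicator B \<omega> * ?D \<omega> \<partial>M)" by (rule reflected_comparison[OF 1 2 S B])
    also have "\<dots> \<le> (\<integral>\<omega>. indicator {\<omega> \<in> space M. c \<le> ?N \<omega>} \<omega> * ?D \<omega> \<partial>M)"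
    proof (intro integral_mono integrable_indicator_mult square_rcllD(4)[OF D] BM)
      fix \<omega> assume \<omega>: "\<omega> \<in> space M"
      have "c \<le> ?N \<omega>" if "\<omega> \<in> B"
        using that square_rcllD(6)[OF V \<omega> bounded_timeD(4)[OF S, of \<omega>]] by (auto simp: B_iff)
      then show "indicator B \<omega> * ?D \<omega> \<le> indicator {\<omega> \<in> space M. c \<le> ?N \<omega>} \<omega> * ?D \<omega>"
        using \<omega> square_rcllD(7)[OF D \<omega>] by (auto simp: indicator_def)
    qed measurable
    finally show "c * prob {\<omega> \<in> space M. c < ?N \<omega>}
        \<le> (\<integral>\<omega>. indicator {\<omega> \<in> space M. c \<le> ?N \<omega>} \<omega> * ?D \<omega> \<partial>M)" .
  qed (use square_rcllD[OF D] square_rcllD[OF V] in auto)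
qed

end


subsection \<open>Solutions of the reflected equation\<close>

lemma (in driven) rbsde_solution_reflected:
  assumes \<mu>: "sigma_finite_measure \<mu>" and W: "brownian_motion M F W" and N: "poisson_random_measure M F \<mu> N"
    and G: "AE \<omega> in M. \<forall>s t. 0 \<le> s \<and> s \<le> t \<and> t \<le> T \<longrightarrow> (LINT u:{s..t}|lborel. g u \<omega>) = G t \<omega> - G s \<omega>"
    and \<xi>: "optional_process M F T \<xi>" "rcll_process M T \<xi>" "sup_norm_sq M T \<xi> < \<infinity>"
    and sol: "rbsde_solution M F T \<mu> W N g \<xi> Y Z l A"
  shows "reflected M F T G R \<xi> Y A"
proof
  obtain I J where I: "is_W_integral M F T W Z I" and J: "is_N_integral M F T \<mu> N l J"
    and eq: "AE \<omega> in M. \<forall>t\<in>{0..T}.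
           Y t \<omega> = \<xi> T \<omega> + (LINT s:{t..T}|lborel. g s \<omega>)
                   - (I T \<omega> - I t \<omega>) - (J T \<omega> - J t \<omega>) + A T \<omega> - A t \<omega>"
    using sol unfolding rbsde_solution_def by blast
  show Y: "square_rcll Y"
    using sol by (intro square_rcllI) (auto simp: rbsde_solution_def in_D2_def)
  show \<xi>_sq: "square_rcll \<xi>" using \<xi> by (intro square_rcllI optional_adapted)
  show A_ad: "adapted_process F T A"
    using sol by (intro predictable_adapted) (auto simp: rbsde_solution_def in_S2pi_def)
  show A_rcll: "rcll_process M T A" using sol by (simp add: rbsde_solution_def)
  show A_mono: "\<omega> \<in> space M \<Longrightarrow> A 0 \<omega> = 0" "\<omega> \<in> space M \<Longrightarrow> mono_on {0..T} (\<lambda>t. A t \<omega>)" for \<omega>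
    using sol by (auto simp: rbsde_solution_def in_S2pi_def)
  have T: "T \<in> {0..T}" using T_pos by simp
  show A_int: "integrable M (A T)"
  proof (rule square_integrable_imp_integrable)
    show "A T \<in> borel_measurable M" by (rule adapted_measurable_M[OF A_ad T])
    then show "integrable M (\<lambda>\<omega>. (A T \<omega>)\<^sup>2)"
      using sol by (intro integrableI_nonneg) (auto simp: rbsde_solution_def in_S2pi_def)
  qed
  show above: "AE \<omega> in M. \<forall>t\<in>{0..T}. \<xi> t \<omega> \<le> Y t \<omega>" using sol by (simp add: rbsde_solution_def)
  have eq': "AE \<omega> in M. \<forall>t\<in>{0..T}. Y t \<omega> + G t \<omega> + A t \<omega>
      = \<xi> T \<omega> + G T \<omega> + A T \<omega> - (I T \<omega> + J T \<omega>) + (I t \<omega> + J t \<omega>)"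
    using eq G by eventually_elim auto
  then show "AE \<omega> in M. Y T \<omega> = \<xi> T \<omega>"
    by eventually_elim (use T in force)
  have A_bound: "AE \<omega> in M. \<forall>t\<in>{0..T}. \<bar>A t \<omega>\<bar> \<le> A T \<omega>"
  proof (intro AE_I2 ballI)
    fix \<omega> t assume "\<omega> \<in> space M" "t \<in> {0..T}"
    then show "\<bar>A t \<omega>\<bar> \<le> A T \<omega>"
      using A_mono(1)[of \<omega>] mono_onD[OF A_mono(2), of \<omega> 0 t] mono_onD[OF A_mono(2), of \<omega> t T] T_pos by auto
  qed
  have IJ: "closed_martingale (\<lambda>t \<omega>. I t \<omega> + J t \<omega>)"
    using closed_martingale_W_integral[OF W I] closed_martingale_N_integral[OF \<mu> N J]
    by (rule closed_martingale_add)
  let ?m = "\<lambda>t \<omega>. Y t \<omega> + G t \<omega> + A t \<omega>"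
  show "closed_martingale ?m"
    unfolding closed_martingale_def
  proof (intro conjI ballI)
    have int: "integrable M (?m t)" if t: "t \<in> {0..T}" for t
      using square_rcll_stopped[OF Y bounded_time_const[OF t]] G_stopped[OF bounded_time_const[OF t]]
        stopped_integrable[OF A_ad A_rcll bounded_time_const[OF t] A_int A_bound]
      by (intro Bochner_Integration.integrable_add)
    fix t assume t: "t \<in> {0..T}"
    show "integrable M (?m t)" by (rule int[OF t])
    fix B assume B: "B \<in> sets (F t)"
    have BM: "B \<in> sets M" using B sets_F_le by blast
    have IJ_int: "integrable M (\<lambda>\<omega>. I t \<omega> + J t \<omega>)" if "t \<in> {0..T}" for t
      using IJ that by (auto simp: closed_martingale_def)
    have "(\<integral>\<omega>. indicator B \<omega> * (?m T \<omega> - ?m t \<omega>) \<partial>M)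
        = (\<integral>\<omega>. indicator B \<omega> * ((I T \<omega> + J T \<omega>) - (I t \<omega> + J t \<omega>)) \<partial>M)"
    proof (rule integral_cong_AE)
      show "AE \<omega> in M. indicator B \<omega> * (?m T \<omega> - ?m t \<omega>)
          = indicator B \<omega> * ((I T \<omega> + J T \<omega>) - (I t \<omega> + J t \<omega>))"
        using eq'
      proof eventually_elim
        case (elim \<omega>)
        from elim[rule_format, OF t] elim[rule_format, OF T] show ?case by simp
      qed
    next
      have "integrable M (\<lambda>\<omega>. indicator B \<omega> * (?m T \<omega> - ?m t \<omega>))"
        by (intro integrable_indicator_mult BM Bochner_Integration.integrable_diff int t T)
      then show "(\<lambda>\<omega>. indicator B \<omega> * (?m T \<omega> - ?m t \<omega>)) \<in> borel_measurable M" by blast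
      have "integrable M (\<lambda>\<omega>. indicator B \<omega> * ((I T \<omega> + J T \<omega>) - (I t \<omega> + J t \<omega>)))"
        by (intro integrable_indicator_mult BM Bochner_Integration.integrable_diff IJ_int t T)
      then show "(\<lambda>\<omega>. indicator B \<omega> * ((I T \<omega> + J T \<omega>) - (I t \<omega> + J t \<omega>))) \<in> borel_measurable M" by blast
    qed
    also have "\<dots> = 0"
      using IJ t B unfolding indicator_integral_diff[OF BM IJ_int[OF T] IJ_int[OF t]]
      by (simp add: closed_martingale_def)
    finally show "(\<integral>\<omega>. indicator B \<omega> * ?m T \<omega> \<partial>M) = (\<integral>\<omega>. indicator B \<omega> * ?m t \<omega> \<partial>M)"
      unfolding indicator_integral_diff[OF BM int[OF T] int[OF t]] by simp
  qed
  have zero: "AE \<omega> in M. (LINT t:{0<..T}|stieltjes_measure T (\<lambda>t. A t \<omega>).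
           Lim (at_left t) (\<lambda>u. Y u \<omega>) - Lim (at_left t) (\<lambda>u. \<xi> u \<omega>)) = 0"
    using sol by (simp add: rbsde_solution_def)
  show "AE \<omega> in M. \<forall>s t \<delta>. 0 \<le> s \<and> s \<le> t \<and> t \<le> T \<and> 0 < \<delta> \<and>
      (\<forall>u. s \<le> u \<and> u < t \<longrightarrow> \<delta> \<le> Y u \<omega> - \<xi> u \<omega>) \<longrightarrow> A t \<omega> = A s \<omega>"
    using zero above AE_space
  proof eventually_elim
    case (elim \<omega>)
    have paths: "rcll_on T (\<lambda>t. Y t \<omega>)" "rcll_on T (\<lambda>t. \<xi> t \<omega>)" "rcll_on T (\<lambda>t. A t \<omega>)"
      using square_rcllD(2)[OF Y] \<xi>(2) A_rcll elim(3) by (auto simp: rcll_process_def)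
    have ge: "\<And>t. t \<in> {0..T} \<Longrightarrow> \<xi> t \<omega> \<le> Y t \<omega>" using elim(2) by blast
    show ?case
      using flat_off_barrier[OF T_pos paths A_mono(2)[OF elim(3)] ge elim(1)] by blast
  qed
qed


section \<open>The limit of the reflected equations\<close>

lemma is_ess_supD:
  assumes "is_ess_sup M I f h"
  shows "h \<in> borel_measurable M" "i \<in> I \<Longrightarrow> AE \<omega> in M. f i \<omega> \<le> h \<omega>"
    "k \<in> borel_measurable M \<Longrightarrow> (\<And>i. i \<in> I \<Longrightarrow> AE \<omega> in M. f i \<omega> \<le> k \<omega>) \<Longrightarrow> AE \<omega> in M. h \<omega> \<le> k \<omega>"
  using assms by (auto simp: is_ess_sup_def)

lemma (in prob_space) INF_eq_zero_AE:
  fixes b :: "nat \<Rightarrow> 'a \<Rightarrow> ennreal"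
  assumes [measurable]: "\<And>n. b n \<in> borel_measurable M"
    and small: "\<And>\<epsilon>. 0 < \<epsilon> \<Longrightarrow> \<exists>n. (\<integral>\<^sup>+\<omega>. b n \<omega> \<partial>M) \<le> ennreal \<epsilon>"
  shows "AE \<omega> in M. \<forall>\<epsilon>>0. \<exists>n. b n \<omega> < ennreal \<epsilon>"
proof -
  have "(\<integral>\<^sup>+\<omega>. (INF n. b n \<omega>) \<partial>M) \<le> 0"
  proof (rule ennreal_le_epsilon)
    fix \<epsilon> :: real assume "0 < \<epsilon>"
    then obtain n where n: "(\<integral>\<^sup>+\<omega>. b n \<omega> \<partial>M) \<le> ennreal \<epsilon>" using small by blast
    have "(\<integral>\<^sup>+\<omega>. (INF n. b n \<omega>) \<partial>M) \<le> (\<integral>\<^sup>+\<omega>. b n \<omega> \<partial>M)"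
      by (intro nn_integral_mono INF_lower) simp
    then show "(\<integral>\<^sup>+\<omega>. (INF n. b n \<omega>) \<partial>M) \<le> 0 + ennreal \<epsilon>" using n by simp
  qed
  then have "AE \<omega> in M. (INF n. b n \<omega>) = 0"
    by (subst nn_integral_0_iff_AE[symmetric]) auto
  then show ?thesis
  proof eventually_elim
    case (elim \<omega>)
    show ?case
    proof (intro allI impI)
      fix \<epsilon> :: real assume "0 < \<epsilon>"
      then have "(INF n. b n \<omega>) < ennreal \<epsilon>" using elim by simp
      then show "\<exists>n. b n \<omega> < ennreal \<epsilon>" by (simp add: INF_less_iff)
    qed
  qed
qed

lemma (in finite_measure_subalgebra) real_cond_exp_le:
  fixes U V :: "'a \<Rightarrow> real"
  assumes U: "integrable M U" "U \<in> borel_measurable F" and V: "integrable M V"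
    and le: "\<And>B. B \<in> sets F \<Longrightarrow> (\<integral>\<omega>. indicator B \<omega> * V \<omega> \<partial>M) \<le> (\<integral>\<omega>. indicator B \<omega> * U \<omega> \<partial>M)"
  shows "AE \<omega> in M. real_cond_exp M F V \<omega> \<le> U \<omega>"
proof -
  let ?C = "real_cond_exp M F V"
  have C: "integrable M ?C" using V by (rule real_cond_exp_int)
  note [measurable] = U(2)
  define B where "B = {\<omega> \<in> space F. U \<omega> < ?C \<omega>}"
  have B: "B \<in> sets F" unfolding B_def by measurable
  have BM [measurable]: "B \<in> sets M" using B subalg by (auto simp: subalgebra_def)
  have int: "integrable M (\<lambda>\<omega>. indicator B \<omega> * f \<omega>)" if "integrable M f" for f :: "'a \<Rightarrow> real"
    using integrable_real_mult_indicator[OF BM that] by (simp add: mult.commute)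
  have "(\<integral>\<omega>. indicator B \<omega> * ?C \<omega> \<partial>M) = (\<integral>\<omega>. indicator B \<omega> * V \<omega> \<partial>M)"
    using real_cond_exp_intA[OF V B] by (simp add: set_lebesgue_integral_def)
  then have "(\<integral>\<omega>. indicator B \<omega> * ?C \<omega> - indicator B \<omega> * U \<omega> \<partial>M) \<le> 0"
    using le[OF B] int[OF C] int[OF U(1)] by simp
  moreover have nonneg: "0 \<le> indicator B \<omega> * ?C \<omega> - indicator B \<omega> * U \<omega>" for \<omega>
    by (auto simp: B_def indicator_def)
  moreover have "0 \<le> (\<integral>\<omega>. indicator B \<omega> * ?C \<omega> - indicator B \<omega> * U \<omega> \<partial>M)"
    by (intro Bochner_Integration.integral_nonneg nonneg)
  ultimately have "(\<integral>\<omega>. indicator B \<omega> * ?C \<omega> - indicator B \<omega> * U \<omega> \<partial>M) = 0" by simp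
  then have "AE \<omega> in M. indicator B \<omega> * ?C \<omega> - indicator B \<omega> * U \<omega> = 0"
    using int[OF C] int[OF U(1)] nonneg by (subst (asm) integral_nonneg_eq_0_iff_AE) auto
  then show ?thesis
    using AE_space
  proof eventually_elim
    case (elim \<omega>)
    have "\<omega> \<in> space F" using elim(2) subalg by (simp add: subalgebra_def)
    then show ?case using elim(1) by (cases "\<omega> \<in> B") (auto simp: B_def)
  qed
qed

context usual_conditions
begin

lemma S2_norm_sq_le:
  assumes b [measurable]: "b \<in> borel_measurable M"
    and le: "AE \<omega> in M. \<forall>t\<in>{0..T}. ennreal ((X t \<omega>)\<^sup>2) \<le> b \<omega>"
  shows "S2_norm_sq M F T X \<le> (\<integral>\<^sup>+\<omega>. b \<omega> \<partial>M)"
proof -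
  let ?f = "\<lambda>\<tau> \<omega>. ereal (\<bar>X (\<tau> \<omega>) \<omega>\<bar>\<^sup>2)"
  have sup: "is_ess_sup M (stopping_times0 M F T) ?f (ess_sup M (stopping_times0 M F T) ?f)"
    by (rule is_ess_sup_ess_sup[OF prob_space_axioms])
  have "AE \<omega> in M. ?f \<tau> \<omega> \<le> enn2ereal (b \<omega>)" if \<tau>: "\<tau> \<in> stopping_times0 M F T" for \<tau>
  proof -
    have "AE \<omega> in M. 0 \<le> \<tau> \<omega> \<and> \<tau> \<omega> \<le> T" using \<tau> by (simp add: stopping_times_def)
    then show ?thesis
      using le
    proof eventually_elim
      case (elim \<omega>)
      then have "ennreal ((X (\<tau> \<omega>) \<omega>)\<^sup>2) \<le> b \<omega>" by simp
      then show ?case by (simp add: less_eq_ennreal.rep_eq)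
    qed
  qed
  then have "AE \<omega> in M. ess_sup M (stopping_times0 M F T) ?f \<omega> \<le> enn2ereal (b \<omega>)"
    by (intro is_ess_supD(3)[OF sup]) measurable
  then have "AE \<omega> in M. e2ennreal (ess_sup M (stopping_times0 M F T) ?f \<omega>) \<le> b \<omega>"
    by eventually_elim (use e2ennreal_mono in force)
  then show ?thesis
    unfolding S2_norm_sq_def by (rule nn_integral_mono_AE)
qed

text \<open>By monotonicity, a uniform bound for one index holds for all later ones. So it suffices that the
  bounds \<open>b n\<close> come arbitrarily close to 0 almost surely, which follows from convergence in mean.\<close>

lemma uniform_limit_AE:
  fixes f :: "nat \<Rightarrow> real \<Rightarrow> 'a \<Rightarrow> real"
  assumes mono: "AE \<omega> in M. \<forall>t\<in>{0..T}. decseq (\<lambda>n. f n t \<omega>)"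
    and lim: "AE \<omega> in M. \<forall>t\<in>{0..T}. (\<lambda>n. f n t \<omega>) \<longlonglongrightarrow> h t \<omega>"
    and b: "\<And>n. b n \<in> borel_measurable M" "(\<lambda>n. \<integral>\<^sup>+\<omega>. b n \<omega> \<partial>M) \<longlonglongrightarrow> 0"
    and le: "\<And>n. AE \<omega> in M. \<forall>t\<in>{0..T}. ennreal ((f n t \<omega> - h t \<omega>)\<^sup>2) \<le> b n \<omega>"
  shows "AE \<omega> in M. uniform_limit {0..T} (\<lambda>n t. f n t \<omega>) (\<lambda>t. h t \<omega>) sequentially"
proof -
  have "\<exists>n. (\<integral>\<^sup>+\<omega>. b n \<omega> \<partial>M) \<le> ennreal \<epsilon>" if "0 < \<epsilon>" for \<epsilon>
  proof -
    have "\<forall>\<^sub>F n in sequentially. (\<integral>\<^sup>+\<omega>. b n \<omega> \<partial>M) < ennreal \<epsilon>"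
      using that by (intro order_tendstoD(2)[OF b(2)]) simp
    then show ?thesis
      using eventually_happens'[OF sequentially_bot] by (blast intro: less_imp_le)
  qed
  then have "AE \<omega> in M. \<forall>\<epsilon>>0. \<exists>n. b n \<omega> < ennreal \<epsilon>"
    using b(1) by (intro INF_eq_zero_AE)
  moreover have "AE \<omega> in M. \<forall>n. \<forall>t\<in>{0..T}. ennreal ((f n t \<omega> - h t \<omega>)\<^sup>2) \<le> b n \<omega>"
    using le by (simp add: AE_all_countable)
  ultimately show ?thesis
    using mono lim
  proof eventually_elim
    case (elim \<omega>)
    show ?case
    proof (rule uniform_limitI)
      fix e :: real assume e: "0 < e"
      then obtain n where n: "b n \<omega> < ennreal (e\<^sup>2)" using elim(1) by (meson zero_less_power)
      have "dist (f m t \<omega>) (h t \<omega>) < e" if "n \<le> m" "t \<in> {0..T}" for m t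
      proof -
        have "ennreal ((f n t \<omega> - h t \<omega>)\<^sup>2) < ennreal (e\<^sup>2)"
          using elim(2)[THEN spec, of n, THEN bspec, OF that(2)] n by (rule order_le_less_trans)
        then have "\<bar>f n t \<omega> - h t \<omega>\<bar>\<^sup>2 < e\<^sup>2" by (simp add: ennreal_less_iff)
        then have "\<bar>f n t \<omega> - h t \<omega>\<bar> < e" by (rule power2_less_imp_less) (use e in simp)
        moreover have mono: "decseq (\<lambda>n. f n t \<omega>)" and lim: "(\<lambda>n. f n t \<omega>) \<longlonglongrightarrow> h t \<omega>"
          using elim(3,4) that(2) by auto
        have "h t \<omega> \<le> f m t \<omega>" by (rule decseq_ge[OF mono lim])
        moreover have "f m t \<omega> \<le> f n t \<omega>" using decseqD[OF mono that(1)] .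
        ultimately show ?thesis by (simp add: dist_real_def)
      qed
      then show "\<forall>\<^sub>F n in sequentially. \<forall>t\<in>{0..T}. dist (f n t \<omega>) (h t \<omega>) < e"
        unfolding eventually_sequentially by blast
    qed
  qed
qed

end

locale reflected_limit = driven +
  fixes \<xi> Y :: "real \<Rightarrow> 'a \<Rightarrow> real" and \<xi>n Yn An :: "nat \<Rightarrow> real \<Rightarrow> 'a \<Rightarrow> real"
  assumes solutions: "\<And>n. reflected M F T G R (\<xi>n n) (Yn n) (An n)"
    and \<xi>n_mono: "AE \<omega> in M. \<forall>t\<in>{0..T}. decseq (\<lambda>n. \<xi>n n t \<omega>)"
    and \<xi>n_lim: "AE \<omega> in M. \<forall>t\<in>{0..T}. (\<lambda>n. \<xi>n n t \<omega>) \<longlonglongrightarrow> \<xi> t \<omega>"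
    and \<xi>n_S2: "(\<lambda>n. S2_norm_sq M F T (\<lambda>t \<omega>. \<xi>n n t \<omega> - \<xi> t \<omega>)) \<longlonglongrightarrow> 0"
    and Yn_mono: "AE \<omega> in M. \<forall>t\<in>{0..T}. decseq (\<lambda>n. Yn n t \<omega>)"
    and Y_def: "\<And>t \<omega>. Y t \<omega> = lim (\<lambda>n. Yn n t \<omega>)"
begin

lemma \<xi>n_square: "square_rcll (\<xi>n n)" and Yn_square: "square_rcll (Yn n)"
  using solutions[of n] by (auto simp: reflected_def reflected_axioms_def)

lemma \<xi>_le_\<xi>n: "AE \<omega> in M. \<forall>t\<in>{0..T}. \<forall>n. \<xi> t \<omega> \<le> \<xi>n n t \<omega>"
  using \<xi>n_mono \<xi>n_lim
proof eventually_elim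
  case (elim \<omega>)
  have "\<xi> t \<omega> \<le> \<xi>n n t \<omega>" if "t \<in> {0..T}" for t n
    by (rule decseq_ge[of "\<lambda>n. \<xi>n n t \<omega>"]) (use elim that in auto)
  then show ?case by blast
qed

lemma \<xi>n_le_Yn: "AE \<omega> in M. \<forall>t\<in>{0..T}. \<forall>n. \<xi>n n t \<omega> \<le> Yn n t \<omega>"
proof -
  have "AE \<omega> in M. \<forall>n. \<forall>t\<in>{0..T}. \<xi>n n t \<omega> \<le> Yn n t \<omega>"
    using reflected.above[OF solutions] by (simp add: AE_all_countable)
  then show ?thesis by eventually_elim blast
qed

lemma Yn_lim: "AE \<omega> in M. \<forall>t\<in>{0..T}. (\<lambda>n. Yn n t \<omega>) \<longlonglongrightarrow> Y t \<omega>"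
  using \<xi>_le_\<xi>n \<xi>n_le_Yn Yn_mono
proof eventually_elim
  case (elim \<omega>)
  show ?case
  proof
    fix t assume t: "t \<in> {0..T}"
    have "\<xi> t \<omega> \<le> Yn n t \<omega>" for n using elim(1,2) t by (meson order_trans)
    then obtain y where "(\<lambda>n. Yn n t \<omega>) \<longlonglongrightarrow> y"
      using decseq_convergent[of "\<lambda>n. Yn n t \<omega>" "\<xi> t \<omega>"] elim(3) t by blast
    then show "(\<lambda>n. Yn n t \<omega>) \<longlonglongrightarrow> Y t \<omega>" by (simp add: Y_def limI)
  qed
qed

lemma Y_le_Yn: "AE \<omega> in M. \<forall>t\<in>{0..T}. \<forall>n. Y t \<omega> \<le> Yn n t \<omega>"
  using Yn_mono Yn_lim
proof eventually_elim
  case (elim \<omega>)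
  have "Y t \<omega> \<le> Yn n t \<omega>" if "t \<in> {0..T}" for t n
    by (rule decseq_ge[of "\<lambda>n. Yn n t \<omega>"]) (use elim that in auto)
  then show ?case by blast
qed

lemma \<xi>_le_Y: "AE \<omega> in M. \<forall>t\<in>{0..T}. \<xi> t \<omega> \<le> Y t \<omega>"
  using \<xi>_le_\<xi>n \<xi>n_le_Yn Yn_lim
proof eventually_elim
  case (elim \<omega>)
  show ?case
  proof
    fix t assume t: "t \<in> {0..T}"
    have "\<xi> t \<omega> \<le> Yn n t \<omega>" for n using elim(1,2) t by (meson order_trans)
    then show "\<xi> t \<omega> \<le> Y t \<omega>" using elim(3) t by (intro LIMSEQ_le_const[of "\<lambda>n. Yn n t \<omega>"]) auto
  qed
qed

text \<open>
  The essential supremum over stopping times bounds \<open>\<xi>n n - \<xi>\<close>, and thereby \<open>\<xi>n n - \<xi>n m\<close> for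
  \<open>m \<ge> n\<close>, at countably many deterministic times; it bounds the latter difference at all times because
  this is right-continuous. Then \<open>m\<close> tends to infinity. Thus the convergence of the barriers in
  \<open>S\<^sup>2\<close> is uniform in time.
\<close>

lemma barrier_bound:
  "\<exists>d :: nat \<Rightarrow> 'a \<Rightarrow> ennreal. (\<forall>n. d n \<in> borel_measurable M) \<and>
    (\<lambda>n. \<integral>\<^sup>+\<omega>. d n \<omega> \<partial>M) \<longlonglongrightarrow> 0 \<and>
    (\<forall>n. AE \<omega> in M. \<forall>t\<in>{0..T}. ennreal ((\<xi>n n t \<omega> - \<xi> t \<omega>)\<^sup>2) \<le> d n \<omega>)"
proof -
  let ?f = "\<lambda>n \<tau> \<omega>. ereal (\<bar>\<xi>n n (\<tau> \<omega>) \<omega> - \<xi> (\<tau> \<omega>) \<omega>\<bar>\<^sup>2)"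
  define h where "h n = ess_sup M (stopping_times0 M F T) (?f n)" for n
  define d where "d n \<omega> = e2ennreal (h n \<omega>)" for n \<omega>
  have sup: "is_ess_sup M (stopping_times0 M F T) (?f n) (h n)" for n
    unfolding h_def by (rule is_ess_sup_ess_sup[OF prob_space_axioms])
  have h [measurable]: "h n \<in> borel_measurable M" for n by (rule is_ess_supD(1)[OF sup])
  have d [measurable]: "d n \<in> borel_measurable M" for n unfolding d_def by measurable
  have d_lim: "(\<lambda>n. \<integral>\<^sup>+\<omega>. d n \<omega> \<partial>M) \<longlonglongrightarrow> 0"
    using \<xi>n_S2 by (simp add: S2_norm_sq_def d_def h_def)
  have d_bound: "AE \<omega> in M. \<forall>t\<in>{0..T}. ennreal ((\<xi>n n t \<omega> - \<xi> t \<omega>)\<^sup>2) \<le> d n \<omega>" for n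
  proof -
    have "AE \<omega> in M. \<forall>q\<in>dense_times T. ennreal ((\<xi>n n q \<omega> - \<xi> q \<omega>)\<^sup>2) \<le> d n \<omega>"
      unfolding AE_ball_countable[OF countable_dense_times]
    proof
      fix q assume "q \<in> dense_times T"
      then have "bounded_time (\<lambda>_. q)"
        using dense_times_subset[of T] T_pos by (intro bounded_time_const) auto
      then have "AE \<omega> in M. ?f n (\<lambda>_. q) \<omega> \<le> h n \<omega>"
        by (intro is_ess_supD(2)[OF sup] bounded_time_stopping_times0)
      then show "AE \<omega> in M. ennreal ((\<xi>n n q \<omega> - \<xi> q \<omega>)\<^sup>2) \<le> d n \<omega>"
      proof eventually_elim
        case (elim \<omega>)
        from e2ennreal_mono[OF elim] show ?case by (simp add: d_def)
      qed
    qed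
    then show ?thesis
      using \<xi>n_mono \<xi>_le_\<xi>n \<xi>n_lim AE_space
    proof eventually_elim
      case (elim \<omega>)
      show ?case
      proof (cases "d n \<omega> = \<top>")
        case False
        then obtain r where r: "0 \<le> r" "d n \<omega> = ennreal r" by (cases "d n \<omega>") auto
        have near: "\<xi>n n t \<omega> - \<xi>n m t \<omega> \<le> sqrt r" if m: "n \<le> m" and t: "t \<in> {0..T}" for m t
        proof (rule rcll_le_on_dense_times[OF _ _ t])
          show "rcll_on T (\<lambda>t. \<xi>n n t \<omega> - \<xi>n m t \<omega>)"
            using square_rcllD(2)[OF \<xi>n_square] elim(5) by (auto simp: rcll_process_def intro: rcll_on_diff)
          fix q assume q: "q \<in> dense_times T"
          then have qT: "q \<in> {0..T}" using dense_times_subset[of T] T_pos by auto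
          have "(\<xi>n n q \<omega> - \<xi> q \<omega>)\<^sup>2 \<le> r"
            using elim(1) q r by auto
          then have "\<xi>n n q \<omega> - \<xi> q \<omega> \<le> sqrt r" by (rule real_le_rsqrt)
          moreover have "\<xi> q \<omega> \<le> \<xi>n m q \<omega>" using elim(3) qT by blast
          ultimately show "\<xi>n n q \<omega> - \<xi>n m q \<omega> \<le> sqrt r" by linarith
        qed
        show ?thesis
        proof
          fix t assume t: "t \<in> {0..T}"
          have "\<xi>n n t \<omega> - \<xi> t \<omega> \<le> sqrt r"
          proof (rule LIMSEQ_le_const2)
            show "(\<lambda>m. \<xi>n n t \<omega> - \<xi>n m t \<omega>) \<longlonglongrightarrow> \<xi>n n t \<omega> - \<xi> t \<omega>"
              using elim(4) t by (intro tendsto_diff) auto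
            show "\<exists>N. \<forall>m\<ge>N. \<xi>n n t \<omega> - \<xi>n m t \<omega> \<le> sqrt r" using near t by blast
          qed
          moreover have "0 \<le> \<xi>n n t \<omega> - \<xi> t \<omega>" using elim(3) t by simp
          ultimately have "(\<xi>n n t \<omega> - \<xi> t \<omega>)\<^sup>2 \<le> (sqrt r)\<^sup>2" by (intro power_mono)
          then show "ennreal ((\<xi>n n t \<omega> - \<xi> t \<omega>)\<^sup>2) \<le> d n \<omega>" using r by (simp add: ennreal_leI)
        qed
      qed simp
    qed
  qed
  show ?thesis using d d_lim d_bound by (intro exI[of _ d]) simp
qed

text \<open>The maximal inequality transfers the uniform bound from the barriers to the solutions.\<close>

lemma solution_bound:
  "\<exists>k :: nat \<Rightarrow> 'a \<Rightarrow> ennreal. (\<forall>n. k n \<in> borel_measurable M) \<and>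
    (\<lambda>n. \<integral>\<^sup>+\<omega>. k n \<omega> \<partial>M) \<longlonglongrightarrow> 0 \<and>
    (\<forall>n. AE \<omega> in M. \<forall>t\<in>{0..T}. ennreal ((Yn n t \<omega> - Y t \<omega>)\<^sup>2) \<le> k n \<omega>)"
proof -
  obtain d :: "nat \<Rightarrow> 'a \<Rightarrow> ennreal" where d: "\<And>n. d n \<in> borel_measurable M"
    "(\<lambda>n. \<integral>\<^sup>+\<omega>. d n \<omega> \<partial>M) \<longlonglongrightarrow> 0"
    "\<And>n. AE \<omega> in M. \<forall>t\<in>{0..T}. ennreal ((\<xi>n n t \<omega> - \<xi> t \<omega>)\<^sup>2) \<le> d n \<omega>"
    using barrier_bound by blast
  define p where "p n m \<omega> = path_sup T (\<lambda>t. Yn n t \<omega> - Yn (n + m) t \<omega>)" for n m \<omega>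
  define k where "k n \<omega> = (SUP m. ennreal ((p n m \<omega>)\<^sup>2))" for n \<omega>
  have sq: "square_rcll (\<lambda>t \<omega>. Yn n t \<omega> - Yn m t \<omega>)" "square_rcll (\<lambda>t \<omega>. \<xi>n n t \<omega> - \<xi>n m t \<omega>)" for n m
    by (intro square_rcll_diff Yn_square \<xi>n_square)+
  have p [measurable]: "p n m \<in> borel_measurable M" for n m
    unfolding p_def by (rule square_rcllD(5)[OF sq(1)])
  have k [measurable]: "k n \<in> borel_measurable M" for n unfolding k_def by measurable
  have p_le: "(\<integral>\<^sup>+\<omega>. ennreal ((p n m \<omega>)\<^sup>2) \<partial>M) \<le> 4 * (\<integral>\<^sup>+\<omega>. d n \<omega> \<partial>M)" for n m
  proof -
    let ?q = "\<lambda>\<omega>. path_sup T (\<lambda>t. \<xi>n n t \<omega> - \<xi>n (n + m) t \<omega>)"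
    have "AE \<omega> in M. \<forall>t\<in>{0..T}. Yn (n + m) t \<omega> \<le> Yn n t \<omega>"
      using Yn_mono by eventually_elim (auto simp: decseq_def)
    then have "(\<integral>\<omega>. (p n m \<omega>)\<^sup>2 \<partial>M) \<le> 4 * (\<integral>\<omega>. (?q \<omega>)\<^sup>2 \<partial>M)"
      unfolding p_def by (rule reflected_maximal_inequality[OF solutions solutions])
    then have "ennreal (\<integral>\<omega>. (p n m \<omega>)\<^sup>2 \<partial>M) \<le> ennreal (4 * (\<integral>\<omega>. (?q \<omega>)\<^sup>2 \<partial>M))"
      by (rule ennreal_leI)
    also have "\<dots> = 4 * ennreal (\<integral>\<omega>. (?q \<omega>)\<^sup>2 \<partial>M)" by (subst ennreal_mult) auto
    also have "ennreal (\<integral>\<omega>. (p n m \<omega>)\<^sup>2 \<partial>M) = (\<integral>\<^sup>+\<omega>. ennreal ((p n m \<omega>)\<^sup>2) \<partial>M)"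
      unfolding p_def using square_rcllD(3)[OF sq(1)] by (intro nn_integral_eq_integral[symmetric]) auto
    also have "ennreal (\<integral>\<omega>. (?q \<omega>)\<^sup>2 \<partial>M) = (\<integral>\<^sup>+\<omega>. ennreal ((?q \<omega>)\<^sup>2) \<partial>M)"
      using square_rcllD(3)[OF sq(2)] by (intro nn_integral_eq_integral[symmetric]) auto
    also have "(\<integral>\<^sup>+\<omega>. ennreal ((?q \<omega>)\<^sup>2) \<partial>M) \<le> (\<integral>\<^sup>+\<omega>. d n \<omega> \<partial>M)"
    proof (rule nn_integral_mono_AE)
      show "AE \<omega> in M. ennreal ((?q \<omega>)\<^sup>2) \<le> d n \<omega>"
        using d(3)[of n] \<xi>n_mono \<xi>_le_\<xi>n AE_space
      proof eventually_elim
        case (elim \<omega>)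
        have "rcll_on T (\<lambda>t. \<xi>n n t \<omega> - \<xi>n (n + m) t \<omega>)"
          using square_rcllD(2)[OF sq(2)] elim(4) by (auto simp: rcll_process_def)
        then have "ennreal ((?q \<omega>)\<^sup>2) = (SUP t\<in>{0..T}. ennreal (\<bar>\<xi>n n t \<omega> - \<xi>n (n + m) t \<omega>\<bar>\<^sup>2))"
          using T_pos by (intro path_sup_square) auto
        also have "\<dots> \<le> d n \<omega>"
        proof (rule SUP_least)
          fix t assume t: "t \<in> {0..T}"
          have "\<xi> t \<omega> \<le> \<xi>n (n + m) t \<omega>" "\<xi>n (n + m) t \<omega> \<le> \<xi>n n t \<omega>"
            using elim(2,3) t by (auto simp: decseq_def)
          then have "ennreal (\<bar>\<xi>n n t \<omega> - \<xi>n (n + m) t \<omega>\<bar>\<^sup>2) \<le> ennreal ((\<xi>n n t \<omega> - \<xi> t \<omega>)\<^sup>2)"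
            by (intro ennreal_leI) (simp add: power_mono)
          also have "\<dots> \<le> d n \<omega>" using elim(1) t by blast
          finally show "ennreal (\<bar>\<xi>n n t \<omega> - \<xi>n (n + m) t \<omega>\<bar>\<^sup>2) \<le> d n \<omega>" .
        qed
        finally show ?case .
      qed
    qed
    finally show ?thesis by (simp add: mult_left_mono)
  qed
  have k_le: "(\<integral>\<^sup>+\<omega>. k n \<omega> \<partial>M) \<le> 4 * (\<integral>\<^sup>+\<omega>. d n \<omega> \<partial>M)" for n
  proof -
    have "(\<integral>\<^sup>+\<omega>. k n \<omega> \<partial>M) = (SUP m. \<integral>\<^sup>+\<omega>. ennreal ((p n m \<omega>)\<^sup>2) \<partial>M)"
      unfolding k_def
    proof (rule nn_integral_monotone_convergence_SUP_AE)
      fix m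
      show "AE \<omega> in M. ennreal ((p n m \<omega>)\<^sup>2) \<le> ennreal ((p n (Suc m) \<omega>)\<^sup>2)"
        using Yn_mono AE_space
      proof eventually_elim
        case (elim \<omega>)
        have "p n m \<omega> \<le> p n (Suc m) \<omega>"
          unfolding p_def
        proof (rule path_sup_least)
          fix t assume t: "t \<in> {0..T}"
          have "Yn (n + Suc m) t \<omega> \<le> Yn (n + m) t \<omega>" "Yn (n + m) t \<omega> \<le> Yn n t \<omega>"
            using elim(1) t by (auto simp: decseq_def)
          moreover have "\<bar>Yn n t \<omega> - Yn (n + Suc m) t \<omega>\<bar> \<le> path_sup T (\<lambda>t. Yn n t \<omega> - Yn (n + Suc m) t \<omega>)"
            by (rule square_rcllD(6)[OF sq(1) elim(2) t])
          ultimately show "\<bar>Yn n t \<omega> - Yn (n + m) t \<omega>\<bar> \<le> path_sup T (\<lambda>t. Yn n t \<omega> - Yn (n + Suc m) t \<omega>)"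
            by linarith
        qed (use T_pos in simp)
        moreover have "0 \<le> p n m \<omega>" unfolding p_def by (rule square_rcllD(7)[OF sq(1) elim(2)])
        ultimately show ?case by (intro ennreal_leI power_mono)
      qed
    qed measurable
    also have "\<dots> \<le> 4 * (\<integral>\<^sup>+\<omega>. d n \<omega> \<partial>M)" by (intro SUP_least p_le)
    finally show ?thesis .
  qed
  have k_lim: "(\<lambda>n. \<integral>\<^sup>+\<omega>. k n \<omega> \<partial>M) \<longlonglongrightarrow> 0"
  proof (rule tendsto_sandwich[OF always_eventually always_eventually tendsto_const])
    show "(\<lambda>n. 4 * (\<integral>\<^sup>+\<omega>. d n \<omega> \<partial>M)) \<longlonglongrightarrow> 0"
      using ennreal_tendsto_cmult[OF _ d(2), of 4] by simp
  qed (use k_le in auto)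
  have k_bound: "AE \<omega> in M. \<forall>t\<in>{0..T}. ennreal ((Yn n t \<omega> - Y t \<omega>)\<^sup>2) \<le> k n \<omega>" for n
    using Yn_lim AE_space
  proof eventually_elim
    case (elim \<omega>)
    show ?case
    proof
      fix t assume t: "t \<in> {0..T}"
      have "(\<lambda>m. Yn (m + n) t \<omega>) \<longlonglongrightarrow> Y t \<omega>" using elim(1) t by (intro LIMSEQ_ignore_initial_segment) blast
      then have lim: "(\<lambda>m. ennreal ((Yn n t \<omega> - Yn (n + m) t \<omega>)\<^sup>2)) \<longlonglongrightarrow> ennreal ((Yn n t \<omega> - Y t \<omega>)\<^sup>2)"
        by (intro tendsto_ennrealI tendsto_power tendsto_diff tendsto_const) (simp add: add.commute)
      have "ennreal ((Yn n t \<omega> - Yn (n + m) t \<omega>)\<^sup>2) \<le> k n \<omega>" for m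
      proof -
        have "\<bar>Yn n t \<omega> - Yn (n + m) t \<omega>\<bar> \<le> p n m \<omega>"
          unfolding p_def by (rule square_rcllD(6)[OF sq(1) elim(2) t])
        then have "(\<bar>Yn n t \<omega> - Yn (n + m) t \<omega>\<bar>)\<^sup>2 \<le> (p n m \<omega>)\<^sup>2" by (intro power_mono) auto
        then have "ennreal ((Yn n t \<omega> - Yn (n + m) t \<omega>)\<^sup>2) \<le> ennreal ((p n m \<omega>)\<^sup>2)"
          by (intro ennreal_leI) simp
        also have "\<dots> \<le> k n \<omega>" unfolding k_def by (rule SUP_upper) simp
        finally show ?thesis .
      qed
      then show "ennreal ((Yn n t \<omega> - Y t \<omega>)\<^sup>2) \<le> k n \<omega>"
        by (intro LIMSEQ_le_const2[OF lim]) auto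
    qed
  qed
  show ?thesis using k k_lim k_bound by (intro exI[of _ k]) simp
qed

lemma barrier_uniform_limit: "AE \<omega> in M. uniform_limit {0..T} (\<lambda>n t. \<xi>n n t \<omega>) (\<lambda>t. \<xi> t \<omega>) sequentially"
  using barrier_bound uniform_limit_AE[OF \<xi>n_mono \<xi>n_lim] by blast

lemma solution_uniform_limit: "AE \<omega> in M. uniform_limit {0..T} (\<lambda>n t. Yn n t \<omega>) (\<lambda>t. Y t \<omega>) sequentially"
  using solution_bound uniform_limit_AE[OF Yn_mono Yn_lim] by blast


subsection \<open>Path regularity of the limit\<close>

lemma right_limit: "AE \<omega> in M. \<forall>t\<in>{0..<T}. ((\<lambda>u. Y u \<omega>) \<longlongrightarrow> Y t \<omega>) (at_right t)"
  using solution_uniform_limit AE_space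
proof eventually_elim
  case (elim \<omega>)
  show ?case
  proof
    fix t assume t: "t \<in> {0..<T}"
    show "((\<lambda>u. Y u \<omega>) \<longlongrightarrow> Y t \<omega>) (at_right t)"
      by (rule tendsto_at_right_uniform_limit[OF _ elim(1)])
         (use square_rcllD(2)[OF Yn_square] elim(2) t in \<open>auto simp: rcll_process_def\<close>)
  qed
qed

lemma left_limit:
  assumes qlc: "quasi_left_continuous M F" and \<tau>: "\<tau> \<in> predictable_times0 M F T"
  shows "AE \<omega> in M. 0 < \<tau> \<omega> \<longrightarrow> (\<exists>y. ((\<lambda>u. Y u \<omega>) \<longlongrightarrow> y) (at_left (\<tau> \<omega>)) \<and>
    ereal y = max (Limsup (at_left (\<tau> \<omega>)) (\<lambda>u. ereal (\<xi> u \<omega>))) (ereal (Y (\<tau> \<omega>) \<omega>)))"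
proof -
  have bounds: "AE \<omega> in M. \<tau> \<omega> \<le> T"
    using \<tau> by (auto simp: predictable_times0_def stopping_times_def elim: eventually_mono)
  have "AE \<omega> in M. \<forall>n. 0 < \<tau> \<omega> \<longrightarrow> Lim (at_left (\<tau> \<omega>)) (\<lambda>t. Yn n t \<omega>)
      = max (Lim (at_left (\<tau> \<omega>)) (\<lambda>t. \<xi>n n t \<omega>)) (Yn n (\<tau> \<omega>) \<omega>)"
    unfolding AE_all_countable using reflected.left_limit_at_predictable_time[OF solutions qlc \<tau>] by blast
  then show ?thesis
    using bounds barrier_uniform_limit solution_uniform_limit Yn_lim AE_space
  proof eventually_elim
    case (elim \<omega>)
    show ?case
    proof
      assume pos: "0 < \<tau> \<omega>"
      let ?L = "at_left (\<tau> \<omega>)"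
      have rcll: "rcll_on T (\<lambda>t. Yn n t \<omega>)" "rcll_on T (\<lambda>t. \<xi>n n t \<omega>)" for n
        using square_rcllD(2)[OF Yn_square] square_rcllD(2)[OF \<xi>n_square] elim(6)
        by (auto simp: rcll_process_def)
      obtain y where y: "(\<lambda>n. Lim ?L (\<lambda>t. Yn n t \<omega>)) \<longlonglongrightarrow> y" "((\<lambda>u. Y u \<omega>) \<longlongrightarrow> y) ?L"
        using tendsto_at_left_uniform_limit[OF rcll(1) elim(4) pos elim(2)] by blast
      obtain x where x: "(\<lambda>n. Lim ?L (\<lambda>t. \<xi>n n t \<omega>)) \<longlonglongrightarrow> x" "((\<lambda>u. \<xi> u \<omega>) \<longlongrightarrow> x) ?L"
        using tendsto_at_left_uniform_limit[OF rcll(2) elim(3) pos elim(2)] by blast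
      have "(\<lambda>n. Yn n (\<tau> \<omega>) \<omega>) \<longlonglongrightarrow> Y (\<tau> \<omega>) \<omega>" using elim(5) pos elim(2) by auto
      then have "(\<lambda>n. Lim ?L (\<lambda>t. Yn n t \<omega>)) \<longlonglongrightarrow> max x (Y (\<tau> \<omega>) \<omega>)"
        using tendsto_max[OF x(1)] elim(1) pos by simp
      then have y_eq: "y = max x (Y (\<tau> \<omega>) \<omega>)" using y(1) LIMSEQ_unique by blast
      have "((\<lambda>u. ereal (\<xi> u \<omega>)) \<longlongrightarrow> ereal x) ?L" using x(2) by (rule tendsto_ereal)
      then have "Limsup ?L (\<lambda>u. ereal (\<xi> u \<omega>)) = ereal x"
        by (intro lim_imp_Limsup) (simp add: trivial_limit_at_left_real)
      then show "\<exists>y. ((\<lambda>u. Y u \<omega>) \<longlongrightarrow> y) ?L \<and>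
          ereal y = max (Limsup ?L (\<lambda>u. ereal (\<xi> u \<omega>))) (ereal (Y (\<tau> \<omega>) \<omega>))"
        using y(2) y_eq by (intro exI[of _ y]) (simp add: max_def)
    qed
  qed
qed

lemma S2_convergence: "(\<lambda>n. S2_norm_sq M F T (\<lambda>t \<omega>. Yn n t \<omega> - Y t \<omega>)) \<longlonglongrightarrow> 0"
proof -
  obtain k :: "nat \<Rightarrow> 'a \<Rightarrow> ennreal" where k: "\<And>n. k n \<in> borel_measurable M"
    "(\<lambda>n. \<integral>\<^sup>+\<omega>. k n \<omega> \<partial>M) \<longlonglongrightarrow> 0"
    "\<And>n. AE \<omega> in M. \<forall>t\<in>{0..T}. ennreal ((Yn n t \<omega> - Y t \<omega>)\<^sup>2) \<le> k n \<omega>"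
    using solution_bound by blast
  have "S2_norm_sq M F T (\<lambda>t \<omega>. Yn n t \<omega> - Y t \<omega>) \<le> (\<integral>\<^sup>+\<omega>. k n \<omega> \<partial>M)" for n
    by (rule S2_norm_sq_le[OF k(1,3)])
  then show ?thesis
    by (intro tendsto_sandwich[OF always_eventually always_eventually tendsto_const k(2)]) auto
qed

lemma Y_in_S2: "in_S2 M F T Y"
proof -
  obtain k :: "nat \<Rightarrow> 'a \<Rightarrow> ennreal" where k: "\<And>n. k n \<in> borel_measurable M"
    "(\<lambda>n. \<integral>\<^sup>+\<omega>. k n \<omega> \<partial>M) \<longlonglongrightarrow> 0"
    "\<And>n. AE \<omega> in M. \<forall>t\<in>{0..T}. ennreal ((Yn n t \<omega> - Y t \<omega>)\<^sup>2) \<le> k n \<omega>"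
    using solution_bound by blast
  note [measurable] = k(1)
  have "optional_process M F T (Yn n)" for n
    using square_rcllD(1,2)[OF Yn_square] by (intro rcll_adapted_optional)
  then have "(\<lambda>x. lim (\<lambda>n. Yn n (fst x) (snd x))) \<in> borel_measurable (optional_sigma M F T)"
    unfolding optional_process_def by (intro borel_measurable_lim_metric) (simp add: case_prod_beta')
  then have "optional_process M F T Y"
    by (simp add: optional_process_def Y_def case_prod_beta')
  moreover have "S2_norm_sq M F T Y < \<infinity>"
  proof -
    obtain n where n: "(\<integral>\<^sup>+\<omega>. k n \<omega> \<partial>M) < 1"
      using eventually_happens'[OF sequentially_bot order_tendstoD(2)[OF k(2), of 1]] by auto
    let ?p = "\<lambda>\<omega>. path_sup T (\<lambda>t. Yn n t \<omega>)"
    have [measurable]: "?p \<in> borel_measurable M" by (rule square_rcllD(5)[OF Yn_square])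
    have "S2_norm_sq M F T Y \<le> (\<integral>\<^sup>+\<omega>. 2 * ennreal ((?p \<omega>)\<^sup>2) + 2 * k n \<omega> \<partial>M)"
    proof (rule S2_norm_sq_le)
      show "AE \<omega> in M. \<forall>t\<in>{0..T}. ennreal ((Y t \<omega>)\<^sup>2) \<le> 2 * ennreal ((?p \<omega>)\<^sup>2) + 2 * k n \<omega>"
        using k(3)[of n] AE_space
      proof eventually_elim
        case (elim \<omega>)
        show ?case
        proof
          fix t assume t: "t \<in> {0..T}"
          let ?a = "Yn n t \<omega>" and ?b = "Yn n t \<omega> - Y t \<omega>"
          have "0 \<le> (?a + ?b)\<^sup>2" by simp
          then have "(Y t \<omega>)\<^sup>2 \<le> 2 * ?a\<^sup>2 + 2 * ?b\<^sup>2"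
            by (simp add: power2_eq_square algebra_simps)
          then have "ennreal ((Y t \<omega>)\<^sup>2) \<le> ennreal (2 * ?a\<^sup>2 + 2 * ?b\<^sup>2)" by (rule ennreal_leI)
          also have "\<dots> = 2 * ennreal (?a\<^sup>2) + 2 * ennreal (?b\<^sup>2)"
            by (simp add: ennreal_plus ennreal_mult)
          also have "\<dots> \<le> 2 * ennreal ((?p \<omega>)\<^sup>2) + 2 * k n \<omega>"
          proof (intro add_mono mult_left_mono)
            have "\<bar>?a\<bar>\<^sup>2 \<le> (?p \<omega>)\<^sup>2"
              using square_rcllD(6)[OF Yn_square elim(2) t, of n] by (intro power_mono) auto
            then show "ennreal (?a\<^sup>2) \<le> ennreal ((?p \<omega>)\<^sup>2)" by (intro ennreal_leI) simp
            show "ennreal (?b\<^sup>2) \<le> k n \<omega>" using elim(1) t by blast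
          qed auto
          finally show "ennreal ((Y t \<omega>)\<^sup>2) \<le> 2 * ennreal ((?p \<omega>)\<^sup>2) + 2 * k n \<omega>" .
        qed
      qed
    qed measurable
    also have "\<dots> = 2 * (\<integral>\<^sup>+\<omega>. ennreal ((?p \<omega>)\<^sup>2) \<partial>M) + 2 * (\<integral>\<^sup>+\<omega>. k n \<omega> \<partial>M)"
      by (simp add: nn_integral_add nn_integral_cmult)
    also have "\<dots> < \<infinity>"
    proof -
      have "(\<integral>\<^sup>+\<omega>. ennreal ((?p \<omega>)\<^sup>2) \<partial>M) = ennreal (\<integral>\<omega>. (?p \<omega>)\<^sup>2 \<partial>M)"
        using square_rcllD(3)[OF Yn_square] by (intro nn_integral_eq_integral) auto
      moreover have "(\<integral>\<^sup>+\<omega>. k n \<omega> \<partial>M) < \<top>" using n less_trans[OF n] by simp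
      ultimately show ?thesis by (simp add: ennreal_mult_less_top)
    qed
    finally show ?thesis .
  qed
  ultimately show ?thesis by (simp add: in_S2_def)
qed


subsection \<open>The limit as value of the optimal stopping problem\<close>

lemma stopped_approximation:
  assumes S: "bounded_time S" and lim: "AE \<omega> in M. \<forall>t\<in>{0..T}. (\<lambda>n. f n t \<omega>) \<longlonglongrightarrow> h t \<omega>"
    and f: "\<And>n. square_rcll (f n)" and b: "(\<lambda>n. \<integral>\<^sup>+\<omega>. b n \<omega> \<partial>M) \<longlonglongrightarrow> 0"
    and le: "\<And>n. AE \<omega> in M. \<forall>t\<in>{0..T}. ennreal ((f n t \<omega> - h t \<omega>)\<^sup>2) \<le> b n \<omega>"
  shows "integrable M (\<lambda>\<omega>. h (S \<omega>) \<omega>)"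
    and "0 < \<epsilon> \<Longrightarrow> \<exists>n. \<forall>B\<in>sets M. \<bar>\<integral>\<omega>. indicator B \<omega> * (f n (S \<omega>) \<omega> - h (S \<omega>) \<omega>) \<partial>M\<bar> \<le> \<epsilon>"
proof -
  have f_int: "integrable M (\<lambda>\<omega>. f n (S \<omega>) \<omega>)" for n by (rule square_rcll_stopped[OF f S])
  have [measurable]: "(\<lambda>\<omega>. h (S \<omega>) \<omega>) \<in> borel_measurable M"
  proof (rule measurable_M_cong_AE)
    show "(\<lambda>\<omega>. lim (\<lambda>n. f n (S \<omega>) \<omega>)) \<in> borel_measurable M"
      using f_int by (intro borel_measurable_lim_metric) auto
    show "AE \<omega> in M. lim (\<lambda>n. f n (S \<omega>) \<omega>) = h (S \<omega>) \<omega>"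
      using lim by eventually_elim (use bounded_timeD(4)[OF S] in \<open>auto intro: limI\<close>)
  qed
  have meas: "(\<lambda>\<omega>. f n (S \<omega>) \<omega> - h (S \<omega>) \<omega>) \<in> borel_measurable M" for n
    using f_int[of n] by (intro borel_measurable_diff) auto
  have near: "\<exists>n. (\<integral>\<^sup>+\<omega>. ennreal ((f n (S \<omega>) \<omega> - h (S \<omega>) \<omega>)\<^sup>2) \<partial>M) \<le> ennreal (\<epsilon>\<^sup>2)" if \<epsilon>: "0 < \<epsilon>" for \<epsilon>
  proof -
    have "\<forall>\<^sub>F n in sequentially. (\<integral>\<^sup>+\<omega>. b n \<omega> \<partial>M) < ennreal (\<epsilon>\<^sup>2)"
      using \<epsilon> by (intro order_tendstoD(2)[OF b]) simp
    then obtain n where n: "(\<integral>\<^sup>+\<omega>. b n \<omega> \<partial>M) < ennreal (\<epsilon>\<^sup>2)"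
      using eventually_happens'[OF sequentially_bot] by blast
    have "(\<integral>\<^sup>+\<omega>. ennreal ((f n (S \<omega>) \<omega> - h (S \<omega>) \<omega>)\<^sup>2) \<partial>M) \<le> (\<integral>\<^sup>+\<omega>. b n \<omega> \<partial>M)"
    proof (rule nn_integral_mono_AE)
      show "AE \<omega> in M. ennreal ((f n (S \<omega>) \<omega> - h (S \<omega>) \<omega>)\<^sup>2) \<le> b n \<omega>"
        using le[of n] by eventually_elim (use bounded_timeD(4)[OF S] in blast)
    qed
    then show ?thesis using n by (intro exI[of _ n]) simp
  qed
  obtain n where "(\<integral>\<^sup>+\<omega>. ennreal ((f n (S \<omega>) \<omega> - h (S \<omega>) \<omega>)\<^sup>2) \<partial>M) \<le> ennreal (1\<^sup>2)"
    using near[of 1] by auto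
  then have diff: "integrable M (\<lambda>\<omega>. f n (S \<omega>) \<omega> - h (S \<omega>) \<omega>)"
    by (rule small_L2(1)[OF meas]) simp
  have "integrable M (\<lambda>\<omega>. f n (S \<omega>) \<omega> - (f n (S \<omega>) \<omega> - h (S \<omega>) \<omega>))"
    by (rule Bochner_Integration.integrable_diff[OF f_int diff])
  then show "integrable M (\<lambda>\<omega>. h (S \<omega>) \<omega>)" by (simp only: diff_diff_eq2 add_diff_cancel_left')
  assume \<epsilon>: "0 < \<epsilon>"
  then show "\<exists>n. \<forall>B\<in>sets M. \<bar>\<integral>\<omega>. indicator B \<omega> * (f n (S \<omega>) \<omega> - h (S \<omega>) \<omega>) \<partial>M\<bar> \<le> \<epsilon>"
    using near[OF \<epsilon>] small_L2(2)[OF meas] by (meson less_imp_le)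
qed

lemma Y_stopped:
  assumes "bounded_time S"
  shows "integrable M (\<lambda>\<omega>. Y (S \<omega>) \<omega>)"
    and "0 < \<epsilon> \<Longrightarrow> \<exists>n. \<forall>B\<in>sets M. \<bar>\<integral>\<omega>. indicator B \<omega> * (Yn n (S \<omega>) \<omega> - Y (S \<omega>) \<omega>) \<partial>M\<bar> \<le> \<epsilon>"
proof -
  obtain k :: "nat \<Rightarrow> 'a \<Rightarrow> ennreal" where k: "\<And>n. k n \<in> borel_measurable M"
    "(\<lambda>n. \<integral>\<^sup>+\<omega>. k n \<omega> \<partial>M) \<longlonglongrightarrow> 0"
    "\<And>n. AE \<omega> in M. \<forall>t\<in>{0..T}. ennreal ((Yn n t \<omega> - Y t \<omega>)\<^sup>2) \<le> k n \<omega>"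
    using solution_bound by blast
  note approx = stopped_approximation[OF assms Yn_lim Yn_square k(2,3)]
  show "integrable M (\<lambda>\<omega>. Y (S \<omega>) \<omega>)" by (rule approx(1))
  show "0 < \<epsilon> \<Longrightarrow> \<exists>n. \<forall>B\<in>sets M. \<bar>\<integral>\<omega>. indicator B \<omega> * (Yn n (S \<omega>) \<omega> - Y (S \<omega>) \<omega>) \<partial>M\<bar> \<le> \<epsilon>"
    by (rule approx(2))
qed

lemma \<xi>_stopped:
  assumes "bounded_time S"
  shows "integrable M (\<lambda>\<omega>. \<xi> (S \<omega>) \<omega>)"
proof -
  obtain d :: "nat \<Rightarrow> 'a \<Rightarrow> ennreal" where d: "(\<lambda>n. \<integral>\<^sup>+\<omega>. d n \<omega> \<partial>M) \<longlonglongrightarrow> 0"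
    "\<And>n. AE \<omega> in M. \<forall>t\<in>{0..T}. ennreal ((\<xi>n n t \<omega> - \<xi> t \<omega>)\<^sup>2) \<le> d n \<omega>"
    using barrier_bound by blast
  show ?thesis by (rule stopped_approximation(1)[OF assms \<xi>n_lim \<xi>n_square d])
qed

lemma Y_measurable:
  assumes S: "bounded_time S"
  shows "(\<lambda>\<omega>. Y (S \<omega>) \<omega>) \<in> borel_measurable (sigma_at M F S)"
  unfolding Y_def
  by (intro borel_measurable_lim_metric stopped_measurable square_rcllD(1,2)[OF Yn_square] S)

lemma stopping_le_Y:
  assumes S: "bounded_time S" and \<tau>: "bounded_time \<tau>" and le: "\<And>\<omega>. S \<omega> \<le> \<tau> \<omega>"
    and B: "B \<in> sets (sigma_at M F S)"
  shows "(\<integral>\<omega>. indicator B \<omega> * (\<xi> (\<tau> \<omega>) \<omega> + G (\<tau> \<omega>) \<omega>) \<partial>M)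
    \<le> (\<integral>\<omega>. indicator B \<omega> * (Y (S \<omega>) \<omega> + G (S \<omega>) \<omega>) \<partial>M)"
proof (rule field_le_epsilon)
  fix \<epsilon> :: real assume "0 < \<epsilon>"
  then obtain n where n: "\<forall>B\<in>sets M. \<bar>\<integral>\<omega>. indicator B \<omega> * (Yn n (S \<omega>) \<omega> - Y (S \<omega>) \<omega>) \<partial>M\<bar> \<le> \<epsilon>"
    using Y_stopped(2)[OF S] by blast
  interpret r: reflected M F T G R "\<xi>n n" "Yn n" "An n" by (rule solutions)
  have BM: "B \<in> sets M"
    using B subalgebra_sigma_at[OF bounded_timeD(1)[OF S]] by (auto simp: subalgebra_def)
  note [simp] = r.Y_stopped[OF S] r.Y_stopped[OF \<tau>] Y_stopped(1)[OF S] \<xi>_stopped[OF \<tau>]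
    G_stopped[OF S] G_stopped[OF \<tau>]
  have "(\<integral>\<omega>. indicator B \<omega> * (\<xi> (\<tau> \<omega>) \<omega> + G (\<tau> \<omega>) \<omega>) \<partial>M)
      \<le> (\<integral>\<omega>. indicator B \<omega> * (Yn n (\<tau> \<omega>) \<omega> + G (\<tau> \<omega>) \<omega>) \<partial>M)"
  proof (rule indicator_integral_mono[OF BM])
    show "AE \<omega> in M. \<omega> \<in> B \<longrightarrow> \<xi> (\<tau> \<omega>) \<omega> + G (\<tau> \<omega>) \<omega> \<le> Yn n (\<tau> \<omega>) \<omega> + G (\<tau> \<omega>) \<omega>"
      using \<xi>_le_\<xi>n \<xi>n_le_Yn
    proof eventually_elim
      case (elim \<omega>)
      have "\<xi> (\<tau> \<omega>) \<omega> \<le> \<xi>n n (\<tau> \<omega>) \<omega>" "\<xi>n n (\<tau> \<omega>) \<omega> \<le> Yn n (\<tau> \<omega>) \<omega>"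
        using elim bounded_timeD(4)[OF \<tau>] by blast+
      then show ?case by simp
    qed
  qed auto
  also have "\<dots> \<le> (\<integral>\<omega>. indicator B \<omega> * (Yn n (S \<omega>) \<omega> + G (S \<omega>) \<omega>) \<partial>M)"
    by (rule r.supermartingale[OF S \<tau> le B])
  also have "\<dots> = (\<integral>\<omega>. indicator B \<omega> * (Y (S \<omega>) \<omega> + G (S \<omega>) \<omega>) \<partial>M)
      + (\<integral>\<omega>. indicator B \<omega> * (Yn n (S \<omega>) \<omega> - Y (S \<omega>) \<omega>) \<partial>M)"
    using BM by (simp add: indicator_integral_add indicator_integral_diff)
  also have "\<dots> \<le> (\<integral>\<omega>. indicator B \<omega> * (Y (S \<omega>) \<omega> + G (S \<omega>) \<omega>) \<partial>M) + \<epsilon>"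
    using n BM by (intro add_left_mono) (auto dest!: bspec[OF _ BM])
  finally show "(\<integral>\<omega>. indicator B \<omega> * (\<xi> (\<tau> \<omega>) \<omega> + G (\<tau> \<omega>) \<omega>) \<partial>M) \<le> \<dots>" .
qed

text \<open>
  A time that is almost optimal for the barrier \<open>\<xi>n n\<close> with large \<open>n\<close> is almost optimal for \<open>\<xi>\<close>,
  because the barriers converge in mean square uniformly over all stopping times.
\<close>

lemma Y_le_stopping:
  assumes S: "bounded_time S" and \<delta>: "0 < \<delta>"
  shows "\<exists>\<tau>. bounded_time \<tau> \<and> (\<forall>\<omega>. S \<omega> \<le> \<tau> \<omega>) \<and>
    (\<integral>\<omega>. Y (S \<omega>) \<omega> + G (S \<omega>) \<omega> \<partial>M) \<le> (\<integral>\<omega>. \<xi> (\<tau> \<omega>) \<omega> + G (\<tau> \<omega>) \<omega> \<partial>M) + \<delta>"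
proof -
  obtain d :: "nat \<Rightarrow> 'a \<Rightarrow> ennreal" where d: "\<And>n. d n \<in> borel_measurable M"
    "(\<lambda>n. \<integral>\<^sup>+\<omega>. d n \<omega> \<partial>M) \<longlonglongrightarrow> 0"
    "\<And>n. AE \<omega> in M. \<forall>t\<in>{0..T}. ennreal ((\<xi>n n t \<omega> - \<xi> t \<omega>)\<^sup>2) \<le> d n \<omega>"
    using barrier_bound by blast
  have "\<forall>\<^sub>F n in sequentially. (\<integral>\<^sup>+\<omega>. d n \<omega> \<partial>M) < ennreal ((\<delta> / 2)\<^sup>2)"
    using \<delta> by (intro order_tendstoD(2)[OF d(2)]) simp
  then obtain n where n: "(\<integral>\<^sup>+\<omega>. d n \<omega> \<partial>M) < ennreal ((\<delta> / 2)\<^sup>2)"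
    using eventually_happens'[OF sequentially_bot] by blast
  interpret r: reflected M F T G R "\<xi>n n" "Yn n" "An n" by (rule solutions)
  have \<delta>2: "0 < \<delta> / 2" using \<delta> by simp
  obtain \<tau> where \<tau>: "bounded_time \<tau>" "\<And>\<omega>. S \<omega> \<le> \<tau> \<omega>" "AE \<omega> in M. Yn n (\<tau> \<omega>) \<omega> \<le> \<xi>n n (\<tau> \<omega>) \<omega> + \<delta> / 2"
    "\<And>B. B \<in> sets (sigma_at M F S) \<Longrightarrow> (\<integral>\<omega>. indicator B \<omega> * (Yn n (S \<omega>) \<omega> + G (S \<omega>) \<omega>) \<partial>M)
      = (\<integral>\<omega>. indicator B \<omega> * (Yn n (\<tau> \<omega>) \<omega> + G (\<tau> \<omega>) \<omega>) \<partial>M)"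
    using r.almost_optimal_time[OF S \<delta>2] by blast
  have \<xi>n_int: "integrable M (\<lambda>\<omega>. \<xi>n n (\<tau> \<omega>) \<omega>)" by (rule square_rcll_stopped[OF \<xi>n_square \<tau>(1)])
  note [simp] = r.Y_stopped[OF S] r.Y_stopped[OF \<tau>(1)] Y_stopped(1)[OF S] \<xi>_stopped[OF \<tau>(1)]
    G_stopped[OF S] G_stopped[OF \<tau>(1)] \<xi>n_int
  have space_sum: "(\<integral>\<omega>. indicator (space M) \<omega> * f \<omega> \<partial>M) = (\<integral>\<omega>. f \<omega> \<partial>M)" for f :: "'a \<Rightarrow> real"
    by (intro Bochner_Integration.integral_cong) auto
  have gap: "(\<integral>\<omega>. \<xi>n n (\<tau> \<omega>) \<omega> - \<xi> (\<tau> \<omega>) \<omega> \<partial>M) \<le> \<delta> / 2"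
  proof -
    have "(\<integral>\<^sup>+\<omega>. ennreal ((\<xi>n n (\<tau> \<omega>) \<omega> - \<xi> (\<tau> \<omega>) \<omega>)\<^sup>2) \<partial>M) \<le> (\<integral>\<^sup>+\<omega>. d n \<omega> \<partial>M)"
    proof (rule nn_integral_mono_AE)
      show "AE \<omega> in M. ennreal ((\<xi>n n (\<tau> \<omega>) \<omega> - \<xi> (\<tau> \<omega>) \<omega>)\<^sup>2) \<le> d n \<omega>"
        using d(3)[of n] by eventually_elim (use bounded_timeD(4)[OF \<tau>(1)] in blast)
    qed
    then have "(\<integral>\<^sup>+\<omega>. ennreal ((\<xi>n n (\<tau> \<omega>) \<omega> - \<xi> (\<tau> \<omega>) \<omega>)\<^sup>2) \<partial>M) \<le> ennreal ((\<delta> / 2)\<^sup>2)"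
      using n by simp
    moreover have "(\<lambda>\<omega>. \<xi>n n (\<tau> \<omega>) \<omega> - \<xi> (\<tau> \<omega>) \<omega>) \<in> borel_measurable M"
      by (rule borel_measurable_integrable) simp
    ultimately have
      "\<bar>\<integral>\<omega>. indicator (space M) \<omega> * (\<xi>n n (\<tau> \<omega>) \<omega> - \<xi> (\<tau> \<omega>) \<omega>) \<partial>M\<bar> \<le> \<delta> / 2"
      using \<delta> by (intro small_L2(2)) auto
    then show ?thesis unfolding space_sum by linarith
  qed
  have "(\<integral>\<omega>. Y (S \<omega>) \<omega> + G (S \<omega>) \<omega> \<partial>M) \<le> (\<integral>\<omega>. Yn n (S \<omega>) \<omega> + G (S \<omega>) \<omega> \<partial>M)"
  proof (rule integral_mono_AE)
    show "AE \<omega> in M. Y (S \<omega>) \<omega> + G (S \<omega>) \<omega> \<le> Yn n (S \<omega>) \<omega> + G (S \<omega>) \<omega>"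
      using Y_le_Yn by eventually_elim (use bounded_timeD(4)[OF S] in simp)
  qed auto
  also have "\<dots> = (\<integral>\<omega>. Yn n (\<tau> \<omega>) \<omega> + G (\<tau> \<omega>) \<omega> \<partial>M)"
    using \<tau>(4)[of "space M"] sets.top[of "sigma_at M F S"] by (simp add: space_sum space_sigma_at)
  also have "\<dots> \<le> (\<integral>\<omega>. (\<xi> (\<tau> \<omega>) \<omega> + G (\<tau> \<omega>) \<omega>) + ((\<xi>n n (\<tau> \<omega>) \<omega> - \<xi> (\<tau> \<omega>) \<omega>) + \<delta> / 2) \<partial>M)"
    using \<tau>(3) by (intro integral_mono_AE) auto
  also have "\<dots> = (\<integral>\<omega>. \<xi> (\<tau> \<omega>) \<omega> + G (\<tau> \<omega>) \<omega> \<partial>M) + ((\<integral>\<omega>. \<xi>n n (\<tau> \<omega>) \<omega> - \<xi> (\<tau> \<omega>) \<omega> \<partial>M) + \<delta> / 2)"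
    by (subst Bochner_Integration.integral_add) (auto simp: prob_space)
  also have "\<dots> \<le> (\<integral>\<omega>. \<xi> (\<tau> \<omega>) \<omega> + G (\<tau> \<omega>) \<omega> \<partial>M) + \<delta>" using gap by simp
  finally show ?thesis using \<tau>(1,2) by (intro exI[of _ \<tau>]) simp
qed

text \<open>
  The conditional expectations of the payoffs are at most \<open>Y\<close> at \<open>S0\<close>. Those of almost optimal
  times are close to it in mean, so the infimum of their distances from it is 0 almost surely, and no
  smaller random variable bounds them all.
\<close>

theorem optimal_stopping_value:
  assumes g: "AE \<omega> in M. \<forall>s t. 0 \<le> s \<and> s \<le> t \<and> t \<le> T \<longrightarrow> (LINT u:{s..t}|lborel. g u \<omega>) = G t \<omega> - G s \<omega>"
    and S0: "S0 \<in> stopping_times0 M F T"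
  shows "AE \<omega> in M. ereal (Y (S0 \<omega>) \<omega>) = ess_sup M (stopping_times M F T S0)
    (\<lambda>\<tau> \<omega>. ereal (real_cond_exp M (sigma_at M F S0)
       (\<lambda>\<omega>. \<xi> (\<tau> \<omega>) \<omega> + (LINT u:{S0 \<omega>..\<tau> \<omega>}|lborel. g u \<omega>)) \<omega>)) \<omega>"
proof -
  let ?H = "sigma_at M F S0"
  have S0_st: "stopping_time F S0" using S0 by (simp add: stopping_times_def)
  define S where "S = clamp S0"
  have S: "bounded_time S" unfolding S_def by (rule bounded_time_clamp[OF S0_st])
  have S_eq: "AE \<omega> in M. S \<omega> = S0 \<omega>" unfolding S_def by (rule clamp_AE[OF S0])
  have sets_H: "sets ?H = sets (sigma_at M F S)"
    by (rule sigma_at_cong_AE[OF bounded_timeD(1)[OF S] S0_st S_eq, symmetric])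
  interpret H: finite_measure_subalgebra M ?H
    by unfold_locales (rule subalgebra_sigma_at[OF S0_st])
  have Y_meas: "(\<lambda>\<omega>. Y (S \<omega>) \<omega>) \<in> borel_measurable ?H"
    using Y_measurable[OF S] by (simp add: measurable_cong_sets[OF sets_H refl])
  have Y_int: "integrable M (\<lambda>\<omega>. Y (S \<omega>) \<omega>)" by (rule Y_stopped(1)[OF S])
  define payoff where "payoff \<tau> \<omega> = \<xi> (\<tau> \<omega>) \<omega> + (LINT u:{S0 \<omega>..\<tau> \<omega>}|lborel. g u \<omega>)" for \<tau> \<omega>
  let ?C = "\<lambda>\<tau>. real_cond_exp M ?H (payoff \<tau>)"
  define h where "h = ess_sup M (stopping_times M F T S0) (\<lambda>\<tau> \<omega>. ereal (?C \<tau> \<omega>))"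
  have sup: "is_ess_sup M (stopping_times M F T S0) (\<lambda>\<tau> \<omega>. ereal (?C \<tau> \<omega>)) h"
    unfolding h_def by (rule is_ess_sup_ess_sup[OF prob_space_axioms])
  have payoff_eq: "AE \<omega> in M. \<xi> (\<tau>' \<omega>) \<omega> + G (\<tau>' \<omega>) \<omega> - G (S \<omega>) \<omega> = payoff \<tau> \<omega>"
    if \<tau>': "bounded_time \<tau>'" "\<And>\<omega>. S \<omega> \<le> \<tau>' \<omega>" "AE \<omega> in M. \<tau>' \<omega> = \<tau> \<omega>" for \<tau> \<tau>'
    using g S_eq \<tau>'(3)
  proof eventually_elim
    case (elim \<omega>)
    have "0 \<le> S \<omega> \<and> S \<omega> \<le> \<tau>' \<omega> \<and> \<tau>' \<omega> \<le> T"
      using bounded_timeD(2)[OF S] bounded_timeD(3)[OF \<tau>'(1)] \<tau>'(2) by blast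
    then show ?case using elim by (simp add: payoff_def)
  qed
  have payoff_int: "integrable M (payoff \<tau>)"
    if \<tau>': "bounded_time \<tau>'" "\<And>\<omega>. S \<omega> \<le> \<tau>' \<omega>" "AE \<omega> in M. \<tau>' \<omega> = \<tau> \<omega>" for \<tau> \<tau>'
  proof -
    have int: "integrable M (\<lambda>\<omega>. \<xi> (\<tau>' \<omega>) \<omega> + G (\<tau>' \<omega>) \<omega> - G (S \<omega>) \<omega>)"
      by (intro Bochner_Integration.integrable_diff Bochner_Integration.integrable_add
          \<xi>_stopped G_stopped S \<tau>'(1))
    moreover have "payoff \<tau> \<in> borel_measurable M"
      by (rule measurable_M_cong_AE[OF _ payoff_eq[OF \<tau>']]) (use int in blast)
    ultimately show ?thesis using payoff_eq[OF \<tau>'] by (rule integrable_cong_AE_imp)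
  qed
  have C_le: "AE \<omega> in M. ?C \<tau> \<omega> \<le> Y (S \<omega>) \<omega>"
    if \<tau>': "bounded_time \<tau>'" "\<And>\<omega>. S \<omega> \<le> \<tau>' \<omega>" "AE \<omega> in M. \<tau>' \<omega> = \<tau> \<omega>" for \<tau> \<tau>'
  proof (rule H.real_cond_exp_le[OF Y_int Y_meas payoff_int[OF \<tau>']])
    fix B assume "B \<in> sets ?H"
    then have B: "B \<in> sets (sigma_at M F S)" by (simp add: sets_H)
    then have BM: "B \<in> sets M"
      using subalgebra_sigma_at[OF bounded_timeD(1)[OF S]] by (auto simp: subalgebra_def)
    have int: "integrable M (\<lambda>\<omega>. \<xi> (\<tau>' \<omega>) \<omega> + G (\<tau>' \<omega>) \<omega>)"
      by (intro Bochner_Integration.integrable_add \<xi>_stopped G_stopped \<tau>'(1))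
    have "(\<integral>\<omega>. indicator B \<omega> * payoff \<tau> \<omega> \<partial>M)
        \<le> (\<integral>\<omega>. indicator B \<omega> * (\<xi> (\<tau>' \<omega>) \<omega> + G (\<tau>' \<omega>) \<omega> - G (S \<omega>) \<omega>) \<partial>M)"
    proof (rule indicator_integral_mono[OF BM payoff_int[OF \<tau>']])
      show "integrable M (\<lambda>\<omega>. \<xi> (\<tau>' \<omega>) \<omega> + G (\<tau>' \<omega>) \<omega> - G (S \<omega>) \<omega>)"
        by (intro Bochner_Integration.integrable_diff int G_stopped S)
      show "AE \<omega> in M. \<omega> \<in> B \<longrightarrow> payoff \<tau> \<omega> \<le> \<xi> (\<tau>' \<omega>) \<omega> + G (\<tau>' \<omega>) \<omega> - G (S \<omega>) \<omega>"
        using payoff_eq[OF \<tau>'] by eventually_elim simp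
    qed
    also have "\<dots> \<le> (\<integral>\<omega>. indicator B \<omega> * Y (S \<omega>) \<omega> \<partial>M)"
      using stopping_le_Y[OF S \<tau>'(1,2) B] indicator_integral_diff[OF BM int G_stopped[OF S]]
        indicator_integral_add[OF BM Y_int G_stopped[OF S]] by simp
    finally show "(\<integral>\<omega>. indicator B \<omega> * payoff \<tau> \<omega> \<partial>M) \<le> (\<integral>\<omega>. indicator B \<omega> * Y (S \<omega>) \<omega> \<partial>M)" .
  qed
  have "AE \<omega> in M. h \<omega> \<le> ereal (Y (S \<omega>) \<omega>)"
  proof -
    have "AE \<omega> in M. ereal (?C \<tau> \<omega>) \<le> ereal (Y (S \<omega>) \<omega>)" if \<tau>: "\<tau> \<in> stopping_times M F T S0" for \<tau>
    proof -
      define \<tau>' where "\<tau>' \<omega> = max (S \<omega>) (clamp \<tau> \<omega>)" for \<omega>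
      have \<tau>_st: "stopping_time F \<tau>" using \<tau> by (simp add: stopping_times_def)
      have "bounded_time \<tau>'" unfolding \<tau>'_def by (intro bounded_time_max S bounded_time_clamp \<tau>_st)
      moreover have "S \<omega> \<le> \<tau>' \<omega>" for \<omega> by (simp add: \<tau>'_def)
      moreover have "AE \<omega> in M. \<tau>' \<omega> = \<tau> \<omega>"
      proof -
        have "AE \<omega> in M. S0 \<omega> \<le> \<tau> \<omega> \<and> \<tau> \<omega> \<le> T" using \<tau> by (simp add: stopping_times_def)
        then show ?thesis
          using S_eq
        proof eventually_elim
          case (elim \<omega>)
          then show ?case
            using bounded_timeD(2)[OF S, of \<omega>] by (simp add: \<tau>'_def clamp_def max_def min_def)
        qed
      qed
      ultimately have "AE \<omega> in M. ?C \<tau> \<omega> \<le> Y (S \<omega>) \<omega>" by (rule C_le)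
      then show ?thesis by eventually_elim simp
    qed
    moreover have "(\<lambda>\<omega>. ereal (Y (S \<omega>) \<omega>)) \<in> borel_measurable M" using Y_int by simp
    ultimately show ?thesis by (intro is_ess_supD(3)[OF sup])
  qed
  moreover have "AE \<omega> in M. ereal (Y (S \<omega>) \<omega>) \<le> h \<omega>"
  proof -
    have "\<exists>\<tau>. bounded_time \<tau> \<and> (\<forall>\<omega>. S \<omega> \<le> \<tau> \<omega>) \<and>
        (\<integral>\<omega>. Y (S \<omega>) \<omega> + G (S \<omega>) \<omega> \<partial>M) \<le> (\<integral>\<omega>. \<xi> (\<tau> \<omega>) \<omega> + G (\<tau> \<omega>) \<omega> \<partial>M) + 1 / real (Suc j)" for j
      by (rule Y_le_stopping[OF S]) simp
    then have "\<exists>\<tau>. \<forall>j. bounded_time (\<tau> j) \<and> (\<forall>\<omega>. S \<omega> \<le> \<tau> j \<omega>) \<and>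
        (\<integral>\<omega>. Y (S \<omega>) \<omega> + G (S \<omega>) \<omega> \<partial>M) \<le> (\<integral>\<omega>. \<xi> (\<tau> j \<omega>) \<omega> + G (\<tau> j \<omega>) \<omega> \<partial>M) + 1 / real (Suc j)"
      by (intro choice allI)
    then obtain \<tau> where \<tau>: "\<And>j. bounded_time (\<tau> j)" "\<And>j \<omega>. S \<omega> \<le> \<tau> j \<omega>"
      "\<And>j. (\<integral>\<omega>. Y (S \<omega>) \<omega> + G (S \<omega>) \<omega> \<partial>M) \<le> (\<integral>\<omega>. \<xi> (\<tau> j \<omega>) \<omega> + G (\<tau> j \<omega>) \<omega> \<partial>M) + 1 / real (Suc j)"
      by blast
    note int = payoff_int[OF \<tau>(1,2) AE_I2[OF refl]] and le = C_le[OF \<tau>(1,2) AE_I2[OF refl]]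
      and eq = payoff_eq[OF \<tau>(1,2) AE_I2[OF refl]]
    have C_int: "integrable M (?C (\<tau> j))" for j by (rule H.real_cond_exp_int(1)[OF int])
    have small: "(\<integral>\<omega>. Y (S \<omega>) \<omega> - ?C (\<tau> j) \<omega> \<partial>M) \<le> 1 / real (Suc j)" for j
    proof -
      have "(\<integral>\<omega>. ?C (\<tau> j) \<omega> \<partial>M) = (\<integral>\<omega>. payoff (\<tau> j) \<omega> \<partial>M)" by (rule H.real_cond_exp_int(2)[OF int])
      also have "\<dots> = (\<integral>\<omega>. \<xi> (\<tau> j \<omega>) \<omega> + G (\<tau> j \<omega>) \<omega> - G (S \<omega>) \<omega> \<partial>M)"
        using eq[of j] \<xi>_stopped[OF \<tau>(1)] G_stopped[OF \<tau>(1)] G_stopped[OF S] int[of j]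
        by (intro integral_cong_AE) (auto elim: eventually_mono)
      finally show ?thesis
        using \<tau>(3)[of j] C_int Y_int \<xi>_stopped[OF \<tau>(1)] G_stopped[OF \<tau>(1)] G_stopped[OF S] by simp
    qed
    have "AE \<omega> in M. \<forall>\<epsilon>>0. \<exists>j. ennreal (Y (S \<omega>) \<omega> - ?C (\<tau> j) \<omega>) < ennreal \<epsilon>"
    proof (rule INF_eq_zero_AE)
      fix \<epsilon> :: real assume "0 < \<epsilon>"
      then obtain j where j: "1 / real (Suc j) < \<epsilon>" using nat_approx_posE by blast
      have "(\<integral>\<^sup>+\<omega>. ennreal (Y (S \<omega>) \<omega> - ?C (\<tau> j) \<omega>) \<partial>M) = ennreal (\<integral>\<omega>. Y (S \<omega>) \<omega> - ?C (\<tau> j) \<omega> \<partial>M)"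
        using C_int Y_int le[of j] by (intro nn_integral_eq_integral) auto
      also have "\<dots> \<le> ennreal \<epsilon>" using small[of j] j by (intro ennreal_leI) simp
      finally show "\<exists>j. (\<integral>\<^sup>+\<omega>. ennreal (Y (S \<omega>) \<omega> - ?C (\<tau> j) \<omega>) \<partial>M) \<le> ennreal \<epsilon>" by blast
    qed (use C_int Y_int in \<open>intro measurable_compose[OF _ measurable_ennreal] borel_measurable_diff, auto\<close>)
    moreover have "AE \<omega> in M. \<forall>j. ereal (?C (\<tau> j) \<omega>) \<le> h \<omega>"
      unfolding AE_all_countable
    proof
      fix j
      have "AE \<omega> in M. S0 \<omega> \<le> \<tau> j \<omega> \<and> \<tau> j \<omega> \<le> T"
        using S_eq
      proof eventually_elim
        case (elim \<omega>)
        then show ?case using \<tau>(2)[of \<omega> j] bounded_timeD(3)[OF \<tau>(1)] by simp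
      qed
      then have "\<tau> j \<in> stopping_times M F T S0"
        using bounded_timeD(1)[OF \<tau>(1)] by (simp add: stopping_times_def)
      then show "AE \<omega> in M. ereal (?C (\<tau> j) \<omega>) \<le> h \<omega>"
        by (rule is_ess_supD(2)[OF sup])
    qed
    ultimately show ?thesis
    proof eventually_elim
      case (elim \<omega>)
      show ?case
      proof (rule ereal_le_epsilon2)
        fix \<epsilon> :: real assume \<epsilon>: "0 < \<epsilon>"
        then obtain j where "ennreal (Y (S \<omega>) \<omega> - ?C (\<tau> j) \<omega>) < ennreal \<epsilon>" using elim(1) by blast
        then have "Y (S \<omega>) \<omega> - ?C (\<tau> j) \<omega> < \<epsilon>"
          using \<epsilon> by (metis ennreal_leI not_le)
        then have "ereal (Y (S \<omega>) \<omega>) \<le> ereal (?C (\<tau> j) \<omega>) + ereal \<epsilon>" by simp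
        also have "\<dots> \<le> h \<omega> + ereal \<epsilon>" using elim(2) by (intro add_right_mono) blast
        finally show "ereal (Y (S \<omega>) \<omega>) \<le> h \<omega> + ereal \<epsilon>" .
      qed
    qed
  qed
  ultimately have "AE \<omega> in M. ereal (Y (S0 \<omega>) \<omega>) = h \<omega>"
    using S_eq by eventually_elim (simp add: order_antisym)
  then show ?thesis by (simp add: h_def payoff_def[abs_def])
qed

end


section \<open>Reflected equations with a barrier of class $S^2$\<close>

theorem theorem3p9:
  fixes M :: "'a measure" and F :: "real \<Rightarrow> 'a measure" and T :: real
    and \<mu> :: "'e measure" and W :: "real \<Rightarrow> 'a \<Rightarrow> real" and N :: "'a \<Rightarrow> (real \<times> 'e) measure"
    and g :: "real \<Rightarrow> 'a \<Rightarrow> real" and \<xi> :: "real \<Rightarrow> 'a \<Rightarrow> real"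
    and \<xi>n :: "nat \<Rightarrow> real \<Rightarrow> 'a \<Rightarrow> real"
    and Yn Zn An :: "nat \<Rightarrow> real \<Rightarrow> 'a \<Rightarrow> real"
    and Ln :: "nat \<Rightarrow> real \<Rightarrow> 'a \<Rightarrow> 'e \<Rightarrow> real"
    and Y :: "real \<Rightarrow> 'a \<Rightarrow> real"
  assumes T_pos: "T > 0"
    and mu: "sigma_finite_measure \<mu>"
    and basis: "filtered_prob_space M F"
    and complete: "complete_filtration M F"
    and right_cont: "right_continuous_filtration F"
    and qlc: "quasi_left_continuous M F"
    and W: "brownian_motion M F W"
    and N: "poisson_random_measure M F \<mu> N"
    and WN: "independent_noises M \<mu> W N"
    and xi_S2: "in_S2 M F T \<xi>"
    and xi_rusc: "right_usc M F T \<xi>"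
    and g_prog: "progressive_process F T g"
    and g_L2: "H2_norm_sq M T g < \<infinity>"
    and xin: "\<And>n. optional_process M F T (\<xi>n n) \<and> rcll_process M T (\<xi>n n) \<and>
                    sup_norm_sq M T (\<xi>n n) < \<infinity>"
    and xin_mono: "AE \<omega> in M. \<forall>t\<in>{0..T}. decseq (\<lambda>n. \<xi>n n t \<omega>)"
    and xin_ge: "AE \<omega> in M. \<forall>t\<in>{0..T}. \<forall>n. \<xi> t \<omega> \<le> \<xi>n n t \<omega>"
    and xin_lim: "AE \<omega> in M. \<forall>t\<in>{0..T}. (\<lambda>n. \<xi>n n t \<omega>) \<longlonglongrightarrow> \<xi> t \<omega>"
    and xin_S2: "(\<lambda>n. S2_norm_sq M F T (\<lambda>t \<omega>. \<xi>n n t \<omega> - \<xi> t \<omega>)) \<longlonglongrightarrow> 0"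
    and sol: "\<And>n. rbsde_solution M F T \<mu> W N g (\<xi>n n) (Yn n) (Zn n) (Ln n) (An n)"
    and Yn_mono: "AE \<omega> in M. \<forall>t\<in>{0..T}. decseq (\<lambda>n. Yn n t \<omega>)"
    and Y_def: "\<And>t \<omega>. Y t \<omega> = lim (\<lambda>n. Yn n t \<omega>)"
    and Y_L2: "converges_in_L2 (restr_to_subalg M (F T) \<Otimes>\<^sub>M restrict_space lborel {0..T})
                 (\<lambda>n (\<omega>, t). Yn n t \<omega>) (\<lambda>(\<omega>, t). Y t \<omega>)"
  shows "(\<forall>S\<in>stopping_times0 M F T. AE \<omega> in M.
            ereal (Y (S \<omega>) \<omega>) =
              ess_sup M (stopping_times M F T S)
                (\<lambda>\<tau> \<omega>. ereal (real_cond_exp M (sigma_at M F S)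
                   (\<lambda>\<omega>. \<xi> (\<tau> \<omega>) \<omega> + (LINT u:{S \<omega>..\<tau> \<omega>}|lborel. g u \<omega>)) \<omega>)) \<omega>)
       \<and> (AE \<omega> in M. \<forall>t\<in>{0..<T}. \<exists>y.
            ((\<lambda>u. Y u \<omega>) \<longlongrightarrow> y) (at_right t) \<and> Y t \<omega> = max (\<xi> t \<omega>) y)
       \<and> (\<forall>\<tau>\<in>predictable_times0 M F T. AE \<omega> in M. 0 < \<tau> \<omega> \<longrightarrow> (\<exists>y.
            ((\<lambda>u. Y u \<omega>) \<longlongrightarrow> y) (at_left (\<tau> \<omega>)) \<and>
            ereal y = max (Limsup (at_left (\<tau> \<omega>)) (\<lambda>u. ereal (\<xi> u \<omega>))) (ereal (Y (\<tau> \<omega>) \<omega>))))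
       \<and> in_S2 M F T Y \<and> (\<lambda>n. S2_norm_sq M F T (\<lambda>t \<omega>. Yn n t \<omega> - Y t \<omega>)) \<longlonglongrightarrow> 0"
proof -
  interpret usual_conditions M F T
    using T_pos basis complete right_cont by (rule usual_conditions.intro)
  obtain G R where G: "adapted_process F T G" "\<forall>\<omega>\<in>space M. continuous_on {0..T} (\<lambda>t. G t \<omega>)"
      "integrable M R" "AE \<omega> in M. \<forall>t\<in>{0..T}. \<bar>G t \<omega>\<bar> \<le> R \<omega>"
    and g_eq: "AE \<omega> in M. \<forall>s t. 0 \<le> s \<and> s \<le> t \<and> t \<le> T \<longrightarrow>
      (LINT u:{s..t}|lborel. g u \<omega>) = G t \<omega> - G s \<omega>"
    using driver_integral[OF g_prog g_L2] by blast
  interpret driven M F T G R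
    by unfold_locales (use G in auto)
  interpret reflected_limit M F T G R \<xi> Y \<xi>n Yn An
  proof (rule reflected_limit.intro[OF driven_axioms reflected_limit_axioms.intro])
    show "reflected M F T G R (\<xi>n n) (Yn n) (An n)" for n
      using xin[of n] by (intro rbsde_solution_reflected[OF mu W N g_eq _ _ _ sol]) auto
  qed (fact xin_mono xin_lim xin_S2 Yn_mono Y_def)+
  \<comment> \<open>The right limit is \<open>Y t \<omega>\<close> itself.\<close>
  have right: "AE \<omega> in M. \<forall>t\<in>{0..<T}. \<exists>y.
      ((\<lambda>u. Y u \<omega>) \<longlongrightarrow> y) (at_right t) \<and> Y t \<omega> = max (\<xi> t \<omega>) y"
    using right_limit \<xi>_le_Y
  proof eventually_elim
    case (elim \<omega>)
    show ?case
    proof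
      fix t assume "t \<in> {0..<T}"
      then show "\<exists>y. ((\<lambda>u. Y u \<omega>) \<longlongrightarrow> y) (at_right t) \<and> Y t \<omega> = max (\<xi> t \<omega>) y"
        using elim by (intro exI[of _ "Y t \<omega>"]) (auto simp: max_absorb2)
    qed
  qed
  show ?thesis
    using optimal_stopping_value[OF g_eq] right left_limit[OF qlc] Y_in_S2 S2_convergence
    by (intro conjI ballI)
qed

end
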